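(* Let $\Xi=(\mathbb{X},d,\mu^*,\{\lambda_k\},\{\phi_k\})$ be an admissible system, with $\{\phi_k\}$ an orthonormal set in $L^2(\mu^* )$, satisfying the Gaussian upper bound condition with exponent $q>0$. Let $U$ be a partial isometry on $L^2(\mu^* )$, let $\psi_k=U^*\phi_k$, and let $\Xi'=(\mathbb{X},d,\mu^*,\{\lambda_k\},\{\psi_k\})$ be the associated admissible system, $\{\psi_k\}$ being also an orthonormal system. Assume that there is a constant $c>0$ such that $\mu^*(\mathbb{B}(x,r))\le c\,r^q$ for all $x\in\mathbb{X}$, $r>0$. Let $1\le p\le\infty$, $f\in L^1(\mu^* )+L^\infty(\mu^* )$, $Uf\in X^p(\Xi)$, and let $h$ be a sufficiently smooth low pass filter. Then: (a) There is a constant $c>0$ independent of $f$ and $n$ such that for all $n\ge 1$, $$E_{n,p}(\Xi;Uf)\le \|Uf-\sigma_n(\Xi,\Xi';h,f)\|_{\mathbb{X},\mu^*,p}\le c\,E_{n/2,p}(\Xi;Uf).$$ (b) In the sense of $L^p(\mu^* )$ convergence, $Uf=\sum_{j=0}^\infty\tau_j(\Xi,\Xi';h,f)$. (c) If $p=2$, then $$\sum_{j=0}^\infty\|\tau_j(\Xi,\Xi';h,f)\|_{\mathbb{X},\mu^*,2}^2\le\|Uf\|_{\mathbb{X},\mu^*,2}^2\le 5\sum_{j=0}^\infty\|\tau_j(\Xi,\Xi';h,f)\|_{\mathbb{X},\mu^*,2}^2.$$ (d) Let $0<\rho\le\infty$, $\gamma>0$. Then $Uf\in B_{p,\rho,\gamma}(\Xi)$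 if and only if $\{\|\tau_j(\Xi,\Xi';h,f)\|_{\mathbb{X},\mu^*,p}\}_{j=0}^\infty\in\mathsf{b}_{\rho,\gamma}$.
   Context: A quasi-metric is a symmetric nonnegative function vanishing exactly on the diagonal and satisfying $d(x,y)\le C(d(x,z)+d(z,y))$ for some constant $C$. For a measure $\nu$ on $\mathbb{X}$, $\|f\|_{\mathbb{X},\nu,p}$ is the usual $L^p$ norm with respect to $|\nu|$; $L^p(\mu^* )=L^p(\mathbb{X},\mu^* )$. Bessel system: $\{\phi_k\}_{k=0}^\infty\subset L^2(\mu^* )$ is a Bessel system if there are a subset $\mathcal{D}\subset L^1(\mu^* )\cap L^\infty(\mu^* )$ dense in $L^2(\mu^* )$ and a (finite valued) functional $\mathcal{N}$ on $L^2(\mu^* )$ with $\sum_{k}|\int f\overline{\phi_k}\,d\mu^*|^2\le\mathcal{N}(f)$ for $f\in\mathcal{D}$. Admissible system: a tuple $\Xi=(\mathbb{X},d,\mu^*,\{\lambda_k\},\{\phi_k\})$ where $\mathbb{X}$ is a locally compact quasi-metric space with quasi-metric $d$ and sigma-finite positive Borel measure $\mu^*$; $\{\lambda_k\}_{k\ge0}$ is a non-decreasing sequence of nonnegative numbers with $\lambda_0=0$, $\lambda_k\to\infty$; and $\{\phi_k\}$ is a Bessel system in $L^2(\mu^* )$ with each $\phi_k$ continuous, bounded and integrable. $\mathbb{B}(x,r)=\{y\in\mathbb{X}:d(x,y)\le r\}$. Gaussian upper bound condition with exponent $q$: the series $K_t(\Xi;x,y)=\sum_{k}\exp(-\lambda_k^2t)\phi_k(x)\overline{\phi_k(y)}$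 converges for all $x,y$, and there are constants $c_1,c_2>0$ with $|K_t(\Xi;x,y)|\le c_1t^{-q/2}\exp(-c_2d(x,y)^2/t)$ for $0<t\le1$, $x,y\in\mathbb{X}$. Low pass filter: an even function $h:\mathbb{R}\to[0,1]$, non-increasing on $[0,\infty)$, with $h(u)=1$ if $|u|<1/2$ and $h(u)=0$ if $|u|\ge1$. Here $h$ is "sufficiently smooth" if there are an integer $S>q+1$ and a signed measure $h^{[S]}$ on $[0,\infty)$ (of bounded variation on compact intervals) with $h(u)=\int_0^\infty(v^2-u^2)_+^S\,dh^{[S]}(v)$ for $u\ge0$ and $\int_0^\infty(v+2)^q(v^S+v^{2S})\,d|h^{[S]}|(v)<\infty$, where $x_+^S=x^S$ if $x>0$ and $0$ otherwise. Coefficients: $\hat f(\Xi;k)=\int f\overline{\phi_k}\,d\mu^*$, $\hat f(\Xi';k)=\int f\overline{\psi_k}\,d\mu^*$. For $f\in L^2(\mu^* )$, $Uf$ is the value of the operator $U$; for other $f\in L^1(\mu^* )+L^\infty(\mu^* )$, "$Uf\in X^p(\Xi)$" means that there is a function in $X^p(\Xi)$, denoted $Uf$, with $\widehat{Uf}(\Xi;k)=\hat f(\Xi';k)$ for all $k$. For $n>0$: $\Pi_n(\Xi)=\mathrm{span}\{\phi_k:\lambda_k<n\}$; $E_{n,p}(\Xi;g)=\inf_{P\in\Pi_n(\Xi)}\|g-P\|_{\mathbb{X},\mu^*,p}$ for $g\in L^p(\mu^* )$; $X^p(\Xi)$ is the set of $g\in L^p(\mu^* )$ with $E_{n,p}(\Xi;g)\to0$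 as $n\to\infty$. Sequence space: $\mathsf{b}_{\rho,\gamma}$ is the set of sequences $\{a_j\}_{j\ge0}$ with $\left(\sum_{j}2^{\gamma\rho j}|a_j|^\rho\right)^{1/\rho}<\infty$ if $0<\rho<\infty$, or $\sup_j2^{j\gamma}|a_j|<\infty$ if $\rho=\infty$. Besov space: $B_{p,\rho,\gamma}(\Xi)$ is the set of $g\in X^p(\Xi)$ with $\{E_{2^j,p}(\Xi;g)\}_{j\ge0}\in\mathsf{b}_{\rho,\gamma}$. Operators: $\sigma_n(\Xi,\Xi';h,f,x)=\sum_{k=0}^\infty h(\lambda_k/n)\hat f(\Xi';k)\phi_k(x)$; $\tau_0(\Xi,\Xi';h,f)=\sigma_1(\Xi,\Xi';h,f)$ and $\tau_j(\Xi,\Xi';h,f)=\sigma_{2^j}(\Xi,\Xi';h,f)-\sigma_{2^{j-1}}(\Xi,\Xi';h,f)$ for $j\ge1$. *)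

theory Defs
  imports "HOL-Probability.Essential_Supremum"
begin

section \<open>Quasi-metric spaces\<close>

definition quasi_metric :: "('a \<Rightarrow> 'a \<Rightarrow> real) \<Rightarrow> bool" where
  "quasi_metric d \<longleftrightarrow>
     (\<forall>x y. 0 \<le> d x y) \<and> (\<forall>x y. d x y = d y x) \<and> (\<forall>x y. d x y = 0 \<longleftrightarrow> x = y) \<and>
     (\<exists>C. \<forall>x y z. d x y \<le> C * (d x z + d z y))"

definition qball :: "('a \<Rightarrow> 'a \<Rightarrow> real) \<Rightarrow> 'a \<Rightarrow> real \<Rightarrow> 'a set" where
  "qball d x r = {y. d x y \<le> r}"

text \<open>The space is the whole type; its topology is the one generated by the quasi-metric.
  A ball of a quasi-metric need not be open, nor even Borel, but every ball contains an open
  neighbourhood of its centre.\<close>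

definition locally_compact_quasi_metric_space :: "('a::topological_space \<Rightarrow> 'a \<Rightarrow> real) \<Rightarrow> bool" where
  "locally_compact_quasi_metric_space d \<longleftrightarrow>
     quasi_metric d \<and>
     (\<forall>V. open V \<longleftrightarrow> (\<forall>x\<in>V. \<exists>r>0. qball d x r \<subseteq> V)) \<and>
     locally_compact_space (euclidean :: 'a topology)"

text \<open>The outer measure coincides with the measure on every ball that is measurable, so nothing is
  demanded about the measurability of balls (the value \<open>emeasure M\<close> takes on a non-measurable
  set is the default value 0, which would make the bound void there).\<close>

definition ball_measure_bound :: "('a \<Rightarrow> 'a \<Rightarrow> real) \<Rightarrow> 'a measure \<Rightarrow> real \<Rightarrow> bool" where
  "ball_measure_bound d M q \<longleftrightarrow>
     (\<exists>c>0. \<forall>x r. r > 0 \<longrightarrow> outer_measure_of M (qball d x r) \<le> ennreal (c * r powr q))"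

section \<open>Lebesgue spaces\<close>

text \<open>Power of an extended nonnegative number with a positive real exponent.\<close>

definition epowr :: "ennreal \<Rightarrow> real \<Rightarrow> ennreal" where
  "epowr x r = (if x = \<infinity> then \<infinity> else ennreal (enn2real x powr r))"

definition Lp_norm :: "'a measure \<Rightarrow> ennreal \<Rightarrow> ('a \<Rightarrow> complex) \<Rightarrow> ennreal" where
  "Lp_norm M p f =
     (if p = \<infinity> then esssup M (\<lambda>x. ennreal (cmod (f x)))
      else epowr (\<integral>\<^sup>+x. ennreal (cmod (f x) powr enn2real p) \<partial>M) (1 / enn2real p))"

text \<open>Elements are functions, not classes modulo equality almost everywhere.\<close>

definition Lp_space :: "'a measure \<Rightarrow> ennreal \<Rightarrow> ('a \<Rightarrow> complex) set" where
  "Lp_space M p = {f \<in> borel_measurable M. Lp_norm M p f < \<infinity>}"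

definition L1_plus_Linf :: "'a measure \<Rightarrow> ('a \<Rightarrow> complex) set" where
  "L1_plus_Linf M = {(\<lambda>x. f1 x + f2 x) | f1 f2. f1 \<in> Lp_space M 1 \<and> f2 \<in> Lp_space M \<infinity>}"

definition L2_inner :: "'a measure \<Rightarrow> ('a \<Rightarrow> complex) \<Rightarrow> ('a \<Rightarrow> complex) \<Rightarrow> complex" where
  "L2_inner M f g = (LINT x|M. f x * cnj (g x))"

definition orthonormal_system :: "'a measure \<Rightarrow> (nat \<Rightarrow> 'a \<Rightarrow> complex) \<Rightarrow> bool" where
  "orthonormal_system M \<phi> \<longleftrightarrow>
     (\<forall>k. \<phi> k \<in> Lp_space M 2) \<and>
     (\<forall>j k. L2_inner M (\<phi> j) (\<phi> k) = (if j = k then 1 else 0))"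

section \<open>Operators on the space of square integrable functions\<close>

text \<open>An operator acts on representatives; it respects equality almost everywhere and is linear up to
  equality almost everywhere.\<close>

definition L2_bounded_operator :: "'a measure \<Rightarrow> (('a \<Rightarrow> complex) \<Rightarrow> ('a \<Rightarrow> complex)) \<Rightarrow> bool" where
  "L2_bounded_operator M T \<longleftrightarrow>
     (\<forall>f\<in>Lp_space M 2. T f \<in> Lp_space M 2) \<and>
     (\<forall>f\<in>Lp_space M 2. \<forall>g\<in>Lp_space M 2. (AE x in M. f x = g x) \<longrightarrow> (AE x in M. T f x = T g x)) \<and>
     (\<forall>f\<in>Lp_space M 2. \<forall>g\<in>Lp_space M 2. \<forall>a b.
        AE x in M. T (\<lambda>y. a * f y + b * g y) x = a * T f x + b * T g x) \<and>
     (\<exists>C::real. \<forall>f\<in>Lp_space M 2. Lp_norm M 2 (T f) \<le> ennreal C * Lp_norm M 2 f)"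

definition L2_kernel :: "'a measure \<Rightarrow> (('a \<Rightarrow> complex) \<Rightarrow> ('a \<Rightarrow> complex)) \<Rightarrow> ('a \<Rightarrow> complex) set" where
  "L2_kernel M T = {f \<in> Lp_space M 2. AE x in M. T f x = 0}"

text \<open>Isometric on the orthogonal complement of the kernel.\<close>

definition partial_isometry :: "'a measure \<Rightarrow> (('a \<Rightarrow> complex) \<Rightarrow> ('a \<Rightarrow> complex)) \<Rightarrow> bool" where
  "partial_isometry M U \<longleftrightarrow>
     L2_bounded_operator M U \<and>
     (\<forall>f\<in>Lp_space M 2. (\<forall>g\<in>L2_kernel M U. L2_inner M f g = 0) \<longrightarrow>
        Lp_norm M 2 (U f) = Lp_norm M 2 f)"

text \<open>\<open>V\<close> is the adjoint of \<open>U\<close>; it is determined up to equality almost everywhere.\<close>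

definition L2_adjoint ::
  "'a measure \<Rightarrow> (('a \<Rightarrow> complex) \<Rightarrow> ('a \<Rightarrow> complex)) \<Rightarrow> (('a \<Rightarrow> complex) \<Rightarrow> ('a \<Rightarrow> complex)) \<Rightarrow> bool" where
  "L2_adjoint M U V \<longleftrightarrow>
     L2_bounded_operator M V \<and>
     (\<forall>f\<in>Lp_space M 2. \<forall>g\<in>Lp_space M 2. L2_inner M (U f) g = L2_inner M f (V g))"

section \<open>Admissible systems\<close>

definition coeff :: "'a measure \<Rightarrow> (nat \<Rightarrow> 'a \<Rightarrow> complex) \<Rightarrow> ('a \<Rightarrow> complex) \<Rightarrow> nat \<Rightarrow> complex" where
  "coeff M \<phi> f k = (LINT x|M. f x * cnj (\<phi> k x))"

text \<open>\<open>N\<close> is a functional on classes modulo equality almost everywhere.\<close>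

definition bessel_system :: "'a measure \<Rightarrow> (nat \<Rightarrow> 'a \<Rightarrow> complex) \<Rightarrow> bool" where
  "bessel_system M \<phi> \<longleftrightarrow>
     (\<forall>k. \<phi> k \<in> Lp_space M 2) \<and>
     (\<exists>D. \<exists>N :: ('a \<Rightarrow> complex) \<Rightarrow> real.
        D \<subseteq> Lp_space M 1 \<inter> Lp_space M \<infinity> \<and>
        (\<forall>f\<in>Lp_space M 2. \<forall>\<epsilon>>0. \<exists>g\<in>D. Lp_norm M 2 (\<lambda>x. f x - g x) < \<epsilon>) \<and>
        (\<forall>f\<in>Lp_space M 2. \<forall>g\<in>Lp_space M 2. (AE x in M. f x = g x) \<longrightarrow> N f = N g) \<and>
        (\<forall>f\<in>D. (\<Sum>k. ennreal ((cmod (coeff M \<phi> f k))\<^sup>2)) \<le> ennreal (N f)))"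

definition admissible_system ::
  "('a::topological_space \<Rightarrow> 'a \<Rightarrow> real) \<Rightarrow> 'a measure \<Rightarrow> (nat \<Rightarrow> real) \<Rightarrow> (nat \<Rightarrow> 'a \<Rightarrow> complex) \<Rightarrow> bool" where
  "admissible_system d M lam \<phi> \<longleftrightarrow>
     locally_compact_quasi_metric_space d \<and>
     sets M = sets borel \<and> sigma_finite_measure M \<and>
     (\<forall>k. 0 \<le> lam k) \<and> incseq lam \<and> lam 0 = 0 \<and> filterlim lam at_top sequentially \<and>
     bessel_system M \<phi> \<and>
     (\<forall>k. continuous_on UNIV (\<phi> k) \<and> bounded (range (\<phi> k)) \<and> integrable M (\<phi> k))"

definition heat_kernel ::
  "(nat \<Rightarrow> real) \<Rightarrow> (nat \<Rightarrow> 'a \<Rightarrow> complex) \<Rightarrow> real \<Rightarrow> 'a \<Rightarrow> 'a \<Rightarrow> complex" where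
  "heat_kernel lam \<phi> t x y = (\<Sum>k. complex_of_real (exp (- (lam k)\<^sup>2 * t)) * \<phi> k x * cnj (\<phi> k y))"

definition gaussian_upper_bound ::
  "('a \<Rightarrow> 'a \<Rightarrow> real) \<Rightarrow> (nat \<Rightarrow> real) \<Rightarrow> (nat \<Rightarrow> 'a \<Rightarrow> complex) \<Rightarrow> real \<Rightarrow> bool" where
  "gaussian_upper_bound d lam \<phi> q \<longleftrightarrow>
     (\<forall>t>0. \<forall>x y. summable (\<lambda>k. complex_of_real (exp (- (lam k)\<^sup>2 * t)) * \<phi> k x * cnj (\<phi> k y))) \<and>
     (\<exists>c1>0. \<exists>c2>0. \<forall>t x y. 0 < t \<and> t \<le> 1 \<longrightarrow>
        cmod (heat_kernel lam \<phi> t x y) \<le> c1 * t powr (- q / 2) * exp (- c2 * (d x y)\<^sup>2 / t))"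

section \<open>Low pass filters\<close>

definition low_pass_filter :: "(real \<Rightarrow> real) \<Rightarrow> bool" where
  "low_pass_filter h \<longleftrightarrow>
     (\<forall>u. 0 \<le> h u \<and> h u \<le> 1) \<and> (\<forall>u. h (- u) = h u) \<and> antimono_on {0..} h \<and>
     (\<forall>u. \<bar>u\<bar> < 1 / 2 \<longrightarrow> h u = 1) \<and> (\<forall>u. \<bar>u\<bar> \<ge> 1 \<longrightarrow> h u = 0)"

definition trunc_power :: "nat \<Rightarrow> real \<Rightarrow> real" where
  "trunc_power S x = (if x > 0 then x ^ S else 0)"

text \<open>A signed measure on the half-line, of bounded variation on compact intervals, given by its Jordan
  decomposition: \<open>P - N\<close> with mutually singular positive parts, the total variation
  being \<open>P + N\<close>. Both parts may be infinite on the whole half-line.\<close>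

definition half_line_signed_measure :: "real measure \<Rightarrow> real measure \<Rightarrow> bool" where
  "half_line_signed_measure P N \<longleftrightarrow>
     sets P = sets (restrict_space borel {0..}) \<and> sets N = sets (restrict_space borel {0..}) \<and>
     (\<exists>A\<in>sets (restrict_space borel {0..}). emeasure P A = 0 \<and> emeasure N ({0..} - A) = 0) \<and>
     (\<forall>b\<ge>0. emeasure P {0..b} < \<infinity> \<and> emeasure N {0..b} < \<infinity>)"

definition sufficiently_smooth :: "real \<Rightarrow> (real \<Rightarrow> real) \<Rightarrow> bool" where
  "sufficiently_smooth q h \<longleftrightarrow>
     (\<exists>S::nat. \<exists>P N. real S > q + 1 \<and> half_line_signed_measure P N \<and>
        (\<forall>u\<ge>0. h u = (LINT v|P. trunc_power S (v\<^sup>2 - u\<^sup>2)) - (LINT v|N. trunc_power S (v\<^sup>2 - u\<^sup>2))) \<and>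
        (\<integral>\<^sup>+v. ennreal ((v + 2) powr q * (v ^ S + v ^ (2 * S))) \<partial>P)
          + (\<integral>\<^sup>+v. ennreal ((v + 2) powr q * (v ^ S + v ^ (2 * S))) \<partial>N) < \<infinity>)"

section \<open>Approximation spaces\<close>

text \<open>The complex linear span of the \<open>\<phi> k\<close> with \<open>lam k < n\<close>.\<close>

definition diffusion_polys ::
  "(nat \<Rightarrow> real) \<Rightarrow> (nat \<Rightarrow> 'a \<Rightarrow> complex) \<Rightarrow> real \<Rightarrow> ('a \<Rightarrow> complex) set" where
  "diffusion_polys lam \<phi> n =
     {(\<lambda>x. \<Sum>k\<in>A. c k * \<phi> k x) | A c. finite A \<and> A \<subseteq> {k. lam k < n}}"

definition approx_error ::
  "'a measure \<Rightarrow> (nat \<Rightarrow> real) \<Rightarrow> (nat \<Rightarrow> 'a \<Rightarrow> complex) \<Rightarrow> real \<Rightarrow> ennreal \<Rightarrow> ('a \<Rightarrow> complex) \<Rightarrow> ennreal" where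
  "approx_error M lam \<phi> n p g = (INF P\<in>diffusion_polys lam \<phi> n. Lp_norm M p (\<lambda>x. g x - P x))"

definition X_space ::
  "'a measure \<Rightarrow> (nat \<Rightarrow> real) \<Rightarrow> (nat \<Rightarrow> 'a \<Rightarrow> complex) \<Rightarrow> ennreal \<Rightarrow> ('a \<Rightarrow> complex) set" where
  "X_space M lam \<phi> p =
     {g \<in> Lp_space M p. ((\<lambda>n. approx_error M lam \<phi> n p g) \<longlongrightarrow> 0) at_top}"

text \<open>Sequences of absolute values \<open>a j\<close>, in the extended nonnegative numbers; membership forces all terms
  to be finite.\<close>

definition b_space :: "ennreal \<Rightarrow> real \<Rightarrow> (nat \<Rightarrow> ennreal) set" where
  "b_space \<rho> \<gamma> =
     {a. if \<rho> = \<infinity> then (SUP j. ennreal (2 powr (real j * \<gamma>)) * a j) < \<infinity>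
         else epowr (\<Sum>j. ennreal (2 powr (\<gamma> * enn2real \<rho> * real j)) * epowr (a j) (enn2real \<rho>))
                (1 / enn2real \<rho>) < \<infinity>}"

definition besov_space ::
  "'a measure \<Rightarrow> (nat \<Rightarrow> real) \<Rightarrow> (nat \<Rightarrow> 'a \<Rightarrow> complex) \<Rightarrow> ennreal \<Rightarrow> ennreal \<Rightarrow> real \<Rightarrow> ('a \<Rightarrow> complex) set" where
  "besov_space M lam \<phi> p \<rho> \<gamma> =
     {g \<in> X_space M lam \<phi> p. (\<lambda>j. approx_error M lam \<phi> (2 ^ j) p g) \<in> b_space \<rho> \<gamma>}"

section \<open>Reconstruction operators\<close>

text \<open>The coefficients are taken with respect to \<open>\<psi>\<close>, the expansion is in terms of \<open>\<phi>\<close>. When the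
  \<open>lam k\<close> tend to infinity and \<open>h\<close> is a low pass filter, the series has finitely many nonzero
  terms.\<close>

definition sigma_op ::
  "'a measure \<Rightarrow> (nat \<Rightarrow> real) \<Rightarrow> (nat \<Rightarrow> 'a \<Rightarrow> complex) \<Rightarrow> (nat \<Rightarrow> 'a \<Rightarrow> complex) \<Rightarrow>
   (real \<Rightarrow> real) \<Rightarrow> real \<Rightarrow> ('a \<Rightarrow> complex) \<Rightarrow> 'a \<Rightarrow> complex" where
  "sigma_op M lam \<phi> \<psi> h n f x =
     (\<Sum>k. complex_of_real (h (lam k / n)) * coeff M \<psi> f k * \<phi> k x)"

definition tau_op ::
  "'a measure \<Rightarrow> (nat \<Rightarrow> real) \<Rightarrow> (nat \<Rightarrow> 'a \<Rightarrow> complex) \<Rightarrow> (nat \<Rightarrow> 'a \<Rightarrow> complex) \<Rightarrow>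
   (real \<Rightarrow> real) \<Rightarrow> nat \<Rightarrow> ('a \<Rightarrow> complex) \<Rightarrow> 'a \<Rightarrow> complex" where
  "tau_op M lam \<phi> \<psi> h j f x =
     (if j = 0 then sigma_op M lam \<phi> \<psi> h 1 f x
      else sigma_op M lam \<phi> \<psi> h (2 ^ j) f x - sigma_op M lam \<phi> \<psi> h (2 ^ (j - 1)) f x)"

text \<open>\<open>g\<close> is \<open>U f\<close>: the value of the operator for square integrable \<open>f\<close>, and otherwise a function
  whose coefficients with respect to \<open>\<phi>\<close> are those of \<open>f\<close> with respect to \<open>\<psi>\<close>.\<close>

definition is_image ::
  "'a measure \<Rightarrow> (nat \<Rightarrow> 'a \<Rightarrow> complex) \<Rightarrow> (nat \<Rightarrow> 'a \<Rightarrow> complex) \<Rightarrow>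
   (('a \<Rightarrow> complex) \<Rightarrow> ('a \<Rightarrow> complex)) \<Rightarrow> ('a \<Rightarrow> complex) \<Rightarrow> ('a \<Rightarrow> complex) \<Rightarrow> bool" where
  "is_image M \<phi> \<psi> U f g \<longleftrightarrow>
     (if f \<in> Lp_space M 2 then AE x in M. g x = U f x
      else \<forall>k. coeff M \<phi> g k = coeff M \<psi> f k)"

end

theory Submission
  imports Defs "HOL-Complex_Analysis.Complex_Analysis" "HOL-Real_Asymp.Real_Asymp"
begin

text \<open>Everything follows from a bound, uniform in \<open>n \<ge> 1\<close> and \<open>x\<close>, for the \<open>L\<^sup>1\<close> norm in \<open>y\<close> of the
  kernel \<open>\<Sum>k. h (lam k / n) \<phi>\<^sub>k(x) cnj \<phi>\<^sub>k(y)\<close>: by the Schur test the reconstruction operators are then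
  uniformly bounded on \<open>L\<^sup>p\<close>, and they reproduce the span of the \<open>\<phi>\<^sub>k\<close> with \<open>lam k < n / 2\<close>.

  Since \<open>h\<close> is a superposition of truncated powers, it is enough to bound the Bochner-Riesz kernels
  with multipliers \<open>(w\<^sup>2 - lam\<^sup>2)\<^sub>+\<^sup>S\<close> by a multiple of \<open>w\<close> to the power \<open>2 S\<close>. The truncated power is
  the inverse Laplace transform of \<open>z\<close> to the power \<open>- S - 1\<close>, up to a factor \<open>S!\<close>, along the line \<open>Re z = 1 / w\<^sup>2\<close>.
  Restricting the line to \<open>\<bar>Im z\<bar> \<le> Y\<close> turns the kernel into an integral of the heat kernel at
  complex times plus a remainder that is small in \<open>L\<^sup>2\<close> by orthonormality. The Gaussian bound, which
  is known only for real times in \<open>(0, 1]\<close>, is carried over to complex times by a two-constants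
  argument in the quadrant. On the shell where \<open>d x y\<close> is about \<open>\<rho> / w\<close> one takes \<open>Y w\<^sup>2 = 2 \<rho>\<^sup>\<kappa>\<close>
  with \<open>\<kappa> < 1 / 2\<close> so close to \<open>1 / 2\<close> that \<open>\<kappa> S > q / 2\<close>; this is possible because \<open>S > q + 1\<close>.\<close>

section \<open>Norms in Lebesgue spaces\<close>

text \<open>The shape of the argument comes from the fact that decay in \<open>d x y\<close> is
  known only at real times, while the inversion line runs through complex times, where the diagonal
  values alone give no decay at all. What the two-constants argument carries over fades as the line
  grows longer: with Y = 2 Z / w^2 the exponent is of the order of (\<rho> / Z^2)^2, so a height Z =
  \<rho>^\<kappa> is affordable only for \<kappa> < 1/2. The truncation error, on the other hand,
  shrinks like Y^(-S), so the height has to grow with the shell. This error is estimated by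
  Cauchy-Schwarz: the measure of a shell, of order (\<rho> / w)^q, and the diagonal heat kernel, of
  order w^q, enter only through their square roots, and this is the source of the condition \<kappa>
  S > q / 2. Everything happens at scale w, with Re z = 1 / w^2 in the range of times covered by the
  Gaussian bound; parameters w \<le> 2 involve a fixed finite set of functions and are estimated
  without any decay.\<close>

lemma epowr_le_iff:
  assumes "r > 0" "a \<ge> 0"
  shows "epowr x (1 / r) \<le> ennreal a \<longleftrightarrow> x \<le> ennreal (a powr r)"
proof (cases x)
  case (real u)
  have "u powr (1 / r) \<le> a \<longleftrightarrow> u \<le> a powr r"
  proof
    assume "u powr (1 / r) \<le> a"
    then have "(u powr (1 / r)) powr r \<le> a powr r"
      using assms by (intro powr_mono2) auto
    then show "u \<le> a powr r"
      using assms real by (simp add: powr_powr)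
  next
    assume "u \<le> a powr r"
    then have "u powr (1 / r) \<le> (a powr r) powr (1 / r)"
      using assms real by (intro powr_mono2) auto
    then show "u powr (1 / r) \<le> a"
      using assms by (simp add: powr_powr)
  qed
  then show ?thesis
    using real assms by (auto simp: epowr_def ennreal_le_iff)
next
  case top
  then show ?thesis by (auto simp: epowr_def top_unique)
qed

lemma epowr_less_top_iff [simp]: "epowr x r < \<infinity> \<longleftrightarrow> x < \<infinity>" "epowr x r < top \<longleftrightarrow> x < top"
  by (auto simp: epowr_def less_top)

lemma epowr_mono: "x \<le> y \<Longrightarrow> r \<ge> 0 \<Longrightarrow> epowr x r \<le> epowr y r"
  by (cases x; cases y) (auto simp: epowr_def top_unique intro!: ennreal_leI powr_mono2)

lemma enn2real_ge_1: "1 \<le> p \<Longrightarrow> p \<noteq> \<infinity> \<Longrightarrow> 1 \<le> enn2real p"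
  by (cases p) (auto simp flip: ennreal_1)

lemma Lp_norm_le_iff_finite:
  assumes "1 \<le> p" "p \<noteq> \<infinity>" "a \<ge> 0"
  shows "Lp_norm M p f \<le> ennreal a \<longleftrightarrow>
    (\<integral>\<^sup>+x. ennreal (cmod (f x) powr enn2real p) \<partial>M) \<le> ennreal (a powr enn2real p)"
  using assms epowr_le_iff[of "enn2real p" a] enn2real_ge_1[of p] by (simp add: Lp_norm_def)

lemma Lp_norm_le_iff_infty:
  assumes [measurable]: "f \<in> borel_measurable M" and "a \<ge> 0"
  shows "Lp_norm M \<infinity> f \<le> ennreal a \<longleftrightarrow> (AE x in M. cmod (f x) \<le> a)"
proof
  assume *: "Lp_norm M \<infinity> f \<le> ennreal a"
  have "AE x in M. ennreal (cmod (f x)) \<le> Lp_norm M \<infinity> f"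
    unfolding Lp_norm_def by (simp add: esssup_AE)
  then show "AE x in M. cmod (f x) \<le> a"
  proof eventually_elim
    case (elim x)
    then have "ennreal (cmod (f x)) \<le> ennreal a" using * by (rule order_trans)
    then show ?case using \<open>a \<ge> 0\<close> by (simp add: ennreal_le_iff)
  qed
next
  assume "AE x in M. cmod (f x) \<le> a"
  then have "AE x in M. ennreal (cmod (f x)) \<le> ennreal a"
    by eventually_elim (rule ennreal_leI)
  then show "Lp_norm M \<infinity> f \<le> ennreal a"
    unfolding Lp_norm_def by (simp add: esssup_I)
qed

lemma Lp_norm_uminus: "Lp_norm M p (\<lambda>x. - f x) = Lp_norm M p f"
  by (simp add: Lp_norm_def)

text \<open>Convexity is used in tangent form because Minkowski's and Jensen's inequalities then
  need only linearity of the integral. Away from u = 0 it is Bernoulli's inequality for u / m, read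
  off from the weighted arithmetic-geometric mean of (u / m)^r and 1.\<close>

lemma powr_tangent:
  fixes u m r :: real
  assumes "r \<ge> 1" "u \<ge> 0" "m > 0"
  shows "m powr r + r * m powr (r - 1) * (u - m) \<le> u powr r"
proof (cases "u = 0")
  case True
  have "m powr r - r * m powr r \<le> 0"
    using mult_right_mono[OF \<open>r \<ge> 1\<close>, of "m powr r"] by simp
  then show ?thesis using True assms by (simp add: powr_diff)
next
  case False
  have "((u / m) powr r) powr (1 / r) * 1 powr (1 - 1 / r) \<le> 1 / r * (u / m) powr r + (1 - 1 / r) * 1"
    using assms False by (intro Youngs_inequality_0) auto
  then have "u / m \<le> (u / m) powr r / r + 1 - 1 / r"
    using assms False by (simp add: powr_powr)
  then have "r * (u / m) \<le> r * ((u / m) powr r / r + 1 - 1 / r)"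
    using assms by (intro mult_left_mono) auto
  also have "\<dots> = (u / m) powr r + r - 1"
    using assms by (simp add: right_diff_distrib distrib_left)
  finally have "1 + r * (u / m - 1) \<le> (u / m) powr r"
    by (simp add: right_diff_distrib)
  then have "(1 + r * (u / m - 1)) * m powr r \<le> (u / m) powr r * m powr r"
    by (intro mult_right_mono) auto
  then show ?thesis using assms False by (simp add: powr_divide powr_diff field_simps)
qed

text \<open>Jensen's inequality with weights proportional to A and B: both tangents are taken at m =
  (s + t) / (A + B), the weighted mean of s / A and t / B, so the linear terms cancel. In
  Minkowski's inequality A and B normalise the two functions.\<close>

lemma powr_sum_le:
  fixes A B s t r :: real
  assumes "A > 0" "B > 0" "s \<ge> 0" "t \<ge> 0" "r \<ge> 1"
  shows "(s + t) powr r \<le> (A + B) powr r * (A / (A + B) * (s / A) powr r + B / (A + B) * (t / B) powr r)"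
proof (cases "s + t = 0")
  case True
  then show ?thesis using assms by simp
next
  case False
  define m where "m = (s + t) / (A + B)"
  have m: "m > 0" using assms False by (simp add: m_def)
  define D where "D = r * m powr (r - 1)"
  have 1: "m powr r + D * (s / A - m) \<le> (s / A) powr r"
    and 2: "m powr r + D * (t / B - m) \<le> (t / B) powr r"
    using powr_tangent[of r "s / A" m] powr_tangent[of r "t / B" m] assms m by (auto simp: D_def)
  define \<alpha> \<beta> where "\<alpha> = A / (A + B)" and "\<beta> = B / (A + B)"
  have ab: "\<alpha> + \<beta> = 1" "\<alpha> * (s / A) + \<beta> * (t / B) = m"
    using assms by (auto simp: \<alpha>_def \<beta>_def m_def simp flip: add_divide_distrib)
  have "\<alpha> * (m powr r + D * (s / A - m)) + \<beta> * (m powr r + D * (t / B - m))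
     = (\<alpha> + \<beta>) * m powr r + D * ((\<alpha> * (s / A) + \<beta> * (t / B)) - (\<alpha> + \<beta>) * m)"
    by (simp only: algebra_simps)
  also have "\<dots> = m powr r" unfolding ab by simp
  finally have "m powr r \<le> A / (A + B) * (s / A) powr r + B / (A + B) * (t / B) powr r"
    using mult_left_mono[OF 1, of "A / (A + B)"] mult_left_mono[OF 2, of "B / (A + B)"] assms
    unfolding \<alpha>_def \<beta>_def by simp
  then have "(A + B) powr r * m powr r \<le> (A + B) powr r * (A / (A + B) * (s / A) powr r + B / (A + B) * (t / B) powr r)"
    by (intro mult_left_mono) auto
  moreover have "(A + B) powr r * m powr r = (s + t) powr r"
    using assms by (simp add: m_def powr_divide)
  ultimately show ?thesis by simp
qed

text \<open>Strictly positive bounds stand in for the norms, which may be 0 and could then not serve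
  as divisors; the excess is removed afterwards by letting it tend to 0.\<close>

lemma Lp_norm_triangle_aux:
  assumes [measurable]: "f \<in> borel_measurable M" "g \<in> borel_measurable M"
    and p: "1 \<le> p" and A: "A > 0" "Lp_norm M p f \<le> ennreal A"
    and B: "B > 0" "Lp_norm M p g \<le> ennreal B"
  shows "Lp_norm M p (\<lambda>x. f x + g x) \<le> ennreal (A + B)"
proof (cases "p = \<infinity>")
  case True
  have "AE x in M. cmod (f x) \<le> A" "AE x in M. cmod (g x) \<le> B"
    using A B True Lp_norm_le_iff_infty[of f M A] Lp_norm_le_iff_infty[of g M B] by auto
  then have "AE x in M. cmod (f x + g x) \<le> A + B"
    by eventually_elim (use norm_triangle_mono in blast)
  then show ?thesis
    using True A B Lp_norm_le_iff_infty[of "\<lambda>x. f x + g x" M "A + B"] by auto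
next
  case False
  define r where "r = enn2real p"
  have r: "r \<ge> 1" using enn2real_ge_1[OF p False] by (simp add: r_def)
  define a where "a = (A + B) powr r * (A / (A + B)) * (1 / A) powr r"
  define b where "b = (A + B) powr r * (B / (A + B)) * (1 / B) powr r"
  have ab: "a \<ge> 0" "b \<ge> 0" using A B by (auto simp: a_def b_def)
  have fA: "(\<integral>\<^sup>+x. ennreal (cmod (f x) powr r) \<partial>M) \<le> ennreal (A powr r)"
    using A Lp_norm_le_iff_finite[OF p False, of A M f] by (simp add: r_def)
  have gB: "(\<integral>\<^sup>+x. ennreal (cmod (g x) powr r) \<partial>M) \<le> ennreal (B powr r)"
    using B Lp_norm_le_iff_finite[OF p False, of B M g] by (simp add: r_def)
  have "cmod (f x + g x) powr r \<le> a * cmod (f x) powr r + b * cmod (g x) powr r" for x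
  proof -
    have "cmod (f x + g x) powr r \<le> (cmod (f x) + cmod (g x)) powr r"
      using r by (intro powr_mono2) (auto intro: norm_triangle_ineq)
    also have "\<dots> \<le> (A + B) powr r * (A / (A + B) * (cmod (f x) / A) powr r + B / (A + B) * (cmod (g x) / B) powr r)"
      using A B r by (intro powr_sum_le) auto
    also have "\<dots> = a * cmod (f x) powr r + b * cmod (g x) powr r"
      using A B by (simp add: a_def b_def powr_divide field_simps)
    finally show ?thesis .
  qed
  then have "(\<integral>\<^sup>+x. ennreal (cmod (f x + g x) powr r) \<partial>M)
      \<le> (\<integral>\<^sup>+x. ennreal a * ennreal (cmod (f x) powr r) + ennreal b * ennreal (cmod (g x) powr r) \<partial>M)"
    using ab by (intro nn_integral_mono) (auto simp flip: ennreal_mult ennreal_plus intro!: ennreal_leI)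
  also have "\<dots> = ennreal a * (\<integral>\<^sup>+x. ennreal (cmod (f x) powr r) \<partial>M) + ennreal b * (\<integral>\<^sup>+x. ennreal (cmod (g x) powr r) \<partial>M)"
    by (simp add: nn_integral_add nn_integral_cmult)
  also have "\<dots> \<le> ennreal a * ennreal (A powr r) + ennreal b * ennreal (B powr r)"
    using fA gB by (intro add_mono mult_left_mono) auto
  also have "\<dots> = ennreal (a * A powr r + b * B powr r)"
    using ab by (simp add: ennreal_mult ennreal_plus)
  also have "a * A powr r + b * B powr r = (A + B) powr r"
  proof -
    have "a * A powr r = (A + B) powr r * (A / (A + B))" "b * B powr r = (A + B) powr r * (B / (A + B))"
      using A B by (auto simp: a_def b_def powr_divide)
    moreover have "A / (A + B) + B / (A + B) = 1"
      using A B by (simp flip: add_divide_distrib)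
    ultimately show ?thesis by (metis distrib_left mult.right_neutral)
  qed
  finally show ?thesis
    using A B Lp_norm_le_iff_finite[OF p False, of "A + B" M "\<lambda>x. f x + g x"] by (simp add: r_def)
qed

lemma Lp_norm_triangle:
  assumes "f \<in> borel_measurable M" "g \<in> borel_measurable M" and p: "1 \<le> p"
  shows "Lp_norm M p (\<lambda>x. f x + g x) \<le> Lp_norm M p f + Lp_norm M p g"
proof (rule ennreal_le_epsilon)
  fix e :: real assume fin: "Lp_norm M p f + Lp_norm M p g < top" and e: "0 < e"
  then obtain A B where AB: "A \<ge> 0" "B \<ge> 0" "Lp_norm M p f = ennreal A" "Lp_norm M p g = ennreal B"
    by (cases "Lp_norm M p f"; cases "Lp_norm M p g") auto
  have "Lp_norm M p (\<lambda>x. f x + g x) \<le> ennreal ((A + e / 2) + (B + e / 2))"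
    using AB e p assms(1,2) by (intro Lp_norm_triangle_aux) (auto intro!: ennreal_leI)
  also have "\<dots> = Lp_norm M p f + Lp_norm M p g + ennreal e"
    using AB e by (simp flip: ennreal_plus)
  finally show "Lp_norm M p (\<lambda>x. f x + g x) \<le> Lp_norm M p f + Lp_norm M p g + ennreal e" .
qed

lemma Lp_norm_triangle_minus:
  assumes "f \<in> borel_measurable M" "g \<in> borel_measurable M" and "1 \<le> p"
  shows "Lp_norm M p (\<lambda>x. f x - g x) \<le> Lp_norm M p f + Lp_norm M p g"
  using Lp_norm_triangle[of f M "\<lambda>x. - g x" p] assms by (simp add: Lp_norm_uminus)

lemma Lp_norm_zero [simp]: "Lp_norm M p (\<lambda>x. 0) \<le> 0"
proof (cases "p = \<infinity>")
  case True
  then show ?thesis using Lp_norm_le_iff_infty[of "\<lambda>x. 0" M 0] by simp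
next
  case False
  then show ?thesis by (simp add: Lp_norm_def epowr_def)
qed

lemma Lp_norm_sum_le:
  assumes "\<And>i. i \<in> I \<Longrightarrow> f i \<in> borel_measurable M" and "1 \<le> p"
  shows "Lp_norm M p (\<lambda>x. \<Sum>i\<in>I. f i x) \<le> (\<Sum>i\<in>I. Lp_norm M p (f i))"
proof (cases "finite I")
  case True
  then show ?thesis using assms
  proof (induction I)
    case empty
    then show ?case by (simp del: le_zero_eq)
  next
    case (insert i I)
    have "Lp_norm M p (\<lambda>x. f i x + (\<Sum>i\<in>I. f i x)) \<le> Lp_norm M p (f i) + Lp_norm M p (\<lambda>x. \<Sum>i\<in>I. f i x)"
      using insert by (intro Lp_norm_triangle) auto
    also have "\<dots> \<le> Lp_norm M p (f i) + (\<Sum>i\<in>I. Lp_norm M p (f i))"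
      using insert by (intro add_left_mono) auto
    finally show ?case using insert by simp
  qed
next
  case False
  then show ?thesis by (simp del: le_zero_eq)
qed

text \<open>Hoelder's inequality for the measure with density k. The tangent is placed at the power
  mean s = (N / C)^(1/r), for which integrating the pointwise bound returns exactly C * s.\<close>

lemma nn_integral_Jensen_powr:
  fixes k :: "'a \<Rightarrow> ennreal" and g :: "'a \<Rightarrow> real"
  assumes [measurable]: "k \<in> borel_measurable M" "g \<in> borel_measurable M"
    and g: "\<And>x. g x \<ge> 0" and r: "r \<ge> 1"
    and C: "C > 0" "(\<integral>\<^sup>+x. k x \<partial>M) \<le> ennreal C"
    and N: "N > 0" "(\<integral>\<^sup>+x. k x * ennreal (g x powr r) \<partial>M) \<le> ennreal N"
  shows "(\<integral>\<^sup>+x. k x * ennreal (g x) \<partial>M) \<le> ennreal (C * (N / C) powr (1 / r))"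
proof -
  define s where "s = (N / C) powr (1 / r)"
  have s: "s > 0" using C N by (simp add: s_def)
  define a where "a = s * (1 - 1 / r)"
  define b where "b = s powr (1 - r) / r"
  have ab: "a \<ge> 0" "b \<ge> 0" using s r by (auto simp: a_def b_def)
  have "g x \<le> a + b * g x powr r" for x
  proof -
    have "s powr r + r * s powr (r - 1) * (g x - s) \<le> g x powr r"
      using s r g by (intro powr_tangent) auto
    then have "(s powr r + r * s powr (r - 1) * (g x - s)) * b \<le> g x powr r * b"
      using ab by (intro mult_right_mono)
    moreover have "(s powr r + r * s powr (r - 1) * (g x - s)) * b = g x - a"
      using s r by (simp add: a_def b_def field_simps powr_diff)
    ultimately show ?thesis by (simp add: mult.commute)
  qed
  then have "(\<integral>\<^sup>+x. k x * ennreal (g x) \<partial>M) \<le> (\<integral>\<^sup>+x. ennreal a * k x + ennreal b * (k x * ennreal (g x powr r)) \<partial>M)"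
  proof (intro nn_integral_mono)
    fix x
    assume le: "\<And>x. g x \<le> a + b * g x powr r"
    have "k x * ennreal (g x) \<le> k x * ennreal (a + b * g x powr r)"
      using le by (intro mult_left_mono ennreal_leI) auto
    also have "\<dots> = ennreal a * k x + ennreal b * (k x * ennreal (g x powr r))"
      using ab by (simp add: ennreal_plus ennreal_mult ring_distribs mult_ac)
    finally show "k x * ennreal (g x) \<le> ennreal a * k x + ennreal b * (k x * ennreal (g x powr r))" .
  qed
  also have "\<dots> = ennreal a * (\<integral>\<^sup>+x. k x \<partial>M) + ennreal b * (\<integral>\<^sup>+x. k x * ennreal (g x powr r) \<partial>M)"
    by (simp add: nn_integral_add nn_integral_cmult)
  also have "\<dots> \<le> ennreal a * ennreal C + ennreal b * ennreal N"
    using C N by (intro add_mono mult_left_mono) auto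
  also have "\<dots> = ennreal (a * C + b * N)"
    using ab C N by (simp add: ennreal_plus ennreal_mult)
  also have "a * C + b * N = C * s"
  proof -
    have "s powr r = N / C" using C N r by (simp add: s_def powr_powr)
    then show ?thesis using s r C N by (simp add: a_def b_def powr_diff field_simps)
  qed
  finally show ?thesis by (simp add: s_def)
qed

lemma nn_integral_Jensen_powr':
  fixes k :: "'a \<Rightarrow> ennreal" and g :: "'a \<Rightarrow> real"
  assumes [measurable]: "k \<in> borel_measurable M" "g \<in> borel_measurable M"
    and g: "\<And>x. g x \<ge> 0" and r: "r \<ge> 1"
    and C: "C > 0" "(\<integral>\<^sup>+x. k x \<partial>M) \<le> ennreal C"
    and F: "F \<ge> 0" "ennreal F \<le> (\<integral>\<^sup>+x. k x * ennreal (g x) \<partial>M)"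
  shows "ennreal (F powr r) \<le> ennreal (C powr (r - 1)) * (\<integral>\<^sup>+x. k x * ennreal (g x powr r) \<partial>M)"
proof (rule ennreal_le_epsilon)
  fix e :: real
  assume fin: "ennreal (C powr (r - 1)) * (\<integral>\<^sup>+x. k x * ennreal (g x powr r) \<partial>M) < top" and e: "0 < e"
  define I where "I = (\<integral>\<^sup>+x. k x * ennreal (g x powr r) \<partial>M)"
  have "I < top"
    using fin C by (auto simp: I_def ennreal_mult_less_top)
  then obtain N where N: "N \<ge> 0" "I = ennreal N"
    by (cases I) auto
  \<comment> \<open>N may be 0 but has to be positive below; the increment is chosen so that it
    costs exactly e after multiplication by \<open>C powr (r - 1)\<close>.\<close>
  define N' where "N' = N + e / C powr (r - 1)"
  have N': "N' > 0" using N e C by (auto simp: N'_def intro!: add_nonneg_pos)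
  have "I \<le> ennreal N'" using N e C by (simp add: N'_def)
  then have "ennreal F \<le> ennreal (C * (N' / C) powr (1 / r))"
    using order.trans[OF F(2) nn_integral_Jensen_powr[OF assms(1,2) g r C N']] by (simp add: I_def)
  then have "F \<le> C * (N' / C) powr (1 / r)"
    using C by (simp add: ennreal_le_iff)
  then have "F powr r \<le> (C * (N' / C) powr (1 / r)) powr r"
    using F r by (intro powr_mono2) auto
  also have "\<dots> = C powr r * (N' / C)"
    using C N' r by (simp add: powr_mult powr_powr)
  also have "\<dots> = C powr (r - 1) * N'"
    using C by (simp add: powr_diff)
  also have "\<dots> = C powr (r - 1) * N + e"
    using C by (simp add: N'_def field_simps)
  finally have "ennreal (F powr r) \<le> ennreal (C powr (r - 1) * N + e)"
    by (rule ennreal_leI)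
  then show "ennreal (F powr r) \<le> ennreal (C powr (r - 1)) * (\<integral>\<^sup>+x. k x * ennreal (g x powr r) \<partial>M) + ennreal e"
    using N e by (simp add: I_def[symmetric] ennreal_plus ennreal_mult)
qed

text \<open>For finite p, Jensen's inequality in y costs the factor \<open>C powr (r - 1)\<close>
  and, after exchanging the integrals, the other marginal costs one more C; together this is
  \<open>C powr r\<close> for r-th powers. F is only dominated by the integral operator, which
  admits complex kernels through their absolute values.\<close>

lemma Schur_test:
  fixes K :: "'a \<Rightarrow> 'a \<Rightarrow> ennreal"
  assumes "sigma_finite_measure M"
    and [measurable]: "(\<lambda>(x, y). K x y) \<in> borel_measurable (M \<Otimes>\<^sub>M M)"
    and [measurable]: "F \<in> borel_measurable M" "g \<in> borel_measurable M"
    and C: "C > 0" "\<And>x. x \<in> space M \<Longrightarrow> (\<integral>\<^sup>+y. K x y \<partial>M) \<le> ennreal C" 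
       "\<And>y. y \<in> space M \<Longrightarrow> (\<integral>\<^sup>+x. K x y \<partial>M) \<le> ennreal C"
    and F: "\<And>x. x \<in> space M \<Longrightarrow> ennreal (cmod (F x)) \<le> (\<integral>\<^sup>+y. K x y * ennreal (cmod (g y)) \<partial>M)"
    and p: "1 \<le> p"
  shows "Lp_norm M p F \<le> ennreal C * Lp_norm M p g"
proof (cases "Lp_norm M p g")
  case top
  then show ?thesis using C by (simp add: ennreal_mult_top)
next
  case (real G)
  interpret pair_sigma_finite M M
    using assms(1) by (simp add: pair_sigma_finite_def)
  have "Lp_norm M p F \<le> ennreal (C * G)"
  proof (cases "p = \<infinity>")
    case True
    have "AE y in M. cmod (g y) \<le> G"
      using True real Lp_norm_le_iff_infty[of g M G] by auto
    then have *: "AE y in M. ennreal (cmod (g y)) \<le> ennreal G"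
      by eventually_elim (rule ennreal_leI)
    have "cmod (F x) \<le> C * G" if "x \<in> space M" for x
    proof -
      have "ennreal (cmod (F x)) \<le> (\<integral>\<^sup>+y. K x y * ennreal (cmod (g y)) \<partial>M)"
        using F that by blast
      also have "\<dots> \<le> (\<integral>\<^sup>+y. K x y * ennreal G \<partial>M)"
        using * by (intro nn_integral_mono_AE) (auto intro!: mult_left_mono)
      also have "\<dots> = (\<integral>\<^sup>+y. K x y \<partial>M) * ennreal G"
        using that by (intro nn_integral_multc) measurable
      also have "\<dots> \<le> ennreal C * ennreal G"
        using C that by (intro mult_right_mono) auto
      finally show ?thesis using C real by (simp flip: ennreal_mult add: ennreal_le_iff)
    qed
    then have "AE x in M. cmod (F x) \<le> C * G" by (rule AE_I2)
    then show ?thesis using True Lp_norm_le_iff_infty[of F M "C * G"] C real by auto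
  next
    case False
    define r where "r = enn2real p"
    have r: "r \<ge> 1" using enn2real_ge_1[OF p False] by (simp add: r_def)
    have gG: "(\<integral>\<^sup>+x. ennreal (cmod (g x) powr r) \<partial>M) \<le> ennreal (G powr r)"
      using real Lp_norm_le_iff_finite[OF p False, of G M g] by (simp add: r_def)
    have "(\<integral>\<^sup>+x. ennreal (cmod (F x) powr r) \<partial>M)
        \<le> (\<integral>\<^sup>+x. ennreal (C powr (r - 1)) * (\<integral>\<^sup>+y. K x y * ennreal (cmod (g y) powr r) \<partial>M) \<partial>M)"
    proof (intro nn_integral_mono)
      fix x assume x: "x \<in> space M"
      show "ennreal (cmod (F x) powr r) \<le> ennreal (C powr (r - 1)) * (\<integral>\<^sup>+y. K x y * ennreal (cmod (g y) powr r) \<partial>M)"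
        using x r C F by (intro nn_integral_Jensen_powr') (auto, measurable)
    qed
    also have "\<dots> = ennreal (C powr (r - 1)) * (\<integral>\<^sup>+x. \<integral>\<^sup>+y. K x y * ennreal (cmod (g y) powr r) \<partial>M \<partial>M)"
      by (intro nn_integral_cmult) measurable
    finally have *: "(\<integral>\<^sup>+x. ennreal (cmod (F x) powr r) \<partial>M) \<le> ennreal (C powr (r - 1)) * (\<integral>\<^sup>+x. \<integral>\<^sup>+y. K x y * ennreal (cmod (g y) powr r) \<partial>M \<partial>M)" .
    have "(\<integral>\<^sup>+x. \<integral>\<^sup>+y. K x y * ennreal (cmod (g y) powr r) \<partial>M \<partial>M)
      = (\<integral>\<^sup>+y. \<integral>\<^sup>+x. K x y * ennreal (cmod (g y) powr r) \<partial>M \<partial>M)"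
      by (intro Fubini') measurable
    also have "\<dots> = (\<integral>\<^sup>+y. (\<integral>\<^sup>+x. K x y \<partial>M) * ennreal (cmod (g y) powr r) \<partial>M)"
      by (intro nn_integral_cong nn_integral_multc) measurable
    also have "\<dots> \<le> (\<integral>\<^sup>+y. ennreal C * ennreal (cmod (g y) powr r) \<partial>M)"
      using C by (intro nn_integral_mono mult_right_mono) auto
    also have "\<dots> = ennreal C * (\<integral>\<^sup>+y. ennreal (cmod (g y) powr r) \<partial>M)"
      by (intro nn_integral_cmult) measurable
    also have "\<dots> \<le> ennreal C * ennreal (G powr r)"
      using gG by (intro mult_left_mono) auto
    finally have "(\<integral>\<^sup>+x. ennreal (cmod (F x) powr r) \<partial>M) \<le> ennreal (C powr (r - 1)) * (ennreal C * ennreal (G powr r))"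
      by (rule order.trans[OF * mult_left_mono]) simp
    also have "\<dots> = ennreal ((C * G) powr r)"
      using C real by (simp flip: ennreal_mult add: powr_diff powr_mult)
    finally show ?thesis
      using Lp_norm_le_iff_finite[OF p False, of "C * G" M F] C real by (simp add: r_def)
  qed
  then show ?thesis using real C by (simp add: ennreal_mult)
qed


text \<open>For finite p the conjugate exponent is avoided through |g| \<le> 1 + |g|^r: the term 1
  is paid for by the integrability of \<psi>, the power by its boundedness.\<close>

lemma integrable_mult_of_Lp:
  fixes g \<psi> :: "'a \<Rightarrow> complex"
  assumes g: "g \<in> Lp_space M p" and p: "1 \<le> p"
    and \<psi>: "integrable M \<psi>" and bnd: "\<And>x. cmod (\<psi> x) \<le> B"
  shows "integrable M (\<lambda>x. g x * \<psi> x)"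
proof -
  have [measurable]: "g \<in> borel_measurable M" and fin: "Lp_norm M p g < \<infinity>"
    using g by (auto simp: Lp_space_def)
  obtain G where G: "G \<ge> 0" "Lp_norm M p g = ennreal G"
    using fin by (cases "Lp_norm M p g") auto
  have [measurable]: "\<psi> \<in> borel_measurable M" using \<psi> by simp
  have B: "B \<ge> 0" using order_trans[OF norm_ge_zero bnd] .
  show ?thesis
  proof (cases "p = \<infinity>")
    case True
    have "AE y in M. cmod (g y) \<le> G"
      using True G Lp_norm_le_iff_infty[of g M G] by auto
    then have "AE x in M. norm (g x * \<psi> x) \<le> norm (complex_of_real G * \<psi> x)"
    proof eventually_elim
      case (elim x)
      then show ?case using mult_right_mono[OF elim, of "cmod (\<psi> x)"] G by (simp add: norm_mult)
    qed
    moreover have "integrable M (\<lambda>x. complex_of_real G * \<psi> x)"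
      using \<psi> by (rule integrable_mult_right)
    ultimately show ?thesis
      by (rule Bochner_Integration.integrable_bound[rotated 2]) measurable
  next
    case False
    define r where "r = enn2real p"
    have r: "r \<ge> 1" using enn2real_ge_1[OF p False] by (simp add: r_def)
    have gG: "(\<integral>\<^sup>+x. ennreal (cmod (g x) powr r) \<partial>M) \<le> ennreal (G powr r)"
      using G Lp_norm_le_iff_finite[OF p False, of G M g] by (simp add: r_def)
    have i: "integrable M (\<lambda>x. cmod (g x) powr r)"
      using gG le_less_trans[OF gG ennreal_less_top] by (intro integrableI_nonneg) auto
    have "norm (g x * \<psi> x) \<le> norm (cmod (\<psi> x) + B * cmod (g x) powr r)" for x
    proof -
      have "cmod (g x) \<le> 1 + cmod (g x) powr r"
      proof (cases "cmod (g x) \<le> 1")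
        case True
        then show ?thesis using powr_ge_zero[of "cmod (g x)" r] by linarith
      next
        case False
        then have "cmod (g x) powr 1 \<le> cmod (g x) powr r" using r by (intro powr_mono) auto
        then show ?thesis using False by simp
      qed
      then have "cmod (g x) * cmod (\<psi> x) \<le> (1 + cmod (g x) powr r) * cmod (\<psi> x)"
        by (intro mult_right_mono) auto
      also have "\<dots> \<le> cmod (\<psi> x) + B * cmod (g x) powr r"
        using bnd[of x] mult_right_mono[OF bnd[of x], of "cmod (g x) powr r"] by (simp add: ring_distribs mult_ac)
      finally show ?thesis by (simp add: norm_mult)
    qed
    then have "AE x in M. norm (g x * \<psi> x) \<le> norm (cmod (\<psi> x) + B * cmod (g x) powr r)"
      by (rule AE_I2)
    moreover have "integrable M (\<lambda>x. cmod (\<psi> x) + B * cmod (g x) powr r)"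
      using \<psi> i by simp
    ultimately show ?thesis
      by (rule Bochner_Integration.integrable_bound[rotated 2]) measurable
  qed
qed

section \<open>Weighted sequence spaces\<close>

lemma epowr_ennreal_mult:
  assumes "c > 0" "r > 0"
  shows "epowr (ennreal c * x) r = ennreal (c powr r) * epowr x r"
  using assms by (cases x) (auto simp: epowr_def ennreal_mult_top powr_mult simp flip: ennreal_mult)

lemma epowr_inverse: "r > 0 \<Longrightarrow> epowr (epowr x r) (1 / r) = x" "r > 0 \<Longrightarrow> epowr (epowr x (1 / r)) r = x"
  by (cases x; auto simp: epowr_def powr_powr)+

text \<open>The weight is drawn inside the power and the outer root dropped, so that finite and
  infinite \<rho> both concern the weighted sequence 2^(\<gamma> j) a_j.\<close>

lemma b_space_iff:
  assumes "\<rho> > 0"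
  shows "a \<in> b_space \<rho> \<gamma> \<longleftrightarrow>
    (if \<rho> = \<infinity> then (SUP j. ennreal (2 powr (\<gamma> * real j)) * a j) < \<infinity>
     else (\<Sum>j. epowr (ennreal (2 powr (\<gamma> * real j)) * a j) (enn2real \<rho>)) < \<infinity>)"
proof -
  have "enn2real \<rho> > 0" if "\<rho> \<noteq> \<infinity>"
    using that assms by (cases \<rho>) auto
  then have "epowr (ennreal (2 powr (\<gamma> * real j)) * a j) (enn2real \<rho>)
      = ennreal (2 powr (\<gamma> * enn2real \<rho> * real j)) * epowr (a j) (enn2real \<rho>)" if "\<rho> \<noteq> \<infinity>" for j
    using that by (subst epowr_ennreal_mult) (auto simp: powr_powr mult_ac)
  then show ?thesis
    by (auto simp: b_space_def mult.commute)
qed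

lemma suminf_swap_ennreal:
  fixes f :: "nat \<Rightarrow> nat \<Rightarrow> ennreal"
  shows "(\<Sum>i. \<Sum>j. f i j) = (\<Sum>j. \<Sum>i. f i j)"
  using nn_integral_suminf[of "\<lambda>j i. f i j" "count_space UNIV"]
  by (simp add: nn_integral_count_space_nat)

lemma suminf_geometric_powr_finite:
  assumes "\<delta> > 0"
  shows "(\<Sum>i. ennreal (2 powr (- \<delta> * real i))) < \<infinity>"
proof -
  have "summable (\<lambda>i. (2 powr (- \<delta>)) ^ i)"
    using assms by (intro summable_geometric) (simp add: powr_minus_divide)
  then have "summable (\<lambda>i. 2 powr (- \<delta> * real i))"
    by (simp add: powr_realpow[symmetric] powr_powr)
  then show ?thesis
    by (simp add: suminf_ennreal2 less_top)
qed

text \<open>Half of the geometric decay is spent on replacing the tail sum by a weighted supremum, which works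
  for all exponents at once.\<close>

lemma b_space_tail_sums:
  fixes t e :: "nat \<Rightarrow> ennreal"
  assumes \<rho>: "\<rho> > 0" and \<gamma>: "\<gamma> > 0" and C: "C > 0" and t: "t \<in> b_space \<rho> \<gamma>"
    and e: "\<And>j. e j \<le> ennreal C * (\<Sum>i. t (i + j))"
  shows "e \<in> b_space \<rho> \<gamma>"
proof -
  define w where "w j = ennreal (2 powr (\<gamma> * real j)) * t j" for j
  define v where "v i j = ennreal (2 powr (- (\<gamma> / 2) * real i)) * w (i + j)" for i j
  define D where "D = (\<Sum>i. ennreal (2 powr (- (\<gamma> / 2) * real i)))"
  have "D < \<infinity>" unfolding D_def using \<gamma> by (intro suminf_geometric_powr_finite) simp
  then obtain D' where "D' \<ge> 0" "D = ennreal D'" by (cases D) auto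
  then have "D \<le> ennreal (D' + 1)" by (auto intro: ennreal_leI)
  define E where "E = C * (D' + 1)"
  have E: "E > 0" using C \<open>D' \<ge> 0\<close> by (simp add: E_def)
  have main: "ennreal (2 powr (\<gamma> * real j)) * e j \<le> ennreal E * s" if s: "\<And>i. v i j \<le> s" for j s
  proof -
    have "ennreal (2 powr (\<gamma> * real j)) * e j \<le> ennreal (2 powr (\<gamma> * real j)) * (ennreal C * (\<Sum>i. t (i + j)))"
      by (intro mult_left_mono e) auto
    also have "\<dots> = ennreal C * (\<Sum>i. ennreal (2 powr (\<gamma> * real j)) * t (i + j))"
      by (simp add: mult_ac)
    also have "(\<lambda>i. ennreal (2 powr (\<gamma> * real j)) * t (i + j)) = (\<lambda>i. ennreal (2 powr (- (\<gamma> / 2) * real i)) * v i j)"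
    proof
      fix i
      have "2 powr (\<gamma> * real j) = 2 powr (- (\<gamma> / 2) * real i) * (2 powr (- (\<gamma> / 2) * real i) * 2 powr (\<gamma> * real (i + j)))"
        by (simp add: powr_add[symmetric] algebra_simps)
      then show "ennreal (2 powr (\<gamma> * real j)) * t (i + j) = ennreal (2 powr (- (\<gamma> / 2) * real i)) * v i j"
        by (simp add: v_def w_def ennreal_mult mult_ac)
    qed
    also have "(\<Sum>i. ennreal (2 powr (- (\<gamma> / 2) * real i)) * v i j) \<le> (\<Sum>i. ennreal (2 powr (- (\<gamma> / 2) * real i)) * s)"
      by (intro suminf_le summableI mult_left_mono s) auto
    also have "\<dots> = D * s" by (simp add: D_def)
    also have "\<dots> \<le> ennreal (D' + 1) * s"
      using \<open>D \<le> _\<close> by (intro mult_right_mono) auto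
    finally have "ennreal (2 powr (\<gamma> * real j)) * e j \<le> ennreal C * (ennreal (D' + 1) * s)"
      by (simp add: mult_left_mono)
    then show ?thesis using C \<open>D' \<ge> 0\<close> by (simp add: E_def ennreal_mult mult_ac)
  qed
  have v_le: "v i j \<le> w (i + j)" for i j
  proof -
    have "v i j \<le> ennreal 1 * w (i + j)"
      unfolding v_def using \<gamma> powr_mono[of "- (\<gamma> / 2) * real i" 0 2] by (intro mult_right_mono ennreal_leI) auto
    then show ?thesis by simp
  qed
  show ?thesis
  proof (cases "\<rho> = \<infinity>")
    case True
    define s where "s = (SUP j. w j)"
    have s: "s < \<infinity>" using t \<rho> True by (simp add: b_space_iff s_def w_def)
    have "w i \<le> s" for i unfolding s_def by (rule SUP_upper) simp
    then have "v i j \<le> s" for i j using v_le order_trans by blast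
    then have "(SUP j. ennreal (2 powr (\<gamma> * real j)) * e j) \<le> ennreal E * s"
      by (intro SUP_least main)
    also have "\<dots> < \<infinity>" using s by (simp add: ennreal_mult_less_top)
    finally show ?thesis using \<rho> True by (simp add: b_space_iff)
  next
    case False
    define r where "r = enn2real \<rho>"
    have r: "r > 0" using False \<rho> by (cases \<rho>) (auto simp: r_def)
    define W where "W = (\<Sum>j. epowr (w j) r)"
    have W: "W < \<infinity>" using t \<rho> False by (simp add: b_space_iff W_def w_def r_def)
    have "epowr (ennreal (2 powr (\<gamma> * real j)) * e j) r \<le> ennreal (E powr r) * (\<Sum>i. epowr (v i j) r)" for j
    proof -
      \<comment> \<open>A term is at most the l^r norm for every r > 0; this replaces the triangle
        inequality, which fails for r < 1.\<close>
      have "v i j \<le> epowr (\<Sum>i. epowr (v i j) r) (1 / r)" for i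
      proof -
        have "epowr (v i j) r \<le> (\<Sum>i. epowr (v i j) r)"
          using sum_le_suminf[of "\<lambda>i. epowr (v i j) r" "{i}"] by simp
        then have "epowr (epowr (v i j) r) (1 / r) \<le> epowr (\<Sum>i. epowr (v i j) r) (1 / r)"
          using r by (intro epowr_mono) auto
        then show ?thesis using r by (simp add: epowr_inverse)
      qed
      then have "epowr (ennreal (2 powr (\<gamma> * real j)) * e j) r
          \<le> epowr (ennreal E * epowr (\<Sum>i. epowr (v i j) r) (1 / r)) r"
        using r by (intro epowr_mono main) auto
      then show ?thesis using r E by (simp add: epowr_ennreal_mult epowr_inverse)
    qed
    then have "(\<Sum>j. epowr (ennreal (2 powr (\<gamma> * real j)) * e j) r)
        \<le> (\<Sum>j. ennreal (E powr r) * (\<Sum>i. epowr (v i j) r))"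
      by (intro suminf_le summableI)
    also have "\<dots> = ennreal (E powr r) * (\<Sum>i. \<Sum>j. epowr (v i j) r)"
      unfolding ennreal_suminf_cmult by (subst suminf_swap_ennreal) (rule refl)
    also have "\<dots> \<le> ennreal (E powr r) * (\<Sum>i. ennreal (2 powr (- (\<gamma> / 2 * r) * real i)) * W)"
    proof (intro mult_left_mono suminf_le summableI)
      fix i
      have "(\<Sum>j. epowr (v i j) r) = (\<Sum>j. ennreal (2 powr (- (\<gamma> / 2 * r) * real i)) * epowr (w (i + j)) r)"
        using r unfolding v_def by (subst epowr_ennreal_mult) (auto simp: powr_powr mult_ac)
      also have "\<dots> = ennreal (2 powr (- (\<gamma> / 2 * r) * real i)) * (\<Sum>j. epowr (w (j + i)) r)"
        by (simp add: add.commute)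
      also have "\<dots> \<le> ennreal (2 powr (- (\<gamma> / 2 * r) * real i)) * W"
        unfolding W_def using suminf_offset[of "\<lambda>j. epowr (w j) r" i]
        by (intro mult_left_mono) (auto simp: summableI)
      finally show "(\<Sum>j. epowr (v i j) r) \<le> ennreal (2 powr (- (\<gamma> / 2 * r) * real i)) * W" .
    qed auto
    also have "\<dots> = ennreal (E powr r) * ((\<Sum>i. ennreal (2 powr (- (\<gamma> / 2 * r) * real i))) * W)"
      by simp
    also have "\<dots> < \<infinity>"
    proof -
      define V where "V = (\<Sum>i. ennreal (2 powr (- (\<gamma> / 2 * r) * real i)))"
      have "V < \<infinity>" unfolding V_def using \<gamma> r by (intro suminf_geometric_powr_finite) simp
      then show ?thesis using W unfolding V_def[symmetric] by (auto simp: ennreal_mult_less_top)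
    qed
    finally show ?thesis using \<rho> False by (simp add: b_space_iff r_def)
  qed
qed

text \<open>A shift rescales the weights by 2^\<gamma> and frees one finite term. It is applied
  twice, because the dyadic parts are controlled by approximation errors only from index 2
  on.\<close>

lemma b_space_Suc:
  fixes t :: "nat \<Rightarrow> ennreal"
  assumes \<rho>: "\<rho> > 0" and t: "(\<lambda>j. t (Suc j)) \<in> b_space \<rho> \<gamma>" and t0: "t 0 < \<infinity>"
  shows "t \<in> b_space \<rho> \<gamma>"
proof -
  define w where "w j = ennreal (2 powr (\<gamma> * real j)) * t j" for j
  have w: "w (Suc j) = ennreal (2 powr \<gamma>) * (ennreal (2 powr (\<gamma> * real j)) * t (Suc j))" for j
    by (simp add: w_def ring_distribs powr_add ennreal_mult mult_ac)
  have w0: "w 0 = t 0" by (simp add: w_def)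
  show ?thesis
  proof (cases "\<rho> = \<infinity>")
    case True
    define s where "s = (SUP j. ennreal (2 powr (\<gamma> * real j)) * t (Suc j))"
    have s: "s < \<infinity>" using t \<rho> True by (simp add: b_space_iff s_def)
    have "w j \<le> max (t 0) (ennreal (2 powr \<gamma>) * s)" for j
    proof (cases j)
      case (Suc i)
      have "w j \<le> ennreal (2 powr \<gamma>) * s"
        unfolding Suc w s_def by (intro mult_left_mono SUP_upper) auto
      then show ?thesis by (simp add: le_max_iff_disj)
    qed (simp add: w0)
    then have "(SUP j. w j) \<le> max (t 0) (ennreal (2 powr \<gamma>) * s)" by (intro SUP_least)
    also have "\<dots> < \<infinity>" using s t0 by (simp add: ennreal_mult_less_top)
    finally show ?thesis using \<rho> True by (simp add: b_space_iff w_def)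
  next
    case False
    define r where "r = enn2real \<rho>"
    have r: "r > 0" using False \<rho> by (cases \<rho>) (auto simp: r_def)
    have "(\<Sum>j. epowr (ennreal (2 powr (\<gamma> * real j)) * t (Suc j)) r) < \<infinity>"
      using t \<rho> False by (simp add: b_space_iff r_def)
    then have *: "(\<Sum>j. epowr (w (Suc j)) r) < \<infinity>"
      using r unfolding w by (subst epowr_ennreal_mult) (auto simp: ennreal_mult_less_top)
    have "(\<Sum>j. epowr (w j) r) = (\<Sum>j. epowr (w (j + 1)) r) + (\<Sum>j<1. epowr (w j) r)"
      by (rule suminf_offset) (rule summableI)
    then have "(\<Sum>j. epowr (w j) r) < \<infinity>"
      using * t0 by (simp add: w0)
    then show ?thesis using \<rho> False by (simp add: b_space_iff w_def r_def)
  qed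
qed

section \<open>Two constants in a quadrant and truncated Laplace inversion\<close>

text \<open>With z = (1 + y) + i x the function is - i z^3 / |z|^6, so the sign of its real part is
  that of sin (3 arg z). The exponent 3 is the smallest for which it becomes negative far out on the
  real axis, where the two-constants argument has no decay at its disposal.\<close>

lemma quadrant_minorant_Re:
  fixes x y :: real
  shows "Re (- \<i> / (1 - \<i> * Complex x y) ^ 3) = x * (3 * (1 + y)\<^sup>2 - x\<^sup>2) / ((1 + y)\<^sup>2 + x\<^sup>2) ^ 3"
proof -
  define b where "b = 1 + y"
  define z where "z = Complex b x"
  have z: "1 - \<i> * Complex x y = cnj z" by (auto simp: complex_eq_iff z_def b_def)
  have nz: "z * cnj z = of_real (b\<^sup>2 + x\<^sup>2)"
    by (simp add: complex_eq_iff z_def power2_eq_square)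
  have "- \<i> / (cnj z) ^ 3 = - \<i> * z ^ 3 / (z * cnj z) ^ 3"
    by (cases "z = 0") (auto simp: power_mult_distrib)
  also have "\<dots> = - \<i> * z ^ 3 / of_real ((b\<^sup>2 + x\<^sup>2) ^ 3)"
    by (simp only: nz of_real_power)
  also have "Re \<dots> = Im (z ^ 3) / (b\<^sup>2 + x\<^sup>2) ^ 3"
    by (simp only: Re_divide_of_real) simp
  also have "Im (z ^ 3) = x * (3 * b\<^sup>2 - x\<^sup>2)"
    by (simp add: z_def power3_eq_cube power2_eq_square algebra_simps)
  finally show ?thesis by (simp add: z b_def)
qed

text \<open>The sign changes at x = sqrt 3; the end point 2 leaves some room.\<close>

lemma quadrant_minorant_real_axis:
  fixes x :: real
  assumes "x \<ge> 0"
  shows "x * (3 - x\<^sup>2) / (1 + x\<^sup>2) ^ 3 \<le> (if x \<le> 2 then 1 else 0)"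
proof (cases "x \<le> 2")
  case True
  have "3 * x \<le> 1 + 3 * x\<^sup>2"
    using zero_le_power2[of "x - 1/2"] by (simp add: power2_eq_square algebra_simps)
  then have "x * (3 - x\<^sup>2) \<le> 1 + 3 * x\<^sup>2"
    using mult_nonneg_nonneg[OF assms zero_le_power2[of x]] by (simp add: right_diff_distrib)
  also have "\<dots> \<le> (1 + x\<^sup>2) ^ 3"
    by (simp add: power3_eq_cube algebra_simps)
  finally show ?thesis using True by (simp add: divide_le_eq add_pos_nonneg)
next
  case False
  then have "x\<^sup>2 \<ge> 2\<^sup>2" by (intro power_mono) auto
  then show ?thesis using False assms by (auto intro!: divide_nonpos_nonneg mult_nonneg_nonpos)
qed

text \<open>The function \<open>- \<i> / (1 - \<i> w)\<^sup>3\<close> has real part vanishing on the imaginary axis, at most 1 on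
  \<open>[0, 2]\<close> and negative on the rest of the positive axis, so that it plays the role of a harmonic
  measure of a real segment in the first quadrant.\<close>

lemma two_constants_quadrant:
  fixes F :: "complex \<Rightarrow> complex" and a s M L x y :: real
  assumes hol: "F holomorphic_on {z. Re z > 0}" and a: "a > 0" and s: "s > 0" and L: "L \<ge> 0"
    and M: "M > 0" "\<And>z. Re z \<ge> a \<Longrightarrow> cmod (F z) \<le> M"
    and seg: "\<And>t. a \<le> t \<Longrightarrow> t \<le> a + 2 * s \<Longrightarrow> cmod (F (of_real t)) \<le> M * exp (- L)"
    and xy: "x \<ge> 0" "y \<ge> 0"
  shows "cmod (F (Complex (a + s * x) (s * y)))
    \<le> M * exp (- L * (x * (3 * (1 + y)\<^sup>2 - x\<^sup>2) / ((1 + y)\<^sup>2 + x\<^sup>2) ^ 3))"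
proof -
  define g where "g w = - \<i> / (1 - \<i> * w) ^ 3" for w :: complex
  define f where "f w = F (of_real a + of_real s * w) * exp (of_real L * g w)" for w
  have ne: "1 - \<i> * w \<noteq> 0" if "Im w \<ge> 0" for w
    using that by (auto simp: complex_eq_iff)
  have cg: "cmod (g w) \<le> 1 / (max (Re w) (Im w)) ^ 3" if "Re w \<ge> 0" "Im w \<ge> 0" "max (Re w) (Im w) > 0" for w
  proof -
    have "\<bar>Re (1 - \<i> * w)\<bar> \<ge> Im w" "\<bar>Im (1 - \<i> * w)\<bar> \<ge> Re w" using that by auto
    then have "cmod (1 - \<i> * w) \<ge> max (Re w) (Im w)"
      using abs_Re_le_cmod[of "1 - \<i> * w"] abs_Im_le_cmod[of "1 - \<i> * w"] by linarith
    then have "cmod (1 - \<i> * w) ^ 3 \<ge> max (Re w) (Im w) ^ 3" using that by (intro power_mono) auto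
    then show ?thesis using that unfolding g_def
      by (auto simp: norm_divide norm_power norm_mult intro!: frac_le zero_less_power)
  qed
  have cf: "cmod (f w) = cmod (F (of_real a + of_real s * w)) * exp (L * Re (g w))" for w
    by (simp add: f_def norm_mult)
  have Mle: "cmod (F (of_real a + of_real s * w)) \<le> M" if "Re w \<ge> 0" for w
    using that s by (intro M) auto
  \<comment> \<open>Maximum principle on the square of side R: on its outer sides |g| is at most 1 /
    R^3, so boundedness of F leaves only the factor exp (L / R^3), which disappears as R
    grows.\<close>
  have bound: "cmod (f (Complex x y)) \<le> M * exp (L / R ^ 3)" if R: "R > 0" "x \<le> R" "y \<le> R" for R
  proof (rule maximum_modulus_frontier[of f "cbox 0 (Complex R R)"])
    have sub: "cbox 0 (Complex R R) \<subseteq> {w. Re w \<ge> 0 \<and> Im w \<ge> 0}"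
      by (auto simp: in_cbox_complex_iff)
    \<comment> \<open>The condition Re w > - a / s means Re z > 0 for z = a + s w. Since a > 0 this
      reaches across the imaginary axis, so f is holomorphic up to the boundary of the
      square.\<close>
    have hf: "f holomorphic_on {w. Re w > - a / s \<and> 1 - \<i> * w \<noteq> 0}"
    proof -
      have "(F \<circ> (\<lambda>w. of_real a + of_real s * w)) holomorphic_on {w. Re w > - a / s \<and> 1 - \<i> * w \<noteq> 0}"
      proof (rule holomorphic_on_compose_gen[OF _ hol])
        show "(\<lambda>w. of_real a + of_real s * w) ` {w. Re w > - a / s \<and> 1 - \<i> * w \<noteq> 0} \<subseteq> {z. 0 < Re z}"
          using s by (auto simp: field_simps)
      qed (auto intro!: holomorphic_intros)
      then show ?thesis
        unfolding f_def g_def by (auto intro!: holomorphic_intros simp: o_def)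
    qed
    have "cbox 0 (Complex R R) \<subseteq> {w. Re w > - a / s \<and> 1 - \<i> * w \<noteq> 0}"
    proof
      fix w assume "w \<in> cbox 0 (Complex R R)"
      then have "Re w \<ge> 0" "Im w \<ge> 0" using sub by auto
      moreover have "- a / s < 0" using a s by simp
      ultimately have "Re w > - a / s" by linarith
      with ne[OF \<open>Im w \<ge> 0\<close>] show "w \<in> {w. Re w > - a / s \<and> 1 - \<i> * w \<noteq> 0}" by blast
    qed
    then have hf2: "f holomorphic_on cbox 0 (Complex R R)" using hf holomorphic_on_subset by blast
    then show "f holomorphic_on interior (cbox 0 (Complex R R))"
      using holomorphic_on_subset interior_subset by blast
    show "continuous_on (closure (cbox 0 (Complex R R))) f"
      using hf2 by (simp add: holomorphic_on_imp_continuous_on)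
    show "bounded (cbox 0 (Complex R R))" by simp
    show "Complex x y \<in> cbox 0 (Complex R R)" using xy that by (auto simp: in_cbox_complex_iff)
    fix w assume "w \<in> frontier (cbox 0 (Complex R R))"
    then have w: "w \<in> cbox 0 (Complex R R)" "w \<notin> box 0 (Complex R R)"
      by (auto simp: frontier_cbox)
    then have w1: "Re w \<ge> 0" "Im w \<ge> 0" "Re w \<le> R" "Im w \<le> R" and
      w2: "Re w = 0 \<or> Im w = 0 \<or> Re w = R \<or> Im w = R"
      by (auto simp: in_cbox_complex_iff in_box_complex_iff)
    have Reg: "Re (g w) = Re w * (3 * (1 + Im w)\<^sup>2 - (Re w)\<^sup>2) / ((1 + Im w)\<^sup>2 + (Re w)\<^sup>2) ^ 3"
      using quadrant_minorant_Re[of "Re w" "Im w"] by (simp add: g_def)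
    have R3: "0 \<le> L / R ^ 3" using L R by simp
    consider "Re w = 0" | "max (Re w) (Im w) = R" | "Im w = 0" "Re w \<le> 2" | "Im w = 0" "Re w > 2"
      using w1 w2 by fastforce
    then show "cmod (f w) \<le> M * exp (L / R ^ 3)"
    proof cases
      case 1
      then have "Re (g w) = 0" using Reg by simp
      then have "cmod (f w) \<le> M" using cf Mle w1 by simp
      also have "M \<le> M * exp (L / R ^ 3)" using M R3 by simp
      finally show ?thesis .
    next
      case 2
      have "Re (g w) \<le> 1 / R ^ 3" using cg[of w] w1 R complex_Re_le_cmod[of "g w"] unfolding 2 by linarith
      then have "L * Re (g w) \<le> L / R ^ 3" using L mult_left_mono by fastforce
      then show ?thesis unfolding cf using Mle[of w] w1 M by (intro mult_mono) auto
    next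
      case 3
      have "Re (g w) \<le> 1" using Reg quadrant_minorant_real_axis[of "Re w"] w1 3 by simp
      then have "L * Re (g w) \<le> L" using L mult_left_mono by fastforce
      moreover have "cmod (F (of_real (a + s * Re w))) \<le> M * exp (- L)"
        using 3 w1 s by (intro seg) auto
      moreover have "of_real (a + s * Re w) = of_real a + of_real s * w"
        using 3 by (simp add: complex_eq_iff)
      ultimately have "cmod (f w) \<le> (M * exp (- L)) * exp L"
        unfolding cf using M by (intro mult_mono) auto
      also have "\<dots> = M" by (simp add: exp_minus field_simps)
      also have "M \<le> M * exp (L / R ^ 3)" using M R3 by simp
      finally show ?thesis .
    next
      case 4
      have "Re (g w) \<le> 0" using Reg quadrant_minorant_real_axis[of "Re w"] w1 4 by simp
      then have "L * Re (g w) \<le> L / R ^ 3" using R3 L mult_nonneg_nonpos[of L "Re (g w)"] by linarith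
      then show ?thesis unfolding cf using Mle[of w] w1 M by (intro mult_mono) auto
    qed
  qed
  have "((\<lambda>R. M * exp (L / R ^ 3)) \<longlongrightarrow> M * exp 0) at_top"
    by (intro tendsto_intros tendsto_divide_0[OF tendsto_const] filterlim_at_top_imp_at_infinity
        filterlim_pow_at_top filterlim_ident) auto
  moreover have "eventually (\<lambda>R. cmod (f (Complex x y)) \<le> M * exp (L / R ^ 3)) at_top"
    using eventually_gt_at_top[of 0] eventually_ge_at_top[of x] eventually_ge_at_top[of y]
    by eventually_elim (rule bound)
  ultimately have "cmod (f (Complex x y)) \<le> M"
    using tendsto_lowerbound[of "\<lambda>R. M * exp (L / R ^ 3)" M at_top] by auto
  moreover define u where "u = x * (3 * (1 + y)\<^sup>2 - x\<^sup>2) / ((1 + y)\<^sup>2 + x\<^sup>2) ^ 3"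
  ultimately have "cmod (F (of_real a + of_real s * Complex x y)) * exp (L * u) \<le> M"
    unfolding cf g_def quadrant_minorant_Re by simp
  moreover have "of_real a + of_real s * Complex x y = Complex (a + s * x) (s * y)"
    by (simp add: complex_eq_iff)
  ultimately have "cmod (F (Complex (a + s * x) (s * y))) * exp (L * u) * exp (- L * u) \<le> M * exp (- L * u)"
    by (intro mult_right_mono) auto
  then show ?thesis by (simp add: u_def mult.assoc flip: exp_add)
qed

section \<open>The truncated inverse Laplace transform\<close>

lemma higher_deriv_exp_mult: "(deriv ^^ n) (\<lambda>z. exp (c * z)) = (\<lambda>z. c ^ n * exp (c * z :: complex))"
proof (induction n)
  case (Suc n)
  have "deriv (\<lambda>z. c ^ n * exp (c * z)) z = c ^ Suc n * exp (c * z)" for z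
    by (rule DERIV_imp_deriv) (auto intro!: derivative_eq_intros)
  then show ?case unfolding funpow.simps o_apply Suc by (rule ext)
qed simp

lemma contour_integral_same_ends:
  assumes "f holomorphic_on S" "open S" "convex S" "valid_path g1" "valid_path g2"
    "path_image g1 \<subseteq> S" "path_image g2 \<subseteq> S"
    "pathstart g1 = pathstart g2" "pathfinish g1 = pathfinish g2"
  shows "contour_integral g1 f = contour_integral g2 f"
proof -
  obtain F where F: "\<And>x. x \<in> S \<Longrightarrow> (F has_field_derivative f x) (at x within S)"
    using holomorphic_convex_primitive'[OF assms(3,2,1)] by blast
  have "contour_integral g1 f = F (pathfinish g1) - F (pathstart g1)"
    using F assms by (intro contour_integral_unique contour_integral_primitive) auto
  moreover have "contour_integral g2 f = F (pathfinish g2) - F (pathstart g2)"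
    using F assms by (intro contour_integral_unique contour_integral_primitive) auto
  ultimately show ?thesis using assms(8,9) by simp
qed

text \<open>The circle path starts at angle 0, so the right half consists of its first and last
  quarters; the last quarter is moved back by a full period.\<close>

lemma contour_integral_circlepath_split:
  fixes f :: "complex \<Rightarrow> complex"
  assumes f: "continuous_on (sphere a r) f" and r: "r > 0"
  shows "contour_integral (circlepath a r) f =
    contour_integral (part_circlepath a r (- pi / 2) (pi / 2)) f +
    contour_integral (part_circlepath a r (pi / 2) (3 * pi / 2)) f"
proof -
  define \<phi> where "\<phi> t = f (a + r * cis t) * r * \<i> * cis t" for t
  have "continuous_on UNIV (\<lambda>t. f (a + r * cis t))"
    by (rule continuous_on_compose2[OF f])
      (use r in \<open>auto intro!: continuous_intros simp: dist_norm norm_mult\<close>)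
  then have cont: "continuous_on UNIV \<phi>" unfolding \<phi>_def by (intro continuous_intros) auto
  have int: "\<phi> integrable_on {s..t}" for s t
    using cont by (intro integrable_continuous_interval) (rule continuous_on_subset, auto)
  have per: "\<phi> (t + 2 * pi) = \<phi> t" for t
    by (simp add: \<phi>_def cis.ctr)
  have "contour_integral (circlepath a r) f = integral {0..2 * pi} \<phi>"
    unfolding circlepath_def \<phi>_def by (subst contour_integral_part_circlepath_eq) auto
  also have "\<dots> = integral {0..pi/2} \<phi> + (integral {pi/2..3*pi/2} \<phi> + integral {3*pi/2..2*pi} \<phi>)"
    using Henstock_Kurzweil_Integration.integral_combine[where a = 0 and c = "pi/2" and b = "2*pi" and f = \<phi>]
      Henstock_Kurzweil_Integration.integral_combine[where a = "pi/2" and c = "3*pi/2" and b = "2*pi" and f = \<phi>] int by simp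
  also have "integral {3*pi/2..2*pi} \<phi> = integral {-pi/2..0} \<phi>"
  proof -
    have "integral {3*pi/2 - 2*pi..2*pi - 2*pi} (\<lambda>x. \<phi> (x + 2*pi)) = integral {3*pi/2..2*pi} \<phi>"
      by (rule integral_shift_real_ivl)
    then show ?thesis by (simp add: per)
  qed
  also have "integral {0..pi/2} \<phi> + (integral {pi/2..3*pi/2} \<phi> + integral {-pi/2..0} \<phi>)
     = integral {-pi/2..pi/2} \<phi> + integral {pi/2..3*pi/2} \<phi>"
    using Henstock_Kurzweil_Integration.integral_combine[where a = "-pi/2" and c = 0 and b = "pi/2" and f = \<phi>] int by (simp add: add.commute)
  finally show ?thesis
    unfolding \<phi>_def by (subst (1 2) contour_integral_part_circlepath_eq) auto
qed

definition truncated_inverse_Laplace :: "nat \<Rightarrow> real \<Rightarrow> real \<Rightarrow> real \<Rightarrow> complex" where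
  "truncated_inverse_Laplace S a Y u = fact S / (2 * pi * \<i>) *
     contour_integral (linepath (Complex a (- Y)) (Complex a Y)) (\<lambda>z. exp (z * u) / z ^ Suc S)"

text \<open>The segment is closed up by the left or right half of the circle with the same end points, on
  the side where the exponential is bounded.\<close>

lemma truncated_inverse_Laplace_error:
  assumes a: "a > 0" and Y: "Y \<ge> 2 * a"
  shows "cmod (truncated_inverse_Laplace S a Y u - trunc_power S u) \<le> fact S * 2 ^ S / Y ^ S * exp (a * u)"
proof -
  define f where "f z = exp (z * u) / z ^ Suc S" for z :: complex
  define I where "I = contour_integral (linepath (Complex a (- Y)) (Complex a Y)) f"
  define R where "R = contour_integral (part_circlepath a Y (- pi / 2) (pi / 2)) f"
  define L where "L = contour_integral (part_circlepath a Y (pi / 2) (3 * pi / 2)) f"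
  have Y0: "Y > 0" "Y > a" using a Y by auto
  have f_hol: "f holomorphic_on A" if "0 \<notin> A" for A
    unfolding f_def using that by (intro holomorphic_intros) auto
  \<comment> \<open>Here Y \<ge> 2 a is used: the circle about a stays at distance at least Y / 2
    from the pole at 0.\<close>
  have nz: "cmod z \<ge> Y / 2" if "cmod (z - a) = Y" for z :: complex
  proof -
    have "cmod (z - a) \<le> cmod z + cmod a" by (rule norm_triangle_ineq4)
    then show ?thesis using that a Y by simp
  qed
  have 0: "0 \<notin> sphere (complex_of_real a) Y" using a Y by (auto simp: dist_norm)
  have fc: "continuous_on (sphere (complex_of_real a) Y) f"
    using f_hol[OF 0] by (rule holomorphic_on_imp_continuous_on)
  have IR: "I = R"
    unfolding I_def R_def
  proof (rule contour_integral_same_ends[of f "{z. Re z > 0}"])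
    show "f holomorphic_on {z. 0 < Re z}" by (rule f_hol) simp
    show "open {z. 0 < Re z}" by (simp add: open_halfspace_Re_gt)
    show "convex {z. 0 < Re z}" by (simp add: convex_halfspace_Re_gt)
    show "path_image (linepath (Complex a (- Y)) (Complex a Y)) \<subseteq> {z. 0 < Re z}"
    proof -
      have "closed_segment (Complex a (- Y)) (Complex a Y) \<subseteq> {z. 0 < Re z}"
        using a by (intro closed_segment_subset) (auto simp: convex_halfspace_Re_gt)
      then show ?thesis by simp
    qed
    show "path_image (part_circlepath a Y (- pi / 2) (pi / 2)) \<subseteq> {z. 0 < Re z}"
    proof
      fix z assume "z \<in> path_image (part_circlepath a Y (- pi / 2) (pi / 2))"
      then obtain t where t: "t \<in> {-pi/2..pi/2}" "z = a + Y * exp (\<i> * t)"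
        by (auto simp: path_image_part_circlepath)
      have "cos t \<ge> 0" using t by (intro cos_ge_zero) auto
      then have "Re z \<ge> a" using t Y0 by (simp add: Re_exp)
      then show "z \<in> {z. 0 < Re z}" using a by simp
    qed
    show "pathstart (linepath (Complex a (- Y)) (Complex a Y)) = pathstart (part_circlepath a Y (- pi / 2) (pi / 2))"
      by (simp add: complex_eq_iff Re_exp Im_exp)
    show "pathfinish (linepath (Complex a (- Y)) (Complex a Y)) = pathfinish (part_circlepath a Y (- pi / 2) (pi / 2))"
      by (simp add: complex_eq_iff Re_exp Im_exp)
  qed auto
  \<comment> \<open>The full circle encloses the pole at 0, whose residue is u^S / S!. Hence for u >
    0 the error is the left arc, while for u \<le> 0 the truncated power is 0 and the right arc
    itself is the error.\<close>
  have RL: "R + L = 2 * pi * \<i> / fact S * of_real u ^ S"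
  proof -
    have "((\<lambda>z. exp (of_real u * z) / (z - 0) ^ Suc S) has_contour_integral
        (2 * pi * \<i> / fact S * (deriv ^^ S) (\<lambda>z. exp (of_real u * z)) 0)) (circlepath a Y)"
      using a Y by (intro Cauchy_has_contour_integral_higher_derivative_circlepath)
        (auto intro!: continuous_intros holomorphic_intros simp: dist_norm)
    moreover have "(\<lambda>z. exp (of_real u * z) / (z - 0) ^ Suc S) = f"
      by (simp add: f_def fun_eq_iff mult.commute)
    ultimately have "contour_integral (circlepath a Y) f = 2 * pi * \<i> / fact S * of_real u ^ S"
      unfolding higher_deriv_exp_mult by (intro contour_integral_unique) simp
    then show ?thesis
      using contour_integral_circlepath_split[OF fc Y0(1)] by (simp add: R_def L_def)
  qed
  have arc: "cmod (contour_integral (part_circlepath a Y s t) f) \<le> exp (a * u) * (2 / Y) ^ Suc S * Y * pi"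
    if st: "t = s + pi" and sgn: "\<And>\<theta>. \<theta> \<in> {s..t} \<Longrightarrow> u * cos \<theta> \<le> 0" for s t
  proof -
    have "cmod (contour_integral (part_circlepath a Y s t) f) \<le> exp (a * u) * (2 / Y) ^ Suc S * Y * (t - s)"
    proof (rule contour_integral_bound_part_circlepath_strong[where k = "{}"])
      have sub: "path_image (part_circlepath a Y s t) \<subseteq> sphere (complex_of_real a) Y"
        using path_image_part_circlepath_subset[of s t Y a] st Y0 by auto
      show "f contour_integrable_on part_circlepath a Y s t"
        by (rule contour_integrable_continuous_part_circlepath[OF continuous_on_subset[OF fc sub]])
      fix z assume z: "z \<in> path_image (part_circlepath a Y s t) - {}"
      then obtain \<theta> where \<theta>: "\<theta> \<in> {s..t}" "z = a + Y * exp (\<i> * \<theta>)"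
        using st by (auto simp: path_image_part_circlepath closed_segment_eq_real_ivl)
      have "Re (z * u) = a * u + Y * (u * cos \<theta>)" using \<theta> by (simp add: Re_exp algebra_simps)
      also have "\<dots> \<le> a * u" using sgn[OF \<theta>(1)] Y0 by (simp add: mult_nonneg_nonpos)
      finally have 1: "cmod (exp (z * u)) \<le> exp (a * u)" by simp
      have "cmod z \<ge> Y / 2" using z sub by (intro nz) (auto simp: dist_norm norm_minus_commute)
      then have "cmod z ^ Suc S \<ge> (Y / 2) ^ Suc S" using Y0 by (intro power_mono) auto
      then have "cmod (f z) \<le> exp (a * u) / (Y / 2) ^ Suc S"
        unfolding f_def norm_divide norm_power using 1 Y0 by (intro frac_le zero_less_power) auto
      also have "\<dots> = exp (a * u) * (2 / Y) ^ Suc S" by (simp add: power_divide field_simps)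
      finally show "cmod (f z) \<le> exp (a * u) * (2 / Y) ^ Suc S" .
    qed (use Y0 st in auto)
    then show ?thesis using st by simp
  qed
  have "cmod (I - 2 * pi * \<i> / fact S * of_real (trunc_power S u)) \<le> exp (a * u) * (2 / Y) ^ Suc S * Y * pi"
  proof (cases "u > 0")
    case True
    then have "I - 2 * pi * \<i> / fact S * of_real (trunc_power S u) = - L"
      using IR RL by (simp add: trunc_power_def algebra_simps)
    moreover have "cmod L \<le> exp (a * u) * (2 / Y) ^ Suc S * Y * pi"
      unfolding L_def
    proof (rule arc)
      fix \<theta> assume \<theta>: "\<theta> \<in> {pi / 2..3 * pi / 2}"
      have "cos (\<theta> - pi) \<ge> 0" using \<theta> by (intro cos_ge_zero) auto
      then show "u * cos \<theta> \<le> 0" using True by (simp add: mult_nonneg_nonpos)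
    qed simp
    ultimately show ?thesis by simp
  next
    case False
    have "cmod R \<le> exp (a * u) * (2 / Y) ^ Suc S * Y * pi"
      unfolding R_def
    proof (rule arc)
      fix \<theta> assume \<theta>: "\<theta> \<in> {- pi / 2..pi / 2}"
      have "cos \<theta> \<ge> 0" using \<theta> by (intro cos_ge_zero) auto
      then show "u * cos \<theta> \<le> 0" using False by (simp add: mult_nonpos_nonneg)
    qed simp
    then show ?thesis using False IR by (simp add: trunc_power_def)
  qed
  moreover have "truncated_inverse_Laplace S a Y u - trunc_power S u
     = fact S / (2 * pi * \<i>) * (I - 2 * pi * \<i> / fact S * of_real (trunc_power S u))"
    by (simp add: truncated_inverse_Laplace_def I_def f_def[abs_def] field_simps)
  moreover have "cmod (fact S / (2 * pi * \<i>)) = fact S / (2 * pi)"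
    by (simp add: norm_divide norm_mult)
  ultimately have "cmod (truncated_inverse_Laplace S a Y u - trunc_power S u)
     \<le> fact S / (2 * pi) * (exp (a * u) * (2 / Y) ^ Suc S * Y * pi)"
    by (simp only: norm_mult) (intro mult_left_mono, auto)
  also have "\<dots> = fact S * 2 ^ S / Y ^ S * exp (a * u)"
    using Y0 by (simp add: power_divide)
  finally show ?thesis .
qed

section \<open>The heat kernel at complex times\<close>

lemma borel_measurable_cnj [measurable]: "cnj \<in> borel_measurable borel"
  by (intro borel_measurable_continuous_onI continuous_intros)

text \<open>The data for the kernel estimates. Since balls need not be measurable, the volume
  condition is stated for a measurable hull of each ball.\<close>

locale heat_system =
  fixes d :: "'a \<Rightarrow> 'a \<Rightarrow> real" and M :: "'a measure" and lam :: "nat \<Rightarrow> real"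
    and \<phi> :: "nat \<Rightarrow> 'a \<Rightarrow> complex" and q c1 c2 cb :: real
  assumes sigma_finite: "sigma_finite_measure M"
    and space_M: "space M = UNIV"
    and d_refl: "d x x = 0" and d_sym: "d x y = d y x"
    and lam_nonneg: "0 \<le> lam k" and lam_lim: "filterlim lam at_top sequentially"
    and \<phi>_int: "integrable M (\<phi> k)" and \<phi>_bnd: "bounded (range (\<phi> k))"
    and orth: "(LINT x|M. \<phi> j x * cnj (\<phi> k x)) = (if j = k then 1 else 0)"
    and q: "q > 0" and c1: "c1 > 0" and c2: "c2 > 0" and cb: "cb > 0"
    and heat_summable: "t > 0 \<Longrightarrow> summable (\<lambda>k. complex_of_real (exp (- (lam k)\<^sup>2 * t)) * \<phi> k x * cnj (\<phi> k y))"
    and heat_bound: "0 < t \<Longrightarrow> t \<le> 1 \<Longrightarrow>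
      cmod (heat_kernel lam \<phi> t x y) \<le> c1 * t powr (- q / 2) * exp (- c2 * (d x y)\<^sup>2 / t)"
    and ball_hull: "r > 0 \<Longrightarrow> \<exists>E\<in>sets M. qball d x r \<subseteq> E \<and> emeasure M E \<le> ennreal (cb * r powr q)"
begin

lemma \<phi>_measurable [measurable]: "\<phi> k \<in> borel_measurable M"
  using \<phi>_int by simp

lemma \<phi>_bound_ex: "\<exists>B>0. \<forall>x. cmod (\<phi> k x) \<le> B"
  using \<phi>_bnd[of k] unfolding bounded_pos by auto

lemma finite_lam_less: "finite {k. lam k < n}"
proof -
  have "eventually (\<lambda>k. lam k \<ge> n) sequentially"
    using lam_lim by (simp add: filterlim_at_top)
  then obtain K where "\<And>k. k \<ge> K \<Longrightarrow> lam k \<ge> n" by (auto simp: eventually_sequentially)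
  then have "{k. lam k < n} \<subseteq> {..<K}" by (auto simp: not_le[symmetric])
  then show ?thesis using finite_subset by blast
qed

lemma integrable_\<phi>_\<phi>: "integrable M (\<lambda>x. \<phi> j x * cnj (\<phi> k x))"
proof -
  obtain B where B: "\<And>x. cmod (\<phi> j x) \<le> B" using \<phi>_bound_ex by blast
  have i1: "integrable M (\<lambda>x. of_real B * cnj (\<phi> k x))"
    using \<phi>_int[of k] by (intro integrable_mult_right) simp
  have i2: "AE x in M. norm (\<phi> j x * cnj (\<phi> k x)) \<le> norm (of_real B * cnj (\<phi> k x))"
  proof (rule AE_I2)
    fix x
    have "cmod (\<phi> j x) * cmod (\<phi> k x) \<le> \<bar>B\<bar> * cmod (\<phi> k x)"
      using B[of x] by (intro mult_right_mono) auto
    then show "norm (\<phi> j x * cnj (\<phi> k x)) \<le> norm (of_real B * cnj (\<phi> k x))"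
      by (simp add: norm_mult)
  qed
  show ?thesis
    by (rule Bochner_Integration.integrable_bound[OF i1 _ i2]) measurable
qed

lemma nn_integral_orthonormal_sum:
  assumes "finite A"
  shows "(\<integral>\<^sup>+y. ennreal ((cmod (\<Sum>k\<in>A. b k * \<phi> k y))\<^sup>2) \<partial>M) = ennreal (\<Sum>k\<in>A. (cmod (b k))\<^sup>2)"
proof -
  define f where "f y = (\<Sum>k\<in>A. b k * \<phi> k y)" for y
  have f: "of_real ((cmod (f y))\<^sup>2) = (\<Sum>j\<in>A. \<Sum>k\<in>A. (b j * cnj (b k)) * (\<phi> j y * cnj (\<phi> k y)))" for y
    unfolding complex_norm_square by (simp add: f_def cnj_sum sum_product mult_ac)
  have i: "integrable M (\<lambda>y. complex_of_real ((cmod (f y))\<^sup>2))"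
    unfolding f by (intro Bochner_Integration.integrable_sum integrable_mult_right integrable_\<phi>_\<phi>)
  then have i': "integrable M (\<lambda>y. (cmod (f y))\<^sup>2)"
    using integrable_Re[OF i] by simp
  have "complex_of_real (LINT y|M. (cmod (f y))\<^sup>2) = (LINT y|M. complex_of_real ((cmod (f y))\<^sup>2))"
    by (rule integral_complex_of_real[symmetric])
  also have "\<dots> = (\<Sum>j\<in>A. \<Sum>k\<in>A. (b j * cnj (b k)) * (if j = k then 1 else 0))"
    unfolding f by (simp add: Bochner_Integration.integral_sum integrable_\<phi>_\<phi> orth)
  also have "\<dots> = (\<Sum>j\<in>A. b j * cnj (b j))"
    using assms by (intro sum.cong refl) (simp add: sum.delta' if_distrib cong: if_cong)
  also have "\<dots> = complex_of_real (\<Sum>k\<in>A. (cmod (b k))\<^sup>2)"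
    by (simp add: complex_norm_square[symmetric] del: of_real_power)
  finally have "(LINT y|M. (cmod (f y))\<^sup>2) = (\<Sum>k\<in>A. (cmod (b k))\<^sup>2)"
    using of_real_eq_iff by blast
  then show ?thesis
    using nn_integral_eq_integral[OF i'] by (simp add: f_def)
qed

lemma nn_integral_orthonormal_sum_cnj:
  assumes "finite A"
  shows "(\<integral>\<^sup>+y. ennreal ((cmod (\<Sum>k\<in>A. b k * cnj (\<phi> k y)))\<^sup>2) \<partial>M) = ennreal (\<Sum>k\<in>A. (cmod (b k))\<^sup>2)"
proof -
  have "cmod (\<Sum>k\<in>A. b k * cnj (\<phi> k y)) = cmod (\<Sum>k\<in>A. cnj (b k) * \<phi> k y)" for y
    by (subst complex_mod_cnj[symmetric]) (simp add: cnj_sum)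
  then show ?thesis using nn_integral_orthonormal_sum[OF assms, of "\<lambda>k. cnj (b k)"] by simp
qed

text \<open>On the diagonal every term is nonnegative and \<open>d x x = 0\<close>, so the kernel
  bound controls a sum of absolute values. Absolute convergence at complex times and off the
  diagonal is reduced to this case.\<close>

lemma heat_diagonal:
  assumes "t > 0"
  shows "summable (\<lambda>k. exp (- (lam k)\<^sup>2 * t) * (cmod (\<phi> k x))\<^sup>2)"
    and "t \<le> 1 \<Longrightarrow> (\<Sum>k. exp (- (lam k)\<^sup>2 * t) * (cmod (\<phi> k x))\<^sup>2) \<le> c1 * t powr (- q / 2)"
proof -
  have eq: "complex_of_real (exp (- (lam k)\<^sup>2 * t)) * \<phi> k x * cnj (\<phi> k x)
      = complex_of_real (exp (- (lam k)\<^sup>2 * t) * (cmod (\<phi> k x))\<^sup>2)" for k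
    by (simp only: of_real_mult complex_norm_square mult.assoc)
  show s: "summable (\<lambda>k. exp (- (lam k)\<^sup>2 * t) * (cmod (\<phi> k x))\<^sup>2)"
    using summable_Re[OF heat_summable[OF assms, of x x]] unfolding eq by simp
  assume "t \<le> 1"
  have "heat_kernel lam \<phi> t x x = complex_of_real (\<Sum>k. exp (- (lam k)\<^sup>2 * t) * (cmod (\<phi> k x))\<^sup>2)"
    unfolding heat_kernel_def eq using s by (rule suminf_of_real[symmetric])
  moreover have "(\<Sum>k. exp (- (lam k)\<^sup>2 * t) * (cmod (\<phi> k x))\<^sup>2) \<ge> 0"
    using s by (intro suminf_nonneg) auto
  ultimately show "(\<Sum>k. exp (- (lam k)\<^sup>2 * t) * (cmod (\<phi> k x))\<^sup>2) \<le> c1 * t powr (- q / 2)"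
    using heat_bound[OF assms \<open>t \<le> 1\<close>, of x x] by (simp add: d_refl)
qed

section \<open>Continuation of the heat kernel to the right half-plane\<close>

definition complex_heat_term :: "nat \<Rightarrow> 'a \<Rightarrow> 'a \<Rightarrow> complex \<Rightarrow> complex" where
  "complex_heat_term k x y z = exp (- of_real ((lam k)\<^sup>2) * z) * \<phi> k x * cnj (\<phi> k y)"

definition complex_heat :: "'a \<Rightarrow> 'a \<Rightarrow> complex \<Rightarrow> complex" where
  "complex_heat x y z = (\<Sum>k. complex_heat_term k x y z)"

text \<open>By the arithmetic-geometric mean, two diagonal terms dominate a mixed one; the bound is
  uniform on Re z \<ge> a.\<close>

definition heat_majorant :: "real \<Rightarrow> 'a \<Rightarrow> 'a \<Rightarrow> nat \<Rightarrow> real" where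
  "heat_majorant a x y k = (exp (- (lam k)\<^sup>2 * a) * (cmod (\<phi> k x))\<^sup>2 + exp (- (lam k)\<^sup>2 * a) * (cmod (\<phi> k y))\<^sup>2) / 2"

lemma complex_heat_term_le:
  assumes "Re z \<ge> a"
  shows "cmod (complex_heat_term k x y z) \<le> heat_majorant a x y k"
proof -
  have "cmod (complex_heat_term k x y z) = exp (- (lam k)\<^sup>2 * Re z) * (cmod (\<phi> k x) * cmod (\<phi> k y))"
    by (simp add: complex_heat_term_def norm_mult)
  also have "\<dots> \<le> exp (- (lam k)\<^sup>2 * a) * (((cmod (\<phi> k x))\<^sup>2 + (cmod (\<phi> k y))\<^sup>2) / 2)"
    using assms sum_squares_bound[of "cmod (\<phi> k x)" "cmod (\<phi> k y)"]
    by (intro mult_mono) (auto simp: mult_left_mono)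
  finally show ?thesis by (simp add: heat_majorant_def ring_distribs add_divide_distrib)
qed

lemma summable_heat_majorant: "a > 0 \<Longrightarrow> summable (heat_majorant a x y)"
  unfolding heat_majorant_def[abs_def] by (intro summable_divide summable_add heat_diagonal(1))

lemma summable_complex_heat_term: "Re z > 0 \<Longrightarrow> summable (\<lambda>k. complex_heat_term k x y z)"
  by (rule summable_comparison_test'[OF summable_heat_majorant, of "Re z"]) (auto intro: complex_heat_term_le)

text \<open>Although the Gaussian bound stops at time 1, Re z is not limited from above: the
  majorant depends on a alone, so only a has to be at most 1. This supplies the global bound for the
  two-constants argument.\<close>

lemma complex_heat_bound:
  assumes "0 < a" "a \<le> 1" "Re z \<ge> a"
  shows "cmod (complex_heat x y z) \<le> c1 * a powr (- q / 2)"
proof -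
  have "cmod (complex_heat x y z) \<le> (\<Sum>k. heat_majorant a x y k)"
    unfolding complex_heat_def using assms by (intro norm_suminf_le complex_heat_term_le summable_heat_majorant)
  also have "\<dots> = ((\<Sum>k. exp (- (lam k)\<^sup>2 * a) * (cmod (\<phi> k x))\<^sup>2) + (\<Sum>k. exp (- (lam k)\<^sup>2 * a) * (cmod (\<phi> k y))\<^sup>2)) / 2"
    unfolding heat_majorant_def using heat_diagonal(1)[OF \<open>0 < a\<close>]
    by (subst suminf_divide) (auto intro!: summable_add simp: suminf_add)
  also have "\<dots> \<le> (c1 * a powr (- q / 2) + c1 * a powr (- q / 2)) / 2"
    using assms by (intro divide_right_mono add_mono heat_diagonal) auto
  finally show ?thesis by simp
qed

lemma complex_heat_uniform_limit:
  assumes "a > 0" "A \<subseteq> {z. Re z \<ge> a}"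
  shows "uniform_limit A (\<lambda>n z. \<Sum>k<n. complex_heat_term k x y z) (complex_heat x y) sequentially"
  unfolding complex_heat_def
  using assms by (intro Weierstrass_m_test[OF _ summable_heat_majorant[of a x y]] complex_heat_term_le) auto

lemma complex_heat_holomorphic: "complex_heat x y holomorphic_on {z. Re z > 0}"
proof (rule holomorphic_uniform_sequence)
  show "open {z. Re z > 0}" by (simp add: open_halfspace_Re_gt)
  show "(\<lambda>z. \<Sum>k<n. complex_heat_term k x y z) holomorphic_on {z. Re z > 0}" for n
    unfolding complex_heat_term_def by (intro holomorphic_intros)
  fix z assume "z \<in> {z. Re z > 0}"
  then have z: "Re z > 0" by simp
  have sub: "cball z (Re z / 2) \<subseteq> {w. Re w \<ge> Re z / 2}"
  proof
    fix w assume "w \<in> cball z (Re z / 2)"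
    then have "Re (z - w) \<le> Re z / 2"
      using complex_Re_le_cmod[of "z - w"] by (simp add: dist_norm)
    then show "w \<in> {w. Re w \<ge> Re z / 2}" by simp
  qed
  moreover have "{w. Re w \<ge> Re z / 2} \<subseteq> {z. Re z > 0}" using z by auto
  ultimately show "\<exists>e>0. cball z e \<subseteq> {z. 0 < Re z} \<and>
      uniform_limit (cball z e) (\<lambda>n z. \<Sum>k<n. complex_heat_term k x y z) (complex_heat x y) sequentially"
    using z complex_heat_uniform_limit[OF _ sub] by (intro exI[of _ "Re z / 2"]) auto
qed

lemma complex_heat_of_real: "complex_heat x y (of_real t) = heat_kernel lam \<phi> t x y"
  unfolding complex_heat_def heat_kernel_def complex_heat_term_def
  by (simp flip: exp_of_real)

text \<open>The lower half of the inversion line is reduced to the upper one by exchanging x and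
  y.\<close>

lemma complex_heat_cnj: "cmod (complex_heat x y (cnj z)) = cmod (complex_heat y x z)" if "Re z > 0"
proof -
  have "(\<lambda>k. complex_heat_term k y x z) sums complex_heat y x z"
    unfolding complex_heat_def using that by (intro summable_sums summable_complex_heat_term)
  then have "(\<lambda>k. cnj (complex_heat_term k y x z)) sums cnj (complex_heat y x z)"
    by (simp add: sums_cnj)
  moreover have "cnj (complex_heat_term k y x z) = complex_heat_term k x y (cnj z)" for k
    by (simp add: complex_heat_term_def exp_cnj mult_ac)
  ultimately have "complex_heat x y (cnj z) = cnj (complex_heat y x z)"
    unfolding complex_heat_def by (simp add: sums_iff)
  then show ?thesis by simp
qed

text \<open>The quadrant is given the corner a / 2 rather than a, since the minorant vanishes on the
  vertical boundary line and the point a + i \<eta> has to lie inside; its scaled abscissa is X = a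
  / (2 s). The decay L comes from the Gaussian bound on the real segment from a / 2 to a / 2 + 2
  s.\<close>

lemma complex_heat_off_diagonal_upper:
  assumes w: "w \<ge> 2" and \<rho>: "\<rho> \<ge> 1" and Z: "Z \<ge> 1" and a: "a = 1 / w\<^sup>2" and Y: "Y = 2 * Z * a"
    and dxy: "d x y \<ge> \<rho> / w" and \<eta>: "0 \<le> \<eta>" "\<eta> \<le> Y"
  shows "cmod (complex_heat x y (Complex a \<eta>)) \<le> c1 * 2 powr (q / 2) * w powr q * exp (- c2 / 6144 * (\<rho>\<^sup>2 / Z ^ 4))"
proof -
  \<comment> \<open>The cap 1 / 4 keeps the times up to a / 2 + 2 s below 1, where the Gaussian
    bound is known; as a \<le> s they are also at most 3 s, whence the 3 in L.\<close>
  define s where "s = min Y (1 / 4)"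
  define r where "r = \<rho> / w"
  define L where "L = c2 * r\<^sup>2 / (3 * s)"
  define M0 where "M0 = c1 * (a / 2) powr (- q / 2)"
  define X where "X = a / (2 * s)"
  define b where "b = 1 + \<eta> / s"
  have "w\<^sup>2 \<ge> 2\<^sup>2" using w by (intro power_mono) auto
  then have a4: "0 < a" "a \<le> 1 / 4" using w divide_left_mono[of 4 "w\<^sup>2" 1] unfolding a by auto
  have Ya: "Y \<ge> 2 * a" using Y Z a4 by simp
  have Y0: "Y > 0" using Ya a4 by linarith
  have s: "s > 0" "s \<ge> a" "s \<le> 1 / 4" "s \<le> Y" using Ya a4 by (auto simp: s_def)
  have r0: "r > 0" using \<rho> w by (simp add: r_def)
  have L: "L \<ge> 0" using c2 s by (simp add: L_def)
  have M0: "M0 > 0" using c1 a4 by (simp add: M0_def)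
  have "cmod (complex_heat x y (Complex (a / 2 + s * X) (s * (\<eta> / s))))
    \<le> M0 * exp (- L * (X * (3 * (1 + \<eta> / s)\<^sup>2 - X\<^sup>2) / ((1 + \<eta> / s)\<^sup>2 + X\<^sup>2) ^ 3))"
  proof (rule two_constants_quadrant[OF complex_heat_holomorphic])
    show "cmod (complex_heat x y z) \<le> M0" if "a / 2 \<le> Re z" for z
      unfolding M0_def using that a4 by (intro complex_heat_bound) auto
    show "cmod (complex_heat x y (of_real t)) \<le> M0 * exp (- L)" if t: "a / 2 \<le> t" "t \<le> a / 2 + 2 * s" for t
    proof -
      have t1: "0 < t" "t \<le> 1" "t \<le> 3 * s" using t a4 s by auto
      have "cmod (complex_heat x y (of_real t)) \<le> c1 * t powr (- q / 2) * exp (- c2 * (d x y)\<^sup>2 / t)"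
        unfolding complex_heat_of_real using t1 by (intro heat_bound)
      also have "\<dots> \<le> c1 * (a / 2) powr (- q / 2) * exp (- L)"
      proof (intro mult_mono)
        show "t powr (- q / 2) \<le> (a / 2) powr (- q / 2)"
          using t a4 q by (intro powr_mono2') auto
        have "L \<le> c2 * (d x y)\<^sup>2 / t"
          unfolding L_def using dxy r0 t1 c2 by (intro frac_le mult_left_mono power_mono) (auto simp: r_def)
        then show "exp (- c2 * (d x y)\<^sup>2 / t) \<le> exp (- L)" by simp
      qed (use c1 in auto)
      finally show ?thesis by (simp add: M0_def)
    qed
  qed (use a4 s L M0 \<eta> in \<open>auto simp: X_def\<close>)
  moreover have "a / 2 + s * X = a" using s by (simp add: X_def)
  moreover have "s * (\<eta> / s) = \<eta>" using s by simp
  ultimately have main: "cmod (complex_heat x y (Complex a \<eta>)) \<le> M0 * exp (- L * (X * (3 * b\<^sup>2 - X\<^sup>2) / (b\<^sup>2 + X\<^sup>2) ^ 3))"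
    by (simp add: b_def)
  have b1: "b \<ge> 1" using \<eta> s by (simp add: b_def)
  have X1: "0 < X" "X \<le> 1" using a4 s by (auto simp: X_def)
  have Xb: "X\<^sup>2 \<le> b\<^sup>2" using X1 b1 by (intro power_mono) auto
  have P: "0 \<le> X * (3 * b\<^sup>2 - X\<^sup>2)"
    using X1 Xb zero_le_power2[of b] by (intro mult_nonneg_nonneg) linarith+
  \<comment> \<open>Since X \<le> 1 \<le> b, the numerator is at least 2 X b^2 and the denominator
    at most (2 b^2)^3; b is then bounded by 2 Y / s.\<close>
  have "X / (4 * b ^ 4) = X * (2 * b\<^sup>2) / (2 * b\<^sup>2) ^ 3"
    using b1 by (simp add: power_mult_distrib field_simps flip: power_mult power_add power_Suc)
  also have "\<dots> \<le> X * (3 * b\<^sup>2 - X\<^sup>2) / (b\<^sup>2 + X\<^sup>2) ^ 3"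
    using X1 Xb b1 by (intro frac_le mult_left_mono power_mono P) (auto intro!: zero_less_power add_pos_nonneg)
  finally have u1: "X / (4 * b ^ 4) \<le> X * (3 * b\<^sup>2 - X\<^sup>2) / (b\<^sup>2 + X\<^sup>2) ^ 3" .
  have "b * s = s + \<eta>" using s by (simp add: b_def distrib_right)
  then have "b * s \<le> 2 * Y" using \<eta> s by simp
  then have "b \<le> 2 * Y / s" using s by (simp add: field_simps)
  then have "b ^ 4 \<le> (2 * Y / s) ^ 4" using b1 by (intro power_mono) auto
  then have "X / (4 * (2 * Y / s) ^ 4) \<le> X / (4 * b ^ 4)"
    using X1 b1 s Y0 by (intro divide_left_mono) (auto intro!: mult_pos_pos zero_less_power divide_pos_pos)
  with u1 have u2: "X / (4 * (2 * Y / s) ^ 4) \<le> X * (3 * b\<^sup>2 - X\<^sup>2) / (b\<^sup>2 + X\<^sup>2) ^ 3" by linarith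
  \<comment> \<open>6144 = 3 * 2 * 4 * 2^4 * 2^4 collects the 3 of L, the 2 of X, the 4 of the
    minorant, the bound b \<le> 2 Y / s and Y = 2 Z a. What is left of s is removed by s \<ge>
    a.\<close>
  have "c2 / 6144 * (\<rho>\<^sup>2 / Z ^ 4) = c2 * r\<^sup>2 * a * a\<^sup>2 / (384 * Y ^ 4)"
    using w Z by (simp add: r_def a Y field_simps power_mult_distrib)
  also have "\<dots> \<le> c2 * r\<^sup>2 * a * s\<^sup>2 / (384 * Y ^ 4)"
    using c2 a4 s Y0 by (intro divide_right_mono mult_left_mono power_mono) auto
  also have "\<dots> = L * (X / (4 * (2 * Y / s) ^ 4))"
    using s Y0 by (simp add: L_def X_def field_simps power_mult_distrib power_divide power2_eq_square power4_eq_xxxx)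
  also have "\<dots> \<le> L * (X * (3 * b\<^sup>2 - X\<^sup>2) / (b\<^sup>2 + X\<^sup>2) ^ 3)"
    using u2 L by (intro mult_left_mono)
  finally have "M0 * exp (- L * (X * (3 * b\<^sup>2 - X\<^sup>2) / (b\<^sup>2 + X\<^sup>2) ^ 3)) \<le> M0 * exp (- c2 / 6144 * (\<rho>\<^sup>2 / Z ^ 4))"
    using M0 by simp
  moreover have "M0 = c1 * 2 powr (q / 2) * w powr q"
  proof -
    have "a / 2 = 1 / (2 * w\<^sup>2)" by (simp add: a)
    then have "(a / 2) powr (- q / 2) = (2 * w\<^sup>2) powr (q / 2)"
      by (simp add: powr_minus powr_divide mult.commute)
    also have "\<dots> = 2 powr (q / 2) * (w powr 2) powr (q / 2)" using w by (simp add: powr_mult)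
    also have "(w powr 2) powr (q / 2) = w powr q" by (simp only: powr_powr) simp
    finally show ?thesis by (simp add: M0_def)
  qed
  ultimately show ?thesis using main by simp
qed

lemma complex_heat_off_diagonal:
  assumes w: "w \<ge> 2" and \<rho>: "\<rho> \<ge> 1" and Z: "Z \<ge> 1" and a: "a = 1 / w\<^sup>2" and Y: "Y = 2 * Z * a"
    and dxy: "d x y \<ge> \<rho> / w" and \<eta>: "\<bar>\<eta>\<bar> \<le> Y"
  shows "cmod (complex_heat x y (Complex a \<eta>)) \<le> c1 * 2 powr (q / 2) * w powr q * exp (- c2 / 6144 * (\<rho>\<^sup>2 / Z ^ 4))"
proof (cases "\<eta> \<ge> 0")
  case True
  then show ?thesis using assms by (intro complex_heat_off_diagonal_upper[OF w \<rho> Z a Y]) auto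
next
  case False
  have "Complex a \<eta> = cnj (Complex a (- \<eta>))" by (simp add: complex_eq_iff)
  then have eq: "cmod (complex_heat x y (Complex a \<eta>)) = cmod (complex_heat y x (Complex a (- \<eta>)))"
    using complex_heat_cnj[of "Complex a (- \<eta>)" x y] w by (simp add: a)
  show ?thesis unfolding eq using False \<eta> dxy d_sym[of x y]
    by (intro complex_heat_off_diagonal_upper[OF w \<rho> Z a Y]) auto
qed

end

section \<open>Bochner-Riesz kernels\<close>

lemma powr_exp_bounded:
  fixes c \<beta> m :: real
  assumes c: "c > 0" and \<beta>: "\<beta> > 0"
  shows "\<exists>C>0. \<forall>x\<ge>1. x powr m * exp (- c * x powr \<beta>) \<le> C"
proof -
  obtain k' :: nat where k': "m / \<beta> \<le> real k'" using real_arch_simple by blast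
  define k where "k = Suc k'"
  have k: "m / \<beta> \<le> real k" using k' by (simp add: k_def)
  have "x powr m * exp (- c * x powr \<beta>) \<le> real k ^ k / c ^ k" if x: "x \<ge> 1" for x
  proof -
    have "(c * x powr \<beta> / k) ^ k \<le> exp (c * x powr \<beta> / k) ^ k"
      using c exp_ge_add_one_self[of "c * x powr \<beta> / k"] by (intro power_mono) (linarith, simp)
    also have "\<dots> = exp (c * x powr \<beta>)"
      using exp_of_nat_mult[of k "c * x powr \<beta> / k"] by (simp add: k_def del: of_nat_Suc)
    finally have "(c * x powr \<beta>) ^ k \<le> real k ^ k * exp (c * x powr \<beta>)"
      by (simp add: power_divide divide_le_eq k_def mult.commute)
    then have "(c * x powr \<beta>) ^ k * exp (- c * x powr \<beta>) \<le> real k ^ k * exp (c * x powr \<beta>) * exp (- c * x powr \<beta>)"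
      by (intro mult_right_mono) auto
    then have "(c * x powr \<beta>) ^ k * exp (- c * x powr \<beta>) \<le> real k ^ k"
      by (simp add: mult.assoc flip: exp_add)
    moreover have "(c * x powr \<beta>) ^ k = c ^ k * x powr (\<beta> * k)"
      using x by (simp add: power_mult_distrib powr_powr[symmetric] powr_realpow)
    ultimately have "x powr (\<beta> * k) * exp (- c * x powr \<beta>) \<le> real k ^ k / c ^ k"
      using c by (simp add: pos_le_divide_eq mult_ac)
    moreover have "x powr m \<le> x powr (\<beta> * k)"
      using k x \<beta> by (intro powr_mono) (auto simp: field_simps)
    ultimately show ?thesis
      by (meson exp_ge_zero mult_right_mono order_trans)
  qed
  then show ?thesis using c by (intro exI[of _ "real k ^ k / c ^ k"]) (auto simp: k_def)
qed

text \<open>Cauchy-Schwarz on F, from 2 \<alpha> t \<le> \<alpha>^2 + t^2 with the weight \<alpha> =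
  b / sqrt m that makes both integrated bounds equal.\<close>

lemma nn_integral_le_sqrt_measure:
  fixes f :: "'a \<Rightarrow> complex"
  assumes [measurable]: "f \<in> borel_measurable M" "F \<in> sets M"
    and m: "m > 0" "emeasure M F \<le> ennreal m"
    and b: "b > 0" "(\<integral>\<^sup>+y. ennreal ((cmod (f y))\<^sup>2) \<partial>M) \<le> ennreal (b\<^sup>2)"
  shows "(\<integral>\<^sup>+y\<in>F. ennreal (cmod (f y)) \<partial>M) \<le> ennreal (sqrt m * b)"
proof -
  define \<alpha> where "\<alpha> = b / sqrt m"
  have \<alpha>: "\<alpha> > 0" using m b by (simp add: \<alpha>_def)
  have le: "cmod (f y) \<le> \<alpha> / 2 + 1 / (2 * \<alpha>) * (cmod (f y))\<^sup>2" for y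
  proof -
    have "2 * \<alpha> * cmod (f y) \<le> \<alpha>\<^sup>2 + (cmod (f y))\<^sup>2" using sum_squares_bound[of \<alpha> "cmod (f y)"] by simp
    then show ?thesis using \<alpha> by (simp add: field_simps power2_eq_square)
  qed
  have "(\<integral>\<^sup>+y\<in>F. ennreal (cmod (f y)) \<partial>M)
    \<le> (\<integral>\<^sup>+y. ennreal (\<alpha> / 2) * indicator F y + ennreal (1 / (2 * \<alpha>)) * ennreal ((cmod (f y))\<^sup>2) \<partial>M)"
  proof (intro nn_integral_mono)
    fix y
    have "ennreal (cmod (f y)) \<le> ennreal (\<alpha> / 2) + ennreal (1 / (2 * \<alpha>)) * ennreal ((cmod (f y))\<^sup>2)"
    proof -
      have "ennreal (cmod (f y)) \<le> ennreal (\<alpha> / 2 + 1 / (2 * \<alpha>) * (cmod (f y))\<^sup>2)"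
        by (rule ennreal_leI[OF le])
      also have "\<dots> = ennreal (\<alpha> / 2) + ennreal (1 / (2 * \<alpha>)) * ennreal ((cmod (f y))\<^sup>2)"
        using \<alpha> by (simp only: ennreal_plus ennreal_mult zero_le_mult_iff zero_le_power2 zero_le_divide_1_iff divide_nonneg_pos less_imp_le simp_thms)
      finally show ?thesis .
    qed
    then show "ennreal (cmod (f y)) * indicator F y
      \<le> ennreal (\<alpha> / 2) * indicator F y + ennreal (1 / (2 * \<alpha>)) * ennreal ((cmod (f y))\<^sup>2)"
      by (auto simp: indicator_def)
  qed
  also have "\<dots> = ennreal (\<alpha> / 2) * emeasure M F + ennreal (1 / (2 * \<alpha>)) * (\<integral>\<^sup>+y. ennreal ((cmod (f y))\<^sup>2) \<partial>M)"
    by (simp add: nn_integral_add nn_integral_cmult)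
  also have "\<dots> \<le> ennreal (\<alpha> / 2) * ennreal m + ennreal (1 / (2 * \<alpha>)) * ennreal (b\<^sup>2)"
    using m b by (intro add_mono mult_left_mono) auto
  also have "\<dots> = ennreal (\<alpha> / 2 * m + 1 / (2 * \<alpha>) * b\<^sup>2)"
    using \<alpha> m by (subst (1 2) ennreal_mult[symmetric]) (auto simp flip: ennreal_plus)
  also have "\<alpha> / 2 * m + 1 / (2 * \<alpha>) * b\<^sup>2 = sqrt m * b"
  proof -
    define r where "r = sqrt m"
    have r: "r > 0" "m = r\<^sup>2" using m by (auto simp: r_def)
    have "\<alpha> / 2 * r\<^sup>2 + 1 / (2 * \<alpha>) * b\<^sup>2 = r * b"
      using r(1) b(1) unfolding \<alpha>_def r_def[symmetric] by (simp add: field_simps power2_eq_square)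
    then show ?thesis by (simp only: r(2)[symmetric] r_def[symmetric])
  qed
  finally show ?thesis .
qed

lemma in_segment_Complex:
  assumes "z \<in> closed_segment (Complex a (- Y)) (Complex a Y)" "Y \<ge> 0"
  shows "\<exists>\<eta>. z = Complex a \<eta> \<and> \<bar>\<eta>\<bar> \<le> Y"
proof -
  from assms obtain u where u: "0 \<le> u" "u \<le> 1"
    "z = (1 - u) *\<^sub>R Complex a (- Y) + u *\<^sub>R Complex a Y"
    by (auto simp: closed_segment_def)
  then have "z = Complex a ((2 * u - 1) * Y)" by (simp add: complex_eq_iff algebra_simps)
  moreover have "\<bar>(2 * u - 1) * Y\<bar> \<le> 1 * Y"
    unfolding abs_mult using u assms(2) by (intro mult_mono) auto
  ultimately show ?thesis by auto
qed

lemma laplace_integrand_le: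
  assumes "a > 0" "z \<in> closed_segment (Complex a (- Y)) (Complex a Y)" "Y \<ge> 0"
  shows "cmod (exp (z * of_real u) / z ^ Suc S) \<le> exp (a * u) / a ^ Suc S"
proof -
  obtain \<eta> where \<eta>: "z = Complex a \<eta>" using in_segment_Complex assms by blast
  have "cmod (exp (z * of_real u)) = exp (a * u)" by (simp add: \<eta>)
  moreover have "a ^ Suc S \<le> cmod z ^ Suc S"
    using assms(1) abs_Re_le_cmod[of z] by (intro power_mono) (auto simp: \<eta>)
  ultimately show ?thesis
    unfolding norm_divide norm_power using assms(1) by (intro frac_le zero_less_power) auto
qed

context heat_system
begin

text \<open>The index range K is kept separate from w, so that one finite range can serve all w = n
  * v up to n * V when the kernels are integrated over v.\<close>

definition bochner_riesz :: "nat \<Rightarrow> nat \<Rightarrow> real \<Rightarrow> 'a \<Rightarrow> 'a \<Rightarrow> complex" where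
  "bochner_riesz S K w x y = (\<Sum>k<K. of_real (trunc_power S (w\<^sup>2 - (lam k)\<^sup>2)) * \<phi> k x * cnj (\<phi> k y))"

lemma bochner_riesz_measurable [measurable]: "bochner_riesz S K w x \<in> borel_measurable M"
  unfolding bochner_riesz_def[abs_def] by measurable

definition laplace_kernel :: "nat \<Rightarrow> real \<Rightarrow> real \<Rightarrow> real \<Rightarrow> 'a \<Rightarrow> 'a \<Rightarrow> complex" where
  "laplace_kernel S a Y w x y = fact S / (2 * pi * \<i>) *
     contour_integral (linepath (Complex a (- Y)) (Complex a Y))
       (\<lambda>z. exp (z * of_real (w\<^sup>2)) / z ^ Suc S * complex_heat x y z)"

text \<open>This expansion makes orthonormality applicable: coefficient by coefficient, the
  difference from \<open>bochner_riesz\<close> is the truncation error of the inverse Laplace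
  transform.\<close>

lemma laplace_kernel_sums:
  assumes a: "a > 0" and Y: "Y > 0"
  shows "(\<lambda>k. truncated_inverse_Laplace S a Y (w\<^sup>2 - (lam k)\<^sup>2) * \<phi> k x * cnj (\<phi> k y)) sums laplace_kernel S a Y w x y"
proof -
  define seg where "seg = linepath (Complex a (- Y)) (Complex a Y)"
  define E where "E z = exp (z * complex_of_real (w\<^sup>2)) / z ^ Suc S" for z
  define B where "B = exp (a * w\<^sup>2) / a ^ Suc S"
  have im: "path_image seg = closed_segment (Complex a (- Y)) (Complex a Y)" by (simp add: seg_def)
  have ReA: "Re z = a" if "z \<in> path_image seg" for z
    using in_segment_Complex[of z a Y] that Y unfolding im by auto
  have cont: "continuous_on (path_image seg) (\<lambda>z. E z * complex_heat_term k x y z)" for k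
    unfolding E_def complex_heat_term_def using ReA a by (intro continuous_intros) fastforce+
  have ci: "(\<lambda>z. E z * complex_heat_term k x y z) contour_integrable_on seg" for k
    unfolding seg_def using cont[of k] im by (intro contour_integrable_continuous_linepath) simp
  have ul: "uniform_limit (path_image seg) (\<lambda>n z. \<Sum>k<n. E z * complex_heat_term k x y z) (\<lambda>z. \<Sum>k. E z * complex_heat_term k x y z) sequentially"
  proof (rule Weierstrass_m_test)
    show "summable (\<lambda>k. B * heat_majorant a x y k)"
      using a by (intro summable_mult summable_heat_majorant)
    fix k z assume z: "z \<in> path_image seg"
    have "cmod (E z) \<le> B" unfolding E_def B_def using z a Y by (intro laplace_integrand_le[of a z Y]) (auto simp: im)
    moreover have "cmod (complex_heat_term k x y z) \<le> heat_majorant a x y k" using ReA[OF z] by (intro complex_heat_term_le) simp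
    ultimately show "cmod (E z * complex_heat_term k x y z) \<le> B * heat_majorant a x y k"
      unfolding norm_mult by (intro mult_mono) (auto simp: B_def a less_imp_le)
  qed
  have "(\<lambda>n. contour_integral seg (\<lambda>z. \<Sum>k<n. E z * complex_heat_term k x y z))
     \<longlonglongrightarrow> contour_integral seg (\<lambda>z. \<Sum>k. E z * complex_heat_term k x y z)"
  proof (rule contour_integral_uniform_limit(2)[OF _ ul])
    show "\<forall>\<^sub>F n in sequentially. (\<lambda>z. \<Sum>k<n. E z * complex_heat_term k x y z) contour_integrable_on seg"
      by (intro always_eventually allI contour_integrable_sum ci) auto
    show "valid_path seg" by (simp add: seg_def)
    show "norm (vector_derivative seg (at t)) \<le> cmod (Complex a Y - Complex a (- Y))" for t
      by (simp add: seg_def)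
  qed simp
  also have "contour_integral seg (\<lambda>z. \<Sum>k. E z * complex_heat_term k x y z) = contour_integral seg (\<lambda>z. E z * complex_heat x y z)"
    unfolding complex_heat_def using ReA a
    by (intro contour_integral_eq suminf_mult summable_complex_heat_term) auto
  also have "(\<lambda>n. contour_integral seg (\<lambda>z. \<Sum>k<n. E z * complex_heat_term k x y z)) = (\<lambda>n. \<Sum>k<n. contour_integral seg (\<lambda>z. E z * complex_heat_term k x y z))"
    using ci by (intro ext contour_integral_sum) auto
  finally have "(\<lambda>k. contour_integral seg (\<lambda>z. E z * complex_heat_term k x y z)) sums contour_integral seg (\<lambda>z. E z * complex_heat x y z)"
    by (simp add: sums_def)
  then have "(\<lambda>k. fact S / (2 * pi * \<i>) * contour_integral seg (\<lambda>z. E z * complex_heat_term k x y z)) sums laplace_kernel S a Y w x y"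
    unfolding laplace_kernel_def seg_def[symmetric] E_def[symmetric] by (rule sums_mult)
  moreover have "fact S / (2 * pi * \<i>) * contour_integral seg (\<lambda>z. E z * complex_heat_term k x y z)
      = truncated_inverse_Laplace S a Y (w\<^sup>2 - (lam k)\<^sup>2) * \<phi> k x * cnj (\<phi> k y)" for k
  proof -
    define J where "J z = exp (z * complex_of_real (w\<^sup>2 - (lam k)\<^sup>2)) / z ^ Suc S" for z
    have "E z * complex_heat_term k x y z = J z * (\<phi> k x * cnj (\<phi> k y))" for z
      by (simp add: E_def complex_heat_term_def J_def right_diff_distrib exp_diff exp_minus field_simps)
    moreover have "J contour_integrable_on seg"
      unfolding seg_def J_def using ReA a im by (intro contour_integrable_continuous_linepath continuous_intros) fastforce+
    ultimately have "contour_integral seg (\<lambda>z. E z * complex_heat_term k x y z) = contour_integral seg J * (\<phi> k x * cnj (\<phi> k y))"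
      by (simp add: contour_integral_rmul)
    then show ?thesis by (simp add: truncated_inverse_Laplace_def J_def[abs_def] seg_def)
  qed
  ultimately show ?thesis by simp
qed

lemma laplace_kernel_bound:
  assumes a: "a > 0" and Y: "Y > 0" and aw: "a * w\<^sup>2 = 1"
    and C: "C \<ge> 0" "\<And>\<eta>. \<bar>\<eta>\<bar> \<le> Y \<Longrightarrow> cmod (complex_heat x y (Complex a \<eta>)) \<le> C"
  shows "cmod (laplace_kernel S a Y w x y) \<le> fact S / pi * exp 1 / a ^ Suc S * C * Y"
proof -
  define seg where "seg = closed_segment (Complex a (- Y)) (Complex a Y)"
  have Re: "Re z = a" if "z \<in> seg" for z
    using in_segment_Complex[of z a Y] that Y unfolding seg_def by auto
  have "cmod (contour_integral (linepath (Complex a (- Y)) (Complex a Y))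
       (\<lambda>z. exp (z * of_real (w\<^sup>2)) / z ^ Suc S * complex_heat x y z))
     \<le> (exp 1 / a ^ Suc S * C) * norm (Complex a Y - Complex a (- Y))"
  proof (rule contour_integral_bound_linepath)
    have "continuous_on seg (complex_heat x y)"
      by (rule continuous_on_subset[OF holomorphic_on_imp_continuous_on[OF complex_heat_holomorphic]])
        (use Re a in auto)
    then show "(\<lambda>z. exp (z * of_real (w\<^sup>2)) / z ^ Suc S * complex_heat x y z) contour_integrable_on linepath (Complex a (- Y)) (Complex a Y)"
      using Re a unfolding seg_def
      by (intro contour_integrable_continuous_linepath continuous_intros) fastforce+
    fix z assume z: "z \<in> closed_segment (Complex a (- Y)) (Complex a Y)"
    then obtain \<eta> where \<eta>: "z = Complex a \<eta>" "\<bar>\<eta>\<bar> \<le> Y" using in_segment_Complex[OF z] Y by auto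
    have "cmod (exp (z * of_real (w\<^sup>2)) / z ^ Suc S) \<le> exp (a * w\<^sup>2) / a ^ Suc S"
      using z a Y by (intro laplace_integrand_le[of a z Y]) auto
    then show "cmod (exp (z * of_real (w\<^sup>2)) / z ^ Suc S * complex_heat x y z) \<le> exp 1 / a ^ Suc S * C"
      unfolding norm_mult using C \<eta> a aw by (intro mult_mono) auto
  qed (use a C in auto)
  also have "norm (Complex a Y - Complex a (- Y)) = 2 * Y" using Y by (simp add: cmod_def real_sqrt_mult)
  finally have "cmod (laplace_kernel S a Y w x y) \<le> fact S / (2 * pi) * ((exp 1 / a ^ Suc S * C) * (2 * Y))"
    unfolding laplace_kernel_def norm_mult
    by (intro mult_mono) (auto simp: norm_divide norm_mult)
  then show ?thesis by simp
qed

text \<open>The factor exp (a u) in the truncation error is decisive: at u = w^2 - lam^2 it equals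
  exp 1 * exp (- a lam^2), so the squared coefficients add up to a diagonal heat kernel at time 2 a.
  Cauchy-Schwarz on F then turns the L2 bound into an L1 bound.\<close>

lemma bochner_riesz_remainder:
  assumes w: "w \<ge> 2" and a: "a = 1 / w\<^sup>2" and Y: "Y \<ge> 2 * a" and K: "\<And>k. k \<ge> K \<Longrightarrow> lam k \<ge> w"
    and [measurable]: "F \<in> sets M" and m: "m > 0" "emeasure M F \<le> ennreal m"
  shows "(\<integral>\<^sup>+y\<in>F. ennreal (cmod (bochner_riesz S K w x y - laplace_kernel S a Y w x y)) \<partial>M)
    \<le> ennreal (sqrt m * (fact S * 2 ^ S / Y ^ S * exp 1 * sqrt c1 * w powr (q / 2)))"
proof -
  define D where "D = fact S * 2 ^ S / Y ^ S"
  define \<beta> where "\<beta> k = (complex_of_real (trunc_power S (w\<^sup>2 - (lam k)\<^sup>2)) - truncated_inverse_Laplace S a Y (w\<^sup>2 - (lam k)\<^sup>2)) * \<phi> k x" for k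
  define B where "B n y = (\<Sum>k<n. \<beta> k * cnj (\<phi> k y))" for n y
  define b where "b = D * exp 1 * sqrt c1 * w powr (q / 2)"
  have "w\<^sup>2 \<ge> 2\<^sup>2" using w by (intro power_mono) auto
  then have a4: "0 < a" "a \<le> 1 / 4" using w divide_left_mono[of 4 "w\<^sup>2" 1] unfolding a by auto
  have aw: "a * w\<^sup>2 = 1" using w by (simp add: a)
  have Y0: "Y > 0" using Y a4 by linarith
  have D: "D > 0" using Y0 by (simp add: D_def)
  have b: "b > 0" using D c1 w by (simp add: b_def)
  have [measurable]: "B n \<in> borel_measurable M" for n unfolding B_def[abs_def] by measurable
  have lim: "(\<lambda>n. B n y) \<longlonglongrightarrow> bochner_riesz S K w x y - laplace_kernel S a Y w x y" for y
  proof -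
    have "trunc_power S (w\<^sup>2 - (lam k)\<^sup>2) = 0" if "k \<ge> K" for k
    proof -
      have "w\<^sup>2 \<le> (lam k)\<^sup>2" using K[OF that] w by (intro power_mono) auto
      then show ?thesis by (simp add: trunc_power_def)
    qed
    then have "(\<lambda>k. of_real (trunc_power S (w\<^sup>2 - (lam k)\<^sup>2)) * \<phi> k x * cnj (\<phi> k y)) sums bochner_riesz S K w x y"
      unfolding bochner_riesz_def by (intro sums_finite) auto
    then have "(\<lambda>k. of_real (trunc_power S (w\<^sup>2 - (lam k)\<^sup>2)) * \<phi> k x * cnj (\<phi> k y)
        - truncated_inverse_Laplace S a Y (w\<^sup>2 - (lam k)\<^sup>2) * \<phi> k x * cnj (\<phi> k y))
        sums (bochner_riesz S K w x y - laplace_kernel S a Y w x y)"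
      using a4 Y0 by (intro sums_diff laplace_kernel_sums)
    then show ?thesis by (simp add: sums_def B_def \<beta>_def left_diff_distrib)
  qed
  have \<beta>: "(cmod (\<beta> k))\<^sup>2 \<le> (D * exp 1)\<^sup>2 * (exp (- (lam k)\<^sup>2 * (2 * a)) * (cmod (\<phi> k x))\<^sup>2)" for k
  proof -
    have "cmod (complex_of_real (trunc_power S (w\<^sup>2 - (lam k)\<^sup>2)) - truncated_inverse_Laplace S a Y (w\<^sup>2 - (lam k)\<^sup>2))
       \<le> D * exp (a * (w\<^sup>2 - (lam k)\<^sup>2))"
      using truncated_inverse_Laplace_error[OF a4(1) Y, of S "w\<^sup>2 - (lam k)\<^sup>2"]
      by (simp add: D_def norm_minus_commute)
    also have "\<dots> = D * exp 1 * exp (- (lam k)\<^sup>2 * a)"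
      using aw by (simp add: right_diff_distrib exp_diff exp_minus field_simps)
    finally have "cmod (\<beta> k) \<le> D * exp 1 * exp (- (lam k)\<^sup>2 * a) * cmod (\<phi> k x)"
      unfolding \<beta>_def norm_mult by (intro mult_right_mono) auto
    then have "(cmod (\<beta> k))\<^sup>2 \<le> (D * exp 1 * exp (- (lam k)\<^sup>2 * a) * cmod (\<phi> k x))\<^sup>2"
      by (intro power_mono) auto
    also have "\<dots> = (D * exp 1)\<^sup>2 * (exp (- (lam k)\<^sup>2 * a) ^ 2 * (cmod (\<phi> k x))\<^sup>2)"
      by (simp only: power_mult_distrib mult.assoc)
    also have "exp (- (lam k)\<^sup>2 * a) ^ 2 = exp (- (lam k)\<^sup>2 * (2 * a))"
      by (simp flip: exp_of_nat_mult)
    finally show ?thesis .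
  qed
  have B2: "(\<integral>\<^sup>+y. ennreal ((cmod (B n y))\<^sup>2) \<partial>M) \<le> ennreal (b\<^sup>2)" for n
  proof -
    have "(\<Sum>k<n. (cmod (\<beta> k))\<^sup>2) \<le> (\<Sum>k<n. (D * exp 1)\<^sup>2 * (exp (- (lam k)\<^sup>2 * (2 * a)) * (cmod (\<phi> k x))\<^sup>2))"
      by (intro sum_mono \<beta>)
    also have "\<dots> = (D * exp 1)\<^sup>2 * (\<Sum>k<n. exp (- (lam k)\<^sup>2 * (2 * a)) * (cmod (\<phi> k x))\<^sup>2)"
      by (simp add: sum_distrib_left)
    also have "(\<Sum>k<n. exp (- (lam k)\<^sup>2 * (2 * a)) * (cmod (\<phi> k x))\<^sup>2) \<le> (\<Sum>k. exp (- (lam k)\<^sup>2 * (2 * a)) * (cmod (\<phi> k x))\<^sup>2)"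
      using a4 by (intro sum_le_suminf heat_diagonal(1)) auto
    also have "\<dots> \<le> c1 * (2 * a) powr (- q / 2)" using a4 by (intro heat_diagonal(2)) auto
    also have "\<dots> \<le> c1 * a powr (- q / 2)" using c1 a4 q by (intro mult_left_mono powr_mono2') auto
    also have "a powr (- q / 2) = (w powr (q / 2))\<^sup>2"
    proof -
      have "a powr (- q / 2) = (w powr 2) powr (q / 2)"
        using w by (simp add: a powr_minus powr_divide)
      also have "\<dots> = (w powr (q / 2)) powr 2" by (simp only: powr_powr) (simp add: mult.commute)
      also have "\<dots> = (w powr (q / 2))\<^sup>2" using w by simp
      finally show ?thesis .
    qed
    finally have "(\<Sum>k<n. (cmod (\<beta> k))\<^sup>2) \<le> (D * exp 1)\<^sup>2 * (c1 * (w powr (q / 2))\<^sup>2)"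
      by (simp add: mult_left_mono)
    also have "\<dots> = b\<^sup>2" using c1 by (simp add: b_def power_mult_distrib)
    finally show ?thesis
      unfolding B_def by (subst nn_integral_orthonormal_sum_cnj) (auto intro: ennreal_leI)
  qed
  \<comment> \<open>The L2 bound is known for the partial sums only; Fatou's lemma passes to their
    pointwise limit.\<close>
  have "(\<integral>\<^sup>+y\<in>F. ennreal (cmod (bochner_riesz S K w x y - laplace_kernel S a Y w x y)) \<partial>M)
     = (\<integral>\<^sup>+y. liminf (\<lambda>n. ennreal (cmod (B n y)) * indicator F y) \<partial>M)"
  proof (intro nn_integral_cong)
    fix y
    have "(\<lambda>n. ennreal (cmod (B n y)) * indicator F y) \<longlonglongrightarrow>
        ennreal (cmod (bochner_riesz S K w x y - laplace_kernel S a Y w x y)) * indicator F y"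
      by (cases "y \<in> F") (auto intro!: tendsto_intros lim)
    then show "ennreal (cmod (bochner_riesz S K w x y - laplace_kernel S a Y w x y)) * indicator F y
        = liminf (\<lambda>n. ennreal (cmod (B n y)) * indicator F y)"
      by (simp add: lim_imp_Liminf)
  qed
  also have "\<dots> \<le> liminf (\<lambda>n. \<integral>\<^sup>+y\<in>F. ennreal (cmod (B n y)) \<partial>M)"
    by (intro nn_integral_liminf) measurable
  also have "\<dots> \<le> ennreal (sqrt m * b)"
    by (intro Liminf_le always_eventually allI nn_integral_le_sqrt_measure m b B2) auto
  finally show ?thesis by (simp add: b_def D_def mult.assoc)
qed

lemma laplace_kernel_measurable [measurable]:
  assumes "a > 0" "Y > 0"
  shows "laplace_kernel S a Y w x \<in> borel_measurable M"
proof (rule borel_measurable_LIMSEQ_metric)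
  show "(\<lambda>n. \<Sum>k<n. truncated_inverse_Laplace S a Y (w\<^sup>2 - (lam k)\<^sup>2) * \<phi> k x * cnj (\<phi> k y)) \<longlonglongrightarrow> laplace_kernel S a Y w x y" for y
    using laplace_kernel_sums[OF assms] by (simp add: sums_def)
qed measurable

end

section \<open>Bochner-Riesz kernels in L1, uniformly in the base point\<close>

lemma trunc_power_le:
  assumes "w \<ge> 0"
  shows "0 \<le> trunc_power S (w\<^sup>2 - l\<^sup>2)" "trunc_power S (w\<^sup>2 - l\<^sup>2) \<le> w ^ (2 * S)"
    "l \<ge> w \<Longrightarrow> trunc_power S (w\<^sup>2 - l\<^sup>2) = 0"
proof -
  show "0 \<le> trunc_power S (w\<^sup>2 - l\<^sup>2)" by (simp add: trunc_power_def)
  show "trunc_power S (w\<^sup>2 - l\<^sup>2) \<le> w ^ (2 * S)"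
    using power_mono[of "w\<^sup>2 - l\<^sup>2" "w\<^sup>2" S] assms by (auto simp: trunc_power_def power_mult)
  show "trunc_power S (w\<^sup>2 - l\<^sup>2) = 0" if "l \<ge> w"
    using power_mono[OF that assms, of 2] by (simp add: trunc_power_def)
qed

lemma trunc_power_nonzero: "trunc_power S (w\<^sup>2 - l\<^sup>2) \<noteq> 0 \<Longrightarrow> w \<ge> 0 \<Longrightarrow> l < w"
  using trunc_power_le(3)[of w l S] by force

context heat_system
begin

text \<open>The Laplace part contributes its supremum times the measure of F, of order \<rho>^(q +
  \<kappa>) exp (- c \<rho>^\<beta>), and the remainder \<rho>^(q / 2 - \<kappa> S), both times w^(2
  S). The other powers of w cancel, because the measure of F is at most of order (\<rho> / w)^q and
  the heat kernel at time 1 / w^2 has size w^q. F is a general measurable set with these properties,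
  since differences of balls need not be measurable.\<close>

lemma bochner_riesz_shell:
  assumes S: "real S > q + 1"
  shows "\<exists>C>0. \<forall>w\<ge>2. \<forall>\<rho>\<ge>1. \<forall>x K. \<forall>F\<in>sets M.
    (\<forall>k\<ge>K. lam k \<ge> w) \<longrightarrow> (\<forall>y\<in>F. d x y \<ge> \<rho> / w) \<longrightarrow> emeasure M F \<le> ennreal (cb * (2 * \<rho> / w) powr q) \<longrightarrow>
    (\<integral>\<^sup>+y\<in>F. ennreal (cmod (bochner_riesz S K w x y)) \<partial>M) \<le> ennreal (C * w ^ (2 * S) * \<rho> powr (- 1 / 4))"
proof -
  \<comment> \<open>\<kappa> solves \<kappa> (q + 1) = q / 2 + 1 / 4. So S > q + 1 leaves a decay of
    exponent 1 / 4 in the remainder, while 2 - 4 \<kappa> = 1 / (q + 1) stays positive.\<close>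
  define \<kappa> where "\<kappa> = (2 * q + 1) / (4 * (q + 1))"
  define \<beta> where "\<beta> = 1 / (q + 1)"
  have \<beta>: "\<beta> > 0" "2 - 4 * \<kappa> = \<beta>" using q by (auto simp: \<beta>_def \<kappa>_def field_simps)
  have \<kappa>: "\<kappa> > 0" using q by (simp add: \<kappa>_def)
  have "\<kappa> * (q + 1) = q / 2 + 1 / 4" using q by (simp add: \<kappa>_def field_simps)
  moreover have "\<kappa> * (q + 1) \<le> \<kappa> * S" using S \<kappa> by (intro mult_left_mono) auto
  ultimately have \<kappa>S: "q / 2 - \<kappa> * S \<le> - 1 / 4" by linarith
  \<comment> \<open>In the exponent, q comes from the measure of F, \<kappa> from the length of the
    inversion segment, and 1 / 4 is the decay to be left over.\<close>
  obtain CE where CE: "CE > 0" "\<And>\<rho>. \<rho> \<ge> 1 \<Longrightarrow> \<rho> powr (q + \<kappa> + 1 / 4) * exp (- (c2 / 6144) * \<rho> powr \<beta>) \<le> CE"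
    using powr_exp_bounded[of "c2 / 6144" \<beta> "q + \<kappa> + 1 / 4"] c2 \<beta> by auto
  define CA where "CA = fact S / pi * exp 1 * 2 * c1 * 2 powr (q / 2) * cb * 2 powr q"
  define CB where "CB = sqrt cb * 2 powr (q / 2) * fact S * exp 1 * sqrt c1"
  have CA: "CA > 0" and CB: "CB > 0" using c1 cb by (auto simp: CA_def CB_def)
  show ?thesis
  proof (intro exI[of _ "CA * CE + CB"] conjI allI impI ballI)
    show "CA * CE + CB > 0" using CA CB CE(1) by (simp add: add_pos_pos)
    fix w \<rho> :: real and x K F
    assume w: "2 \<le> w" and \<rho>: "1 \<le> \<rho>" and F [measurable]: "F \<in> sets M" and K: "\<forall>k\<ge>K. w \<le> lam k"
      and dF: "\<forall>y\<in>F. \<rho> / w \<le> d x y" and mF: "emeasure M F \<le> ennreal (cb * (2 * \<rho> / w) powr q)"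
    define a where "a = 1 / w\<^sup>2"
    define Z where "Z = \<rho> powr \<kappa>"
    define Y where "Y = 2 * Z * a"
    define m where "m = cb * (2 * \<rho> / w) powr q"
    define E where "E = exp (- (c2 / 6144) * \<rho> powr \<beta>)"
    define Cg where "Cg = c1 * 2 powr (q / 2) * w powr q * E"
    define As where "As = fact S / pi * exp 1 / a ^ Suc S * Cg * Y"
    have Z: "Z \<ge> 1" using \<rho> \<kappa> by (simp add: Z_def ge_one_powr_ge_zero)
    have a0: "a > 0" using w by (simp add: a_def)
    have Y0: "Y > 0" "Y \<ge> 2 * a" using a0 Z by (auto simp: Y_def)
    have m: "m > 0" using cb \<rho> w by (simp add: m_def)
    have aw: "a * w\<^sup>2 = 1" using w by (simp add: a_def)
    have "Z ^ 4 = \<rho> powr (4 * \<kappa>)" using \<rho> by (simp add: Z_def powr_powr mult.commute flip: powr_numeral)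
    moreover have "\<rho>\<^sup>2 = \<rho> powr 2" using \<rho> by simp
    ultimately have "\<rho>\<^sup>2 / Z ^ 4 = \<rho> powr (2 - 4 * \<kappa>)" by (simp add: powr_diff)
    then have \<rho>Z: "\<rho>\<^sup>2 / Z ^ 4 = \<rho> powr \<beta>" using \<beta> by simp
    have Cg0: "Cg \<ge> 0" using c1 by (simp add: Cg_def E_def)
    have As0: "As \<ge> 0" using Cg0 a0 Y0 by (simp add: As_def)
    have A: "cmod (laplace_kernel S a Y w x y) \<le> As" if "y \<in> F" for y
      unfolding As_def
    proof (rule laplace_kernel_bound[OF a0 Y0(1) aw Cg0])
      fix \<eta> :: real assume \<eta>: "\<bar>\<eta>\<bar> \<le> Y"
      show "cmod (complex_heat x y (Complex a \<eta>)) \<le> Cg"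
        using complex_heat_off_diagonal[OF w \<rho> Z a_def Y_def _ \<eta>, of x y] dF that \<rho>Z by (simp add: Cg_def E_def)
    qed
    have [measurable]: "laplace_kernel S a Y w x \<in> borel_measurable M"
      using a0 Y0(1) by (rule laplace_kernel_measurable)
    have "(\<integral>\<^sup>+y\<in>F. ennreal (cmod (bochner_riesz S K w x y)) \<partial>M)
       \<le> (\<integral>\<^sup>+y. ennreal As * indicator F y + ennreal (cmod (bochner_riesz S K w x y - laplace_kernel S a Y w x y)) * indicator F y \<partial>M)"
    proof (intro nn_integral_mono)
      fix y
      have "ennreal (cmod (bochner_riesz S K w x y)) \<le> ennreal As + ennreal (cmod (bochner_riesz S K w x y - laplace_kernel S a Y w x y))" if "y \<in> F"
      proof -
        have "cmod (bochner_riesz S K w x y) \<le> As + cmod (bochner_riesz S K w x y - laplace_kernel S a Y w x y)"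
          using A[OF that] norm_triangle_sub[of "bochner_riesz S K w x y" "laplace_kernel S a Y w x y"] by linarith
        then show ?thesis using As0 by (subst ennreal_plus[symmetric]) (auto simp del: ennreal_plus intro!: ennreal_leI)
      qed
      then show "ennreal (cmod (bochner_riesz S K w x y)) * indicator F y
        \<le> ennreal As * indicator F y + ennreal (cmod (bochner_riesz S K w x y - laplace_kernel S a Y w x y)) * indicator F y"
        by (auto simp: indicator_def)
    qed
    also have "\<dots> = ennreal As * emeasure M F + (\<integral>\<^sup>+y\<in>F. ennreal (cmod (bochner_riesz S K w x y - laplace_kernel S a Y w x y)) \<partial>M)"
      by (simp add: nn_integral_add nn_integral_cmult)
    also have "\<dots> \<le> ennreal As * ennreal m + ennreal (sqrt m * (fact S * 2 ^ S / Y ^ S * exp 1 * sqrt c1 * w powr (q / 2)))"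
      using mF m K by (intro add_mono mult_left_mono bochner_riesz_remainder[OF w a_def Y0(2)]) (auto simp: m_def)
    also have "\<dots> = ennreal (As * m + sqrt m * (fact S * 2 ^ S / Y ^ S * exp 1 * sqrt c1 * w powr (q / 2)))"
      using As0 m Y0 c1 by (simp add: ennreal_mult ennreal_plus)
    also have "\<dots> \<le> ennreal ((CA * CE + CB) * w ^ (2 * S) * \<rho> powr (- 1 / 4))"
    proof (rule ennreal_leI)
      have wS: "1 / a ^ S = w ^ (2 * S)" by (simp add: a_def power_mult power_divide)
      have wq: "(2 * \<rho> / w) powr q * w powr q = 2 powr q * \<rho> powr q"
        using w \<rho> by (simp add: powr_divide powr_mult)
      have "As * m = CA * (1 / a ^ S) * (\<rho> powr q * Z * E)"
      proof -
        have "As * m = fact S / pi * exp 1 * 2 * c1 * 2 powr (q / 2) * cb * ((2 * \<rho> / w) powr q * w powr q) * (1 / a ^ S) * (Z * E)"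
          using a0 by (simp add: As_def m_def Cg_def Y_def)
        then show ?thesis unfolding wq by (simp add: CA_def)
      qed
      also have "\<dots> = CA * w ^ (2 * S) * (\<rho> powr (q + \<kappa> + 1 / 4) * E * \<rho> powr (- 1 / 4))"
        unfolding wS Z_def using \<rho> by (simp add: powr_add[symmetric])
      also have "\<dots> \<le> CA * w ^ (2 * S) * (CE * \<rho> powr (- 1 / 4))"
        using CE(2)[OF \<rho>] CA w unfolding E_def by (intro mult_left_mono mult_right_mono) auto
      finally have 1: "As * m \<le> CA * CE * w ^ (2 * S) * \<rho> powr (- 1 / 4)" by (simp add: mult_ac)
      have "sqrt m = sqrt cb * ((2 * \<rho> / w) powr (q / 2))"
      proof -
        have "sqrt ((2 * \<rho> / w) powr q) = ((2 * \<rho> / w) powr q) powr (1 / 2)"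
          by (rule powr_half_sqrt[symmetric]) simp
        then show ?thesis by (simp add: m_def real_sqrt_mult powr_powr)
      qed
      moreover have "(2 * \<rho> / w) powr (q / 2) * w powr (q / 2) = 2 powr (q / 2) * \<rho> powr (q / 2)"
        using w \<rho> by (simp add: powr_divide powr_mult)
      ultimately have "sqrt m * (fact S * 2 ^ S / Y ^ S * exp 1 * sqrt c1 * w powr (q / 2))
         = CB * (2 ^ S / Y ^ S) * \<rho> powr (q / 2)"
        by (simp add: CB_def mult_ac)
      also have "2 ^ S / Y ^ S = 1 / a ^ S / Z ^ S" by (simp add: Y_def power_mult_distrib)
      also have "Z ^ S = \<rho> powr (\<kappa> * S)" using \<rho> by (simp add: Z_def powr_powr flip: powr_realpow)
      also have "CB * (1 / a ^ S / \<rho> powr (\<kappa> * S)) * \<rho> powr (q / 2) = CB * w ^ (2 * S) * \<rho> powr (q / 2 - \<kappa> * S)"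
        unfolding wS by (simp add: powr_diff)
      also have "\<dots> \<le> CB * w ^ (2 * S) * \<rho> powr (- 1 / 4)"
        using \<kappa>S \<rho> CB w by (intro mult_left_mono powr_mono) auto
      finally show "As * m + sqrt m * (fact S * 2 ^ S / Y ^ S * exp 1 * sqrt c1 * w powr (q / 2))
         \<le> (CA * CE + CB) * w ^ (2 * S) * \<rho> powr (- 1 / 4)"
        using 1 by (simp add: ring_distribs)
    qed
    finally show "(\<integral>\<^sup>+y\<in>F. ennreal (cmod (bochner_riesz S K w x y)) \<partial>M) \<le> ennreal ((CA * CE + CB) * w ^ (2 * S) * \<rho> powr (- 1 / 4))" .
  qed
qed

text \<open>For \<open>lam k < w\<close> the heat factor at time 1 / w^2 is at least exp (- 1), so
  the Christoffel function is dominated by the diagonal heat kernel.\<close>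

lemma sum_\<phi>_squares:
  assumes w: "w \<ge> 1"
  shows "(\<Sum>k | lam k < w. (cmod (\<phi> k x))\<^sup>2) \<le> exp 1 * c1 * w powr q"
proof -
  have w2: "w\<^sup>2 \<ge> 1" using w by simp
  have "(\<Sum>k | lam k < w. (cmod (\<phi> k x))\<^sup>2) \<le> (\<Sum>k | lam k < w. exp 1 * (exp (- (lam k)\<^sup>2 * (1 / w\<^sup>2)) * (cmod (\<phi> k x))\<^sup>2))"
  proof (intro sum_mono)
    fix k assume "k \<in> {k. lam k < w}"
    then have "(lam k)\<^sup>2 \<le> w\<^sup>2" using lam_nonneg[of k] by (intro power_mono) auto
    then have "(lam k)\<^sup>2 / w\<^sup>2 \<le> 1" using w2 by (simp add: divide_le_eq)
    then have "1 \<le> exp (1 - (lam k)\<^sup>2 / w\<^sup>2)" by simp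
    then have "1 * (cmod (\<phi> k x))\<^sup>2 \<le> exp (1 - (lam k)\<^sup>2 / w\<^sup>2) * (cmod (\<phi> k x))\<^sup>2" by (intro mult_right_mono) auto
    then show "(cmod (\<phi> k x))\<^sup>2 \<le> exp 1 * (exp (- (lam k)\<^sup>2 * (1 / w\<^sup>2)) * (cmod (\<phi> k x))\<^sup>2)"
      by (simp add: exp_diff exp_minus field_simps)
  qed
  also have "\<dots> = exp 1 * (\<Sum>k | lam k < w. exp (- (lam k)\<^sup>2 * (1 / w\<^sup>2)) * (cmod (\<phi> k x))\<^sup>2)"
    by (simp add: sum_distrib_left)
  also have "\<dots> \<le> exp 1 * (\<Sum>k. exp (- (lam k)\<^sup>2 * (1 / w\<^sup>2)) * (cmod (\<phi> k x))\<^sup>2)"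
    using w finite_lam_less by (intro mult_left_mono sum_le_suminf heat_diagonal(1)) auto
  also have "\<dots> \<le> exp 1 * (c1 * (1 / w\<^sup>2) powr (- q / 2))"
    using w w2 by (intro mult_left_mono heat_diagonal(2)) auto
  also have "(1 / w\<^sup>2) powr (- q / 2) = (w powr 2) powr (q / 2)"
    using w by (simp add: powr_minus powr_divide)
  also have "\<dots> = w powr q" by (simp only: powr_powr) simp
  finally show ?thesis by simp
qed

lemma bochner_riesz_center:
  assumes w: "w \<ge> 1" and K: "\<And>k. k \<ge> K \<Longrightarrow> lam k \<ge> w" and [measurable]: "F \<in> sets M"
    and mF: "emeasure M F \<le> ennreal (cb * (1 / w) powr q)"
  shows "(\<integral>\<^sup>+y\<in>F. ennreal (cmod (bochner_riesz S K w x y)) \<partial>M) \<le> ennreal (sqrt cb * sqrt (exp 1 * c1) * w ^ (2 * S))"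
proof -
  define b where "b = w ^ (2 * S) * sqrt (exp 1 * c1 * w powr q)"
  have b: "b > 0" using w c1 by (simp add: b_def)
  have "(\<Sum>k<K. (cmod (of_real (trunc_power S (w\<^sup>2 - (lam k)\<^sup>2)) * \<phi> k x))\<^sup>2)
     = (\<Sum>k\<in>{..<K} \<inter> {k. lam k < w}. (cmod (of_real (trunc_power S (w\<^sup>2 - (lam k)\<^sup>2)) * \<phi> k x))\<^sup>2)"
    using w by (intro sum.mono_neutral_right) (auto dest: trunc_power_nonzero)
  also have "\<dots> \<le> (\<Sum>k | lam k < w. (cmod (of_real (trunc_power S (w\<^sup>2 - (lam k)\<^sup>2)) * \<phi> k x))\<^sup>2)"
    using finite_lam_less by (intro sum_mono2) auto
  also have "\<dots> \<le> (\<Sum>k | lam k < w. (w ^ (2 * S))\<^sup>2 * (cmod (\<phi> k x))\<^sup>2)"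
    unfolding norm_mult power_mult_distrib norm_of_real
    using w trunc_power_le[of w S] by (intro sum_mono mult_right_mono power_mono) auto
  also have "\<dots> = (w ^ (2 * S))\<^sup>2 * (\<Sum>k | lam k < w. (cmod (\<phi> k x))\<^sup>2)" by (simp add: sum_distrib_left)
  also have "\<dots> \<le> (w ^ (2 * S))\<^sup>2 * (exp 1 * c1 * w powr q)"
    using w by (intro mult_left_mono sum_\<phi>_squares) auto
  also have "\<dots> = b\<^sup>2" using c1 by (simp add: b_def power_mult_distrib)
  finally have "(\<integral>\<^sup>+y. ennreal ((cmod (bochner_riesz S K w x y))\<^sup>2) \<partial>M) \<le> ennreal (b\<^sup>2)"
    unfolding bochner_riesz_def by (subst nn_integral_orthonormal_sum_cnj) (auto intro: ennreal_leI)
  then have "(\<integral>\<^sup>+y\<in>F. ennreal (cmod (bochner_riesz S K w x y)) \<partial>M) \<le> ennreal (sqrt (cb * (1 / w) powr q) * b)"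
    using mF cb w b by (intro nn_integral_le_sqrt_measure) auto
  also have "sqrt (cb * (1 / w) powr q) * b = sqrt cb * sqrt (exp 1 * c1) * w ^ (2 * S) * sqrt ((1 / w) powr q * w powr q)"
    by (simp add: b_def real_sqrt_mult)
  also have "(1 / w) powr q * w powr q = 1" using w by (simp add: powr_divide)
  finally show ?thesis by simp
qed

text \<open>For bounded w only the finitely many \<phi>_k with \<open>lam k < 2\<close> occur, and
  each of them is bounded and integrable. The constant does not shrink with w, which is why 1 + w^(2
  S) appears later.\<close>

lemma bochner_riesz_small:
  "\<exists>C>0. \<forall>w x K. 0 \<le> w \<longrightarrow> w \<le> 2 \<longrightarrow> (\<integral>\<^sup>+y. ennreal (cmod (bochner_riesz S K w x y)) \<partial>M) \<le> ennreal C"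
proof -
  obtain B where B: "\<And>k. B k > 0" "\<And>k x. cmod (\<phi> k x) \<le> B k" using \<phi>_bound_ex by metis
  define A where "A = {k. lam k < 2}"
  have A: "finite A" unfolding A_def by (rule finite_lam_less)
  define I where "I k = (LINT y|M. cmod (\<phi> k y))" for k
  have I: "(\<integral>\<^sup>+y. ennreal (cmod (\<phi> k y)) \<partial>M) = ennreal (I k)" "I k \<ge> 0" for k
    unfolding I_def using \<phi>_int[of k] by (auto intro!: nn_integral_eq_integral)
  define C where "C = (\<Sum>k\<in>A. 2 ^ (2 * S) * B k * I k)"
  have C: "C \<ge> 0" unfolding C_def using I(2) B(1) by (intro sum_nonneg mult_nonneg_nonneg) (auto simp: less_imp_le)
  have "(\<integral>\<^sup>+y. ennreal (cmod (bochner_riesz S K w x y)) \<partial>M) \<le> ennreal C" if w: "0 \<le> w" "w \<le> 2" for w x K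
  proof -
    have "cmod (bochner_riesz S K w x y) \<le> (\<Sum>k\<in>A. (2 ^ (2 * S) * B k) * cmod (\<phi> k y))" for y
    proof -
      have "cmod (bochner_riesz S K w x y) \<le> (\<Sum>k<K. cmod (of_real (trunc_power S (w\<^sup>2 - (lam k)\<^sup>2)) * \<phi> k x * cnj (\<phi> k y)))"
        unfolding bochner_riesz_def by (rule norm_sum)
      also have "\<dots> = (\<Sum>k\<in>{..<K} \<inter> A. cmod (of_real (trunc_power S (w\<^sup>2 - (lam k)\<^sup>2)) * \<phi> k x * cnj (\<phi> k y)))"
        using w by (intro sum.mono_neutral_right) (force simp: A_def dest: trunc_power_nonzero)+
      also have "\<dots> \<le> (\<Sum>k\<in>A. cmod (of_real (trunc_power S (w\<^sup>2 - (lam k)\<^sup>2)) * \<phi> k x * cnj (\<phi> k y)))"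
        using A by (intro sum_mono2) auto
      also have "\<dots> \<le> (\<Sum>k\<in>A. (2 ^ (2 * S) * B k) * cmod (\<phi> k y))"
      proof (intro sum_mono)
        fix k
        have "trunc_power S (w\<^sup>2 - (lam k)\<^sup>2) \<le> 2 ^ (2 * S)"
          using trunc_power_le(2)[OF w(1), of S "lam k"] power_mono[OF w(2,1), of "2 * S"] by linarith
        then show "cmod (of_real (trunc_power S (w\<^sup>2 - (lam k)\<^sup>2)) * \<phi> k x * cnj (\<phi> k y)) \<le> (2 ^ (2 * S) * B k) * cmod (\<phi> k y)"
          using B w trunc_power_le(1)[OF w(1), of S "lam k"]
          unfolding norm_mult norm_of_real complex_mod_cnj by (intro mult_right_mono mult_mono) auto
      qed
      finally show ?thesis .
    qed
    then have "(\<integral>\<^sup>+y. ennreal (cmod (bochner_riesz S K w x y)) \<partial>M)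
        \<le> (\<integral>\<^sup>+y. (\<Sum>k\<in>A. ennreal (2 ^ (2 * S) * B k) * ennreal (cmod (\<phi> k y))) \<partial>M)"
      using B(1) by (intro nn_integral_mono)
        (auto simp: sum_ennreal less_imp_le simp flip: ennreal_mult intro!: ennreal_leI)
    also have "\<dots> = (\<Sum>k\<in>A. ennreal (2 ^ (2 * S) * B k) * ennreal (I k))"
      by (simp add: nn_integral_sum nn_integral_cmult I)
    also have "\<dots> = ennreal C"
      unfolding C_def using B(1) I(2) by (simp add: sum_ennreal less_imp_le flip: ennreal_mult)
    finally show ?thesis .
  qed
  then have "(\<integral>\<^sup>+y. ennreal (cmod (bochner_riesz S K w x y)) \<partial>M) \<le> ennreal (C + 1)" if "0 \<le> w" "w \<le> 2" for w x K
    by (rule order_trans) (use that in \<open>auto simp del: ennreal_plus intro!: ennreal_leI\<close>)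
  then show ?thesis using C by (intro exI[of _ "C + 1"]) (auto simp del: ennreal_plus)
qed

end

lemma exists_power_two_ge: "\<exists>i::nat. (x::real) \<le> 2 ^ i"
proof -
  obtain n where "x < 2 ^ n" using real_arch_pow[of 2 x] by auto
  then show ?thesis by (intro exI less_imp_le)
qed

context heat_system
begin

lemma bochner_riesz_large:
  assumes S: "real S > q + 1"
  shows "\<exists>C>0. \<forall>w\<ge>2. \<forall>x K. (\<forall>k\<ge>K. lam k \<ge> w) \<longrightarrow>
    (\<integral>\<^sup>+y. ennreal (cmod (bochner_riesz S K w x y)) \<partial>M) \<le> ennreal (C * w ^ (2 * S))"
proof -
  from bochner_riesz_shell[OF S] obtain C where C: "C > 0" and shell: "\<forall>w\<ge>2. \<forall>\<rho>\<ge>1. \<forall>x K. \<forall>F\<in>sets M.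
    (\<forall>k\<ge>K. lam k \<ge> w) \<longrightarrow> (\<forall>y\<in>F. d x y \<ge> \<rho> / w) \<longrightarrow> emeasure M F \<le> ennreal (cb * (2 * \<rho> / w) powr q) \<longrightarrow>
    (\<integral>\<^sup>+y\<in>F. ennreal (cmod (bochner_riesz S K w x y)) \<partial>M) \<le> ennreal (C * w ^ (2 * S) * \<rho> powr (- 1 / 4))"
    by (elim exE conjE)
  define C0 where "C0 = sqrt cb * sqrt (exp 1 * c1)"
  have C0: "C0 > 0" using cb c1 by (simp add: C0_def)
  define T where "T = (\<Sum>i. ennreal (2 powr (- (1 / 4) * real i)))"
  have "T < \<infinity>" unfolding T_def by (rule suminf_geometric_powr_finite) simp
  then obtain t where t: "t \<ge> 0" "T = ennreal t" by (cases T) auto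
  show ?thesis
  proof (intro exI[of _ "C0 + C * t"] conjI allI impI)
    show "C0 + C * t > 0" using C0 C t by (simp add: add_pos_nonneg)
    fix w x K assume w: "2 \<le> w" and K: "\<forall>k\<ge>K. w \<le> lam k"
    have "\<exists>E\<in>sets M. qball d x (2 ^ i / w) \<subseteq> E \<and> emeasure M E \<le> ennreal (cb * (2 ^ i / w) powr q)" for i :: nat
      using w by (intro ball_hull) auto
    then obtain E where E [measurable]: "\<And>i. E i \<in> sets M" and EB: "\<And>i. qball d x (2 ^ i / w) \<subseteq> E i"
      and Em: "\<And>i. emeasure M (E i) \<le> ennreal (cb * (2 ^ i / w) powr q)" by metis
    \<comment> \<open>The hulls need not be nested, so these differences need not be disjoint. They
      still cover the space, by the least i with y in \<open>E i\<close>, and a point outside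
      \<open>E j\<close> lies outside the ball of radius 2^j / w.\<close>
    define F where "F i = (case i of 0 \<Rightarrow> E 0 | Suc j \<Rightarrow> E (Suc j) - E j)" for i
    have F [measurable]: "F i \<in> sets M" for i by (cases i) (auto simp: F_def)
    define g where "g y = ennreal (cmod (bochner_riesz S K w x y))" for y
    have [measurable]: "g \<in> borel_measurable M" unfolding g_def[abs_def] by measurable
    have cover: "\<exists>i. y \<in> F i" for y
    proof -
      obtain i0 :: nat where "d x y * w \<le> 2 ^ i0" using exists_power_two_ge by blast
      then have "y \<in> qball d x (2 ^ i0 / w)" using w by (simp add: qball_def pos_le_divide_eq)
      then have ex: "\<exists>i. y \<in> E i" using EB by blast
      define i where "i = (LEAST i. y \<in> E i)"
      have "y \<in> E i" unfolding i_def using ex by (rule LeastI_ex)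
      moreover have "y \<notin> E j" if "j < i" for j using that not_less_Least unfolding i_def by blast
      ultimately have "y \<in> F i" by (cases i) (auto simp: F_def)
      then show ?thesis by blast
    qed
    have "(\<integral>\<^sup>+y. g y \<partial>M) \<le> (\<integral>\<^sup>+y. (\<Sum>i. g y * indicator (F i) y) \<partial>M)"
    proof (intro nn_integral_mono)
      fix y
      obtain i where "y \<in> F i" using cover by blast
      then show "g y \<le> (\<Sum>i. g y * indicator (F i) y)"
        using sum_le_suminf[of "\<lambda>i. g y * indicator (F i) y" "{i}"] by simp
    qed
    also have "\<dots> = (\<Sum>i. \<integral>\<^sup>+y\<in>F i. g y \<partial>M)" by (rule nn_integral_suminf) measurable
    also have "\<dots> = (\<Sum>i. \<integral>\<^sup>+y\<in>F (i + 1). g y \<partial>M) + (\<Sum>i<1. \<integral>\<^sup>+y\<in>F i. g y \<partial>M)"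
      by (rule suminf_offset) (rule summableI)
    also have "\<dots> \<le> (\<Sum>i. ennreal (C * w ^ (2 * S)) * ennreal (2 powr (- (1 / 4) * real i))) + ennreal (C0 * w ^ (2 * S))"
    proof (intro add_mono suminf_le summableI)
      fix i :: nat
      have "(\<integral>\<^sup>+y\<in>F (Suc i). g y \<partial>M) \<le> ennreal (C * w ^ (2 * S) * (2 ^ i) powr (- 1 / 4))"
        unfolding g_def
      proof (rule shell[rule_format, OF w _ F])
        show "w \<le> lam k" if "K \<le> k" for k using K that by simp
        show "2 ^ i / w \<le> d x y" if "y \<in> F (Suc i)" for y
        proof -
          have "y \<notin> qball d x (2 ^ i / w)" using that EB by (auto simp: F_def)
          then show "2 ^ i / w \<le> d x y" by (simp add: qball_def)
        qed
        have "emeasure M (F (Suc i)) \<le> emeasure M (E (Suc i))" by (intro emeasure_mono) (auto simp: F_def)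
        also have "\<dots> \<le> ennreal (cb * (2 * 2 ^ i / w) powr q)" using Em[of "Suc i"] by simp
        finally show "emeasure M (F (Suc i)) \<le> ennreal (cb * (2 * 2 ^ i / w) powr q)" .
      qed simp
      also have "(2 ^ i) powr (- 1 / 4) = 2 powr (- (1 / 4) * real i)"
        by (simp add: powr_powr flip: powr_realpow)
      finally show "(\<integral>\<^sup>+y\<in>F (i + 1). g y \<partial>M) \<le> ennreal (C * w ^ (2 * S)) * ennreal (2 powr (- (1 / 4) * real i))"
        using C w by (simp add: ennreal_mult)
      have "(\<integral>\<^sup>+y\<in>F 0. g y \<partial>M) \<le> ennreal (C0 * w ^ (2 * S))"
        unfolding g_def C0_def using w K Em[of 0] by (intro bochner_riesz_center F) (auto simp: F_def)
      then show "(\<Sum>i<1. \<integral>\<^sup>+y\<in>F i. g y \<partial>M) \<le> ennreal (C0 * w ^ (2 * S))" by simp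
    qed
    also have "(\<Sum>i. ennreal (C * w ^ (2 * S)) * ennreal (2 powr (- (1 / 4) * real i))) = ennreal (C * w ^ (2 * S)) * T"
      unfolding T_def by (rule ennreal_suminf_cmult)
    also have "ennreal (C * w ^ (2 * S)) * T + ennreal (C0 * w ^ (2 * S)) = ennreal ((C0 + C * t) * w ^ (2 * S))"
      unfolding t(2) using C C0 t w by (subst ennreal_mult[symmetric])
        (auto simp: algebra_simps simp flip: ennreal_plus)
    finally show "(\<integral>\<^sup>+y. ennreal (cmod (bochner_riesz S K w x y)) \<partial>M) \<le> ennreal ((C0 + C * t) * w ^ (2 * S))"
      by (simp add: g_def)
  qed
qed

lemma bochner_riesz_L1:
  assumes S: "real S > q + 1"
  shows "\<exists>C>0. \<forall>w\<ge>0. \<forall>x K. (\<forall>k\<ge>K. lam k \<ge> w) \<longrightarrow>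
    (\<integral>\<^sup>+y. ennreal (cmod (bochner_riesz S K w x y)) \<partial>M) \<le> ennreal (C * (1 + w ^ (2 * S)))"
proof -
  from bochner_riesz_large[OF S] obtain C1 where C1: "C1 > 0" and 1: "\<forall>w\<ge>2. \<forall>x K. (\<forall>k\<ge>K. lam k \<ge> w) \<longrightarrow>
    (\<integral>\<^sup>+y. ennreal (cmod (bochner_riesz S K w x y)) \<partial>M) \<le> ennreal (C1 * w ^ (2 * S))"
    by (elim exE conjE)
  from bochner_riesz_small[of S] obtain C2 where C2: "C2 > 0" and 2: "\<forall>w x K. 0 \<le> w \<longrightarrow> w \<le> 2 \<longrightarrow>
    (\<integral>\<^sup>+y. ennreal (cmod (bochner_riesz S K w x y)) \<partial>M) \<le> ennreal C2"
    by (elim exE conjE)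
  have "(\<integral>\<^sup>+y. ennreal (cmod (bochner_riesz S K w x y)) \<partial>M) \<le> ennreal ((C1 + C2) * (1 + w ^ (2 * S)))"
    if w: "w \<ge> 0" and K: "\<forall>k\<ge>K. lam k \<ge> w" for w x K
  proof (cases "w \<ge> 2")
    case True
    have "C1 * w ^ (2 * S) \<le> (C1 + C2) * (1 + w ^ (2 * S))"
      using C1 C2 w by (intro mult_mono) auto
    then show ?thesis using K by (intro order_trans[OF 1[rule_format, OF True] ennreal_leI]) auto
  next
    case False
    have "C2 * 1 \<le> (C1 + C2) * (1 + w ^ (2 * S))"
      using C1 C2 w by (intro mult_mono) auto
    then show ?thesis using False w by (intro order_trans[OF 2[rule_format] ennreal_leI]) auto
  qed
  then show ?thesis using C1 C2 by (intro exI[of _ "C1 + C2"]) auto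
qed

end

section \<open>Measures representing smooth filters\<close>

definition smooth_weight :: "real \<Rightarrow> nat \<Rightarrow> real \<Rightarrow> real" where
  "smooth_weight q S v = (v + 2) powr q * (v ^ S + v ^ (2 * S))"

lemma smooth_weight_ge:
  assumes "v \<ge> 0" "q > 0"
  shows "v powr q * v ^ (2 * S) \<le> smooth_weight q S v" "v ^ (2 * S) \<le> smooth_weight q S v"
    "smooth_weight q S v \<ge> 0"
proof -
  show "v powr q * v ^ (2 * S) \<le> smooth_weight q S v"
    unfolding smooth_weight_def using assms by (intro mult_mono powr_mono2) auto
  have "1 * v ^ (2 * S) \<le> smooth_weight q S v"
    unfolding smooth_weight_def using assms by (intro mult_mono ge_one_powr_ge_zero) auto
  then show "v ^ (2 * S) \<le> smooth_weight q S v" by simp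
  show "smooth_weight q S v \<ge> 0" unfolding smooth_weight_def using assms by simp
qed

lemma trunc_power_measurable [measurable]: "trunc_power S \<in> borel_measurable borel"
  unfolding trunc_power_def[abs_def] by measurable

lemma smooth_weight_measurable [measurable]: "smooth_weight q S \<in> borel_measurable borel"
  unfolding smooth_weight_def[abs_def] by measurable

text \<open>One Jordan part of the representing measure, carried over to the whole real line. It may
  have infinite mass, so finiteness on the half-lines \<open>{..b}\<close> is what makes it
  sigma-finite for Fubini's theorem.\<close>

locale smooth_measure =
  fixes Q :: "real measure" and q :: real and S :: nat
  assumes sets_Q [measurable_cong]: "sets Q = sets borel"
    and Q_finite: "emeasure Q {..b} < \<infinity>"
    and Q_nonneg: "AE v in Q. v \<ge> 0"
    and Q_weight: "(\<integral>\<^sup>+v. ennreal (smooth_weight q S v) \<partial>Q) < \<infinity>"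
    and q_pos: "q > 0"
begin

lemma sigma_finite_Q: "sigma_finite_measure Q"
proof
  have "space Q = UNIV" using sets_eq_imp_space_eq[OF sets_Q] by simp
  moreover have "\<exists>n::nat. x \<in> {..real n}" for x :: real using real_arch_simple by auto
  ultimately show "\<exists>A. countable A \<and> A \<subseteq> sets Q \<and> \<Union>A = space Q \<and> (\<forall>a\<in>A. emeasure Q a \<noteq> \<infinity>)"
    using Q_finite by (intro exI[of _ "range (\<lambda>n::nat. {..real n})"]) (auto simp: sets_Q less_top)
qed

lemma trunc_power_le_weight: "v \<ge> 0 \<Longrightarrow> trunc_power S (v\<^sup>2 - u\<^sup>2) \<le> smooth_weight q S v"
  using trunc_power_le(2)[of v S u] smooth_weight_ge(2)[OF _ q_pos, of v S] by linarith

lemma integrable_weight: "integrable Q (smooth_weight q S)"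
proof (rule integrableI_nonneg)
  show "AE v in Q. 0 \<le> smooth_weight q S v"
    using Q_nonneg by eventually_elim (rule smooth_weight_ge(3)[OF _ q_pos])
qed (use Q_weight in auto)

lemma integrable_trunc_power:
  assumes [measurable]: "A \<in> sets borel"
  shows "integrable Q (\<lambda>v. indicator A v * trunc_power S (v\<^sup>2 - u\<^sup>2))"
proof (rule Bochner_Integration.integrable_bound[OF integrable_weight])
  show "AE v in Q. norm (indicator A v * trunc_power S (v\<^sup>2 - u\<^sup>2)) \<le> norm (smooth_weight q S v)"
    using Q_nonneg
  proof eventually_elim
    case (elim v)
    have "trunc_power S (v\<^sup>2 - u\<^sup>2) \<ge> 0" by (simp add: trunc_power_def)
    then show ?case
      using elim trunc_power_le_weight[of v u] smooth_weight_ge(3)[OF elim q_pos, of S] by (auto simp: indicator_def)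
  qed
qed measurable

text \<open>It is h, and not the integral against each Jordan part separately, that is assumed to
  vanish beyond 1. Cutting at V makes each part vanish for u \<ge> V, so that finitely many indices
  k remain.\<close>

definition cut :: "real \<Rightarrow> real \<Rightarrow> real" where
  "cut V u = (LINT v|Q. indicator {..V} v * trunc_power S (v\<^sup>2 - u\<^sup>2))"

lemma cut_eq_0: "cut V u = 0" if "u \<ge> V" "u \<ge> 0"
proof -
  have "AE v in Q. indicator {..V} v * trunc_power S (v\<^sup>2 - u\<^sup>2) = 0"
    using Q_nonneg
  proof eventually_elim
    case (elim v)
    then show ?case using that trunc_power_le(3)[of v u S] by (auto simp: indicator_def)
  qed
  then show ?thesis unfolding cut_def by (rule integral_eq_zero_AE)
qed

definition tail :: "real \<Rightarrow> real" where
  "tail V = (LINT v|Q. indicator {V<..} v * smooth_weight q S v)"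

lemma tail_tendsto: "(\<lambda>m::nat. tail (real m)) \<longlonglongrightarrow> 0"
proof -
  have "(\<lambda>m::nat. LINT v|Q. indicator {real m<..} v * smooth_weight q S v) \<longlonglongrightarrow> (LINT v|Q. 0)"
  proof (rule integral_dominated_convergence[where w = "\<lambda>v. norm (smooth_weight q S v)"])
    show "integrable Q (\<lambda>v. norm (smooth_weight q S v))" using integrable_weight by (rule integrable_norm)
    show "AE v in Q. (\<lambda>m::nat. indicator {real m<..} v * smooth_weight q S v) \<longlonglongrightarrow> 0"
    proof (rule AE_I2)
      fix v :: real
      obtain m0 :: nat where "v \<le> real m0" using real_arch_simple by blast
      then have "eventually (\<lambda>m::nat. indicator {real m<..} v * smooth_weight q S v = 0) sequentially"
        unfolding eventually_sequentially by (intro exI[of _ m0]) (auto simp: indicator_def)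
      then show "(\<lambda>m::nat. indicator {real m<..} v * smooth_weight q S v) \<longlonglongrightarrow> 0"
        by (rule tendsto_eventually)
    qed
    show "AE v in Q. norm (indicator {real m<..} v * smooth_weight q S v) \<le> norm (smooth_weight q S v)" for m :: nat
      by (auto simp: indicator_def)
  qed measurable
  then show ?thesis by (simp add: tail_def)
qed

text \<open>On v > V the factor \<open>V powr q\<close> is at most \<open>v powr q\<close>, which
  the weight absorbs; so the discarded part tends to 0 even after multiplication by
  \<open>V powr q\<close>.\<close>

lemma cut_error:
  assumes V: "V > 0"
  shows "V powr q * \<bar>(LINT v|Q. trunc_power S (v\<^sup>2 - u\<^sup>2)) - cut V u\<bar> \<le> tail V"
proof -
  have i: "integrable Q (\<lambda>v. trunc_power S (v\<^sup>2 - u\<^sup>2))" using integrable_trunc_power[of UNIV] by simp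
  have "(LINT v|Q. trunc_power S (v\<^sup>2 - u\<^sup>2)) - cut V u
      = (LINT v|Q. trunc_power S (v\<^sup>2 - u\<^sup>2) - indicator {..V} v * trunc_power S (v\<^sup>2 - u\<^sup>2))"
    unfolding cut_def by (intro Bochner_Integration.integral_diff[symmetric] i integrable_trunc_power) auto
  also have "\<dots> = (LINT v|Q. indicator {V<..} v * trunc_power S (v\<^sup>2 - u\<^sup>2))"
    by (intro Bochner_Integration.integral_cong) (auto simp: indicator_def)
  finally have eq: "(LINT v|Q. trunc_power S (v\<^sup>2 - u\<^sup>2)) - cut V u = (LINT v|Q. indicator {V<..} v * trunc_power S (v\<^sup>2 - u\<^sup>2))" .
  have "(LINT v|Q. indicator {V<..} v * trunc_power S (v\<^sup>2 - u\<^sup>2)) \<ge> 0"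
    by (intro Bochner_Integration.integral_nonneg) (auto simp: trunc_power_def)
  then have "V powr q * \<bar>(LINT v|Q. trunc_power S (v\<^sup>2 - u\<^sup>2)) - cut V u\<bar> = (LINT v|Q. V powr q * (indicator {V<..} v * trunc_power S (v\<^sup>2 - u\<^sup>2)))"
    unfolding eq by simp
  also have "\<dots> \<le> tail V"
    unfolding tail_def
  proof (rule integral_mono_AE)
    show "AE v in Q. V powr q * (indicator {V<..} v * trunc_power S (v\<^sup>2 - u\<^sup>2)) \<le> indicator {V<..} v * smooth_weight q S v"
    proof (rule AE_I2)
      fix v
      show "V powr q * (indicator {V<..} v * trunc_power S (v\<^sup>2 - u\<^sup>2)) \<le> indicator {V<..} v * smooth_weight q S v"
      proof (cases "v > V")
        case True
        have "trunc_power S (v\<^sup>2 - u\<^sup>2) \<le> v ^ (2 * S)"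
          using True V by (intro trunc_power_le(2)) auto
        then have "V powr q * trunc_power S (v\<^sup>2 - u\<^sup>2) \<le> v powr q * v ^ (2 * S)"
          using True V q_pos by (intro mult_mono powr_mono2) (auto simp: trunc_power_def)
        also have "\<dots> \<le> smooth_weight q S v" using True V by (intro smooth_weight_ge q_pos) auto
        finally show ?thesis using True by simp
      qed simp
    qed
    show "integrable Q (\<lambda>v. V powr q * (indicator {V<..} v * trunc_power S (v\<^sup>2 - u\<^sup>2)))"
      by (intro integrable_mult_right integrable_trunc_power) auto
    show "integrable Q (\<lambda>v. indicator {V<..} v * smooth_weight q S v)"
      using integrable_mult_indicator[OF _ integrable_weight, of "{V<..}"] by (simp add: sets_Q)
  qed
  finally show ?thesis .
qed

text \<open>The weight need not dominate 1 near v = 0, where finiteness of the measure on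
  \<open>{..1}\<close> is used instead; beyond 1 the constant is absorbed into v^(2 S), at the cost
  of the factor 2.\<close>

lemma nn_integral_one_plus_power_finite: "(\<integral>\<^sup>+v. ennreal (1 + v ^ (2 * S)) \<partial>Q) < \<infinity>"
proof -
  have "(\<integral>\<^sup>+v. ennreal (1 + v ^ (2 * S)) \<partial>Q) \<le> (\<integral>\<^sup>+v. indicator {..1} v + ennreal 2 * ennreal (smooth_weight q S v) \<partial>Q)"
  proof (intro nn_integral_mono_AE AE_mp[OF Q_nonneg AE_I2] impI)
    fix v assume elim: "0 \<le> (v::real)"
    have W: "v ^ (2 * S) \<le> smooth_weight q S v" "smooth_weight q S v \<ge> 0"
      using smooth_weight_ge[OF elim q_pos] by auto
    show "ennreal (1 + v ^ (2 * S)) \<le> indicator {..1} v + ennreal 2 * ennreal (smooth_weight q S v)"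
    proof (cases "v \<le> 1")
      case True
      have "ennreal (1 + v ^ (2 * S)) \<le> ennreal (1 + 2 * smooth_weight q S v)" using W by (intro ennreal_leI) auto
      then show ?thesis using True W by (simp add: ennreal_mult)
    next
      case False
      then have "1 \<le> v ^ (2 * S)" by (intro one_le_power) auto
      then have "ennreal (1 + v ^ (2 * S)) \<le> ennreal (2 * smooth_weight q S v)" using W by (intro ennreal_leI) auto
      then show ?thesis using False W by (simp add: ennreal_mult)
    qed
  qed
  also have "\<dots> = emeasure Q {..1} + ennreal 2 * (\<integral>\<^sup>+v. ennreal (smooth_weight q S v) \<partial>Q)"
    by (simp add: nn_integral_add nn_integral_cmult)
  also have "\<dots> < \<infinity>" using Q_finite Q_weight by (simp add: ennreal_mult_less_top)
  finally show ?thesis .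
qed

end

section \<open>Kernels of low pass filters\<close>

lemma trunc_power_scale:
  assumes "n > 0"
  shows "trunc_power S (v\<^sup>2 - (l / n)\<^sup>2) = 1 / n ^ (2 * S) * trunc_power S ((n * v)\<^sup>2 - l\<^sup>2)"
proof -
  have eq: "v\<^sup>2 - (l / n)\<^sup>2 = ((n * v)\<^sup>2 - l\<^sup>2) / n\<^sup>2"
    using assms by (simp add: power_divide power_mult_distrib diff_divide_distrib)
  have "((n * v)\<^sup>2 - l\<^sup>2) / n\<^sup>2 > 0 \<longleftrightarrow> (n * v)\<^sup>2 - l\<^sup>2 > 0"
    using assms by (simp add: zero_less_divide_iff)
  then show ?thesis unfolding eq trunc_power_def by (simp add: power_divide power_mult)
qed

context heat_system
begin

text \<open>The factor n^(- 2 S) from rescaling cancels the growth (n v)^(2 S) of the Bochner-Riesz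
  bound and leaves 1 + v^(2 S), which is integrable. The bound is independent of V and K as well as
  of n, as the limit of large V requires.\<close>

lemma cut_kernel_L1:
  assumes Q: "smooth_measure Q q S" and S: "real S > q + 1"
  shows "\<exists>C\<ge>0. \<forall>n\<ge>1. \<forall>V x K. (\<forall>k\<ge>K. lam k \<ge> n * V) \<longrightarrow>
    (\<integral>\<^sup>+y. ennreal (cmod (\<Sum>k<K. of_real (smooth_measure.cut Q S V (lam k / n)) * \<phi> k x * cnj (\<phi> k y))) \<partial>M) \<le> ennreal C"
proof -
  interpret Q: smooth_measure Q q S by fact
  interpret QM: pair_sigma_finite Q M
    using Q.sigma_finite_Q sigma_finite by (simp add: pair_sigma_finite_def)
  note [measurable_cong] = Q.sets_Q
  from bochner_riesz_L1[OF S] obtain C where C: "C > 0" and BR: "\<forall>w\<ge>0. \<forall>x K. (\<forall>k\<ge>K. lam k \<ge> w) \<longrightarrow>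
    (\<integral>\<^sup>+y. ennreal (cmod (bochner_riesz S K w x y)) \<partial>M) \<le> ennreal (C * (1 + w ^ (2 * S)))"
    by (elim exE conjE)
  define I where "I = (\<integral>\<^sup>+v. ennreal (1 + v ^ (2 * S)) \<partial>Q)"
  have "I < \<infinity>" unfolding I_def by (rule Q.nn_integral_one_plus_power_finite)
  then obtain J where J: "J \<ge> 0" "I = ennreal J" by (cases I) auto
  have "(\<integral>\<^sup>+y. ennreal (cmod (\<Sum>k<K. of_real (Q.cut V (lam k / n)) * \<phi> k x * cnj (\<phi> k y))) \<partial>M) \<le> ennreal (C * J)"
    if n: "n \<ge> 1" and K: "\<forall>k\<ge>K. lam k \<ge> n * V" for n V x K
  proof -
    define g where "g v y = complex_of_real (indicator {..V} v / n ^ (2 * S)) * bochner_riesz S K (n * v) x y" for v y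
    have g_meas [measurable]: "(\<lambda>(v, y). g v y) \<in> borel_measurable (Q \<Otimes>\<^sub>M M)"
      unfolding g_def bochner_riesz_def by measurable
    have tp: "complex_of_real (indicator {..V} v * trunc_power S (v\<^sup>2 - (lam k / n)\<^sup>2))
        = of_real (indicator {..V} v / n ^ (2 * S)) * of_real (trunc_power S ((n * v)\<^sup>2 - (lam k)\<^sup>2))" for k v
      using trunc_power_scale[of n S v "lam k"] n by simp
    have "(\<Sum>k<K. of_real (Q.cut V (lam k / n)) * \<phi> k x * cnj (\<phi> k y)) = (LINT v|Q. g v y)" for y
    proof -
      have ik: "integrable Q (\<lambda>v. complex_of_real (indicator {..V} v * trunc_power S (v\<^sup>2 - (lam k / n)\<^sup>2)))" for k
        by (intro integrable_of_real Q.integrable_trunc_power) simp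
      have "(\<Sum>k<K. of_real (Q.cut V (lam k / n)) * \<phi> k x * cnj (\<phi> k y))
         = (\<Sum>k<K. (LINT v|Q. complex_of_real (indicator {..V} v * trunc_power S (v\<^sup>2 - (lam k / n)\<^sup>2)) * (\<phi> k x * cnj (\<phi> k y))))"
        unfolding Q.cut_def by (simp only: integral_complex_of_real[symmetric] mult.assoc Bochner_Integration.integral_mult_left[OF ik])
      also have "\<dots> = (LINT v|Q. (\<Sum>k<K. complex_of_real (indicator {..V} v * trunc_power S (v\<^sup>2 - (lam k / n)\<^sup>2)) * (\<phi> k x * cnj (\<phi> k y))))"
        by (intro Bochner_Integration.integral_sum[symmetric] integrable_mult_left ik)
      also have "\<dots> = (LINT v|Q. g v y)"
        unfolding g_def bochner_riesz_def tp by (simp only: sum_distrib_left mult.assoc)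
      finally show ?thesis .
    qed
    \<comment> \<open>If g is not integrable in v, its Bochner integral is 0 by default and the
      bound is trivial.\<close>
    moreover have "ennreal (cmod (LINT v|Q. g v y)) \<le> (\<integral>\<^sup>+v. ennreal (cmod (g v y)) \<partial>Q)" for y
      by (cases "integrable Q (\<lambda>v. g v y)")
        (auto simp: not_integrable_integral_eq intro: integral_norm_bound_ennreal)
    ultimately have "(\<integral>\<^sup>+y. ennreal (cmod (\<Sum>k<K. of_real (Q.cut V (lam k / n)) * \<phi> k x * cnj (\<phi> k y))) \<partial>M)
       \<le> (\<integral>\<^sup>+y. \<integral>\<^sup>+v. ennreal (cmod (g v y)) \<partial>Q \<partial>M)"
      by (intro nn_integral_mono) simp
    also have "\<dots> = (\<integral>\<^sup>+v. \<integral>\<^sup>+y. ennreal (cmod (g v y)) \<partial>M \<partial>Q)"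
      by (intro QM.Fubini') measurable
    also have "\<dots> \<le> (\<integral>\<^sup>+v. ennreal C * ennreal (1 + v ^ (2 * S)) \<partial>Q)"
    proof (intro nn_integral_mono_AE AE_mp[OF Q.Q_nonneg AE_I2] impI)
      fix v :: real assume v: "0 \<le> v"
      have [measurable]: "bochner_riesz S K (n * v) x \<in> borel_measurable M" by (rule bochner_riesz_measurable)
      show "(\<integral>\<^sup>+y. ennreal (cmod (g v y)) \<partial>M) \<le> ennreal C * ennreal (1 + v ^ (2 * S))"
      proof (cases "v \<le> V")
        case True
        have "(\<integral>\<^sup>+y. ennreal (cmod (g v y)) \<partial>M) = (\<integral>\<^sup>+y. ennreal (1 / n ^ (2 * S)) * ennreal (cmod (bochner_riesz S K (n * v) x y)) \<partial>M)"
          using True n by (intro nn_integral_cong) (simp add: g_def norm_mult norm_divide norm_power flip: ennreal_mult)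
        also have "\<dots> = ennreal (1 / n ^ (2 * S)) * (\<integral>\<^sup>+y. ennreal (cmod (bochner_riesz S K (n * v) x y)) \<partial>M)"
          by (rule nn_integral_cmult) measurable
        also have "\<dots> \<le> ennreal (1 / n ^ (2 * S)) * ennreal (C * (1 + (n * v) ^ (2 * S)))"
        proof (intro mult_left_mono BR[rule_format])
          show "0 \<le> n * v" using n v by simp
          show "n * v \<le> lam k" if "K \<le> k" for k
          proof -
            have "n * v \<le> n * V" using True n by (intro mult_left_mono) auto
            then show ?thesis using K that by force
          qed
        qed simp
        also have "\<dots> = ennreal (C * (1 / n ^ (2 * S) + v ^ (2 * S)))"
        proof -
          have "1 / n ^ (2 * S) * (C * (1 + (n * v) ^ (2 * S))) = C * (1 / n ^ (2 * S) + v ^ (2 * S))"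
            using n by (simp add: field_simps power_mult_distrib)
          then show ?thesis using n C v by (subst ennreal_mult[symmetric]) auto
        qed
        also have "\<dots> \<le> ennreal (C * (1 + v ^ (2 * S)))"
          using n C by (intro ennreal_leI mult_left_mono add_right_mono) auto
        also have "\<dots> = ennreal C * ennreal (1 + v ^ (2 * S))" using C v by (intro ennreal_mult) auto
        finally show ?thesis .
      qed (simp add: g_def)
    qed
    also have "\<dots> = ennreal C * I" unfolding I_def by (rule nn_integral_cmult) measurable
    also have "\<dots> = ennreal (C * J)" using C J by (simp add: ennreal_mult)
    finally show ?thesis .
  qed
  then show ?thesis using C J by (intro exI[of _ "C * J"]) auto
qed

section \<open>The kernel of the filter and its limit representation by cut kernels\<close>

definition filter_kernel :: "(real \<Rightarrow> real) \<Rightarrow> real \<Rightarrow> 'a \<Rightarrow> 'a \<Rightarrow> complex" where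
  "filter_kernel h n x y = (\<Sum>k | lam k < n. of_real (h (lam k / n)) * \<phi> k x * cnj (\<phi> k y))"

lemma filter_kernel_measurable [measurable]: "filter_kernel h n x \<in> borel_measurable M"
  unfolding filter_kernel_def[abs_def] by measurable

lemma filter_kernel_measurable2 [measurable]: "(\<lambda>(x, y). filter_kernel h n x y) \<in> borel_measurable (M \<Otimes>\<^sub>M M)"
  unfolding filter_kernel_def by measurable

lemma lam_cofinal: "\<exists>K. \<forall>k\<ge>K. lam k \<ge> n"
  using lam_lim by (simp add: filterlim_at_top eventually_sequentially)

lemma sum_\<phi>_\<phi>_le:
  assumes "w \<ge> 1"
  shows "(\<Sum>k | lam k < w. cmod (\<phi> k x) * cmod (\<phi> k y)) \<le> exp 1 * c1 * w powr q"
proof -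
  have "(\<Sum>k | lam k < w. cmod (\<phi> k x) * cmod (\<phi> k y)) \<le> (\<Sum>k | lam k < w. (cmod (\<phi> k x))\<^sup>2 / 2 + (cmod (\<phi> k y))\<^sup>2 / 2)"
  proof (intro sum_mono)
    fix k
    show "cmod (\<phi> k x) * cmod (\<phi> k y) \<le> (cmod (\<phi> k x))\<^sup>2 / 2 + (cmod (\<phi> k y))\<^sup>2 / 2"
      using sum_squares_bound[of "cmod (\<phi> k x)" "cmod (\<phi> k y)"] by simp
  qed
  also have "\<dots> = (\<Sum>k | lam k < w. (cmod (\<phi> k x))\<^sup>2) / 2 + (\<Sum>k | lam k < w. (cmod (\<phi> k y))\<^sup>2) / 2"
    by (simp add: sum.distrib sum_divide_distrib)
  also have "\<dots> \<le> exp 1 * c1 * w powr q"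
    using sum_\<phi>_squares[OF assms, of x] sum_\<phi>_squares[OF assms, of y] by linarith
  finally show ?thesis .
qed

text \<open>Cutting the integral for \<open>h\<close> at \<open>v = m\<close> changes the kernel by at most the tail of the weighted
  variation of the representing measures; the weight \<open>(v + 2)\<^sup>q\<close> compensates the growth of the
  Christoffel function.\<close>

lemma filter_kernel_L1_aux:
  assumes Q: "smooth_measure P q S" "smooth_measure N q S" and S: "real S > q + 1"
    and h: "\<And>u. u \<ge> 0 \<Longrightarrow> h u = (LINT v|P. trunc_power S (v\<^sup>2 - u\<^sup>2)) - (LINT v|N. trunc_power S (v\<^sup>2 - u\<^sup>2))"
    and h0: "\<And>u. u \<ge> 1 \<Longrightarrow> h u = 0"
  shows "\<exists>C>0. \<forall>n\<ge>1. \<forall>x. (\<integral>\<^sup>+y. ennreal (cmod (filter_kernel h n x y)) \<partial>M) \<le> ennreal C"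
proof -
  interpret P: smooth_measure P q S by fact
  interpret N: smooth_measure N q S by fact
  from cut_kernel_L1[OF Q(1) S] obtain CP where CP: "CP \<ge> 0" and P: "\<forall>n\<ge>1. \<forall>V x K. (\<forall>k\<ge>K. lam k \<ge> n * V) \<longrightarrow>
    (\<integral>\<^sup>+y. ennreal (cmod (\<Sum>k<K. of_real (P.cut V (lam k / n)) * \<phi> k x * cnj (\<phi> k y))) \<partial>M) \<le> ennreal CP"
    by (elim exE conjE)
  from cut_kernel_L1[OF Q(2) S] obtain CN where CN: "CN \<ge> 0" and N: "\<forall>n\<ge>1. \<forall>V x K. (\<forall>k\<ge>K. lam k \<ge> n * V) \<longrightarrow>
    (\<integral>\<^sup>+y. ennreal (cmod (\<Sum>k<K. of_real (N.cut V (lam k / n)) * \<phi> k x * cnj (\<phi> k y))) \<partial>M) \<le> ennreal CN"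
    by (elim exE conjE)
  have "(\<integral>\<^sup>+y. ennreal (cmod (filter_kernel h n x y)) \<partial>M) \<le> ennreal (CP + CN)" if n: "n \<ge> 1" for n x
  proof -
    have "\<exists>K. \<forall>k\<ge>K. lam k \<ge> n * real m" for m by (rule lam_cofinal)
    then obtain K where K: "\<And>m k. k \<ge> K m \<Longrightarrow> lam k \<ge> n * real m" by metis
    define p where "p m y = (\<Sum>k<K m. of_real (P.cut (real m) (lam k / n)) * \<phi> k x * cnj (\<phi> k y))" for m y
    define r where "r m y = (\<Sum>k<K m. of_real (N.cut (real m) (lam k / n)) * \<phi> k x * cnj (\<phi> k y))" for m y
    have [measurable]: "p m \<in> borel_measurable M" "r m \<in> borel_measurable M" for m
      unfolding p_def[abs_def] r_def[abs_def] by measurable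
    have lim: "(\<lambda>m. p m y - r m y) \<longlonglongrightarrow> filter_kernel h n x y" for y
    proof -
      define t where "t m = P.tail (real m) + N.tail (real m)" for m :: nat
      \<comment> \<open>For fixed n the factor \<open>n powr q\<close> is harmless: this limit need
        not be uniform in n, since the uniform bound comes from \<open>cut_kernel_L1\<close> through
        Fatou's lemma.\<close>
      have t0: "(\<lambda>m. t m * (exp 1 * c1 * n powr q)) \<longlonglongrightarrow> 0"
        unfolding t_def by (intro tendsto_mult_left_zero tendsto_add_zero P.tail_tendsto N.tail_tendsto)
      have "cmod (p m y - r m y - filter_kernel h n x y) \<le> t m * (exp 1 * c1 * n powr q)" if m: "m \<ge> 1" for m
      proof -
        define c where "c k = P.cut (real m) (lam k / n) - N.cut (real m) (lam k / n)" for k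
        have c0: "c k = 0" if "lam k \<ge> n * real m" for k
          using that n lam_nonneg[of k] by (simp add: c_def P.cut_eq_0 N.cut_eq_0 pos_le_divide_eq mult.commute)
        have hk0: "h (lam k / n) = 0" if "lam k \<ge> n" for k
          using that n by (intro h0) simp
        have sub: "{k. lam k < n * real m} \<subseteq> {..<K m}" using K by (auto simp: not_le[symmetric])
        have "p m y - r m y = (\<Sum>k<K m. of_real (c k) * \<phi> k x * cnj (\<phi> k y))"
          by (simp add: p_def r_def c_def sum_subtractf[symmetric] left_diff_distrib)
        also have "\<dots> = (\<Sum>k | lam k < n * real m. of_real (c k) * \<phi> k x * cnj (\<phi> k y))"
          using sub c0 by (intro sum.mono_neutral_right) (auto simp: not_less)
        finally have 1: "p m y - r m y = (\<Sum>k | lam k < n * real m. of_real (c k) * \<phi> k x * cnj (\<phi> k y))" .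
        have nm: "n \<le> n * real m" using n m by simp
        have 2: "filter_kernel h n x y = (\<Sum>k | lam k < n * real m. of_real (h (lam k / n)) * \<phi> k x * cnj (\<phi> k y))"
          unfolding filter_kernel_def using nm hk0 finite_lam_less
          by (intro sum.mono_neutral_left) (auto simp: not_less)
        have ck: "real m powr q * \<bar>c k - h (lam k / n)\<bar> \<le> t m" for k
        proof -
          define u where "u = lam k / n"
          have u: "u \<ge> 0" using n lam_nonneg[of k] by (simp add: u_def)
          define A B where "A = (LINT v|P. trunc_power S (v\<^sup>2 - u\<^sup>2)) - P.cut (real m) u"
            and "B = (LINT v|N. trunc_power S (v\<^sup>2 - u\<^sup>2)) - N.cut (real m) u"
          have "\<bar>c k - h u\<bar> \<le> \<bar>A\<bar> + \<bar>B\<bar>" unfolding h[OF u] c_def u_def[symmetric] A_def B_def by linarith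
          then have "real m powr q * \<bar>c k - h u\<bar> \<le> real m powr q * \<bar>A\<bar> + real m powr q * \<bar>B\<bar>"
            unfolding distrib_left[symmetric] by (intro mult_left_mono) auto
          also have "\<dots> \<le> t m"
            unfolding t_def A_def B_def using m by (intro add_mono P.cut_error N.cut_error) auto
          finally show ?thesis by (simp add: u_def)
        qed
        have m0: "real m powr q > 0" using m by simp
        have "cmod (p m y - r m y - filter_kernel h n x y) = cmod (\<Sum>k | lam k < n * real m. of_real (c k - h (lam k / n)) * \<phi> k x * cnj (\<phi> k y))"
          unfolding 1 2 by (simp add: sum_subtractf[symmetric] left_diff_distrib)
        also have "\<dots> \<le> (\<Sum>k | lam k < n * real m. \<bar>c k - h (lam k / n)\<bar> * (cmod (\<phi> k x) * cmod (\<phi> k y)))"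
          by (rule order_trans[OF norm_sum]) (simp add: norm_mult mult.assoc flip: of_real_diff)
        also have "\<dots> \<le> (\<Sum>k | lam k < n * real m. (t m / real m powr q) * (cmod (\<phi> k x) * cmod (\<phi> k y)))"
          using ck m0 by (intro sum_mono mult_right_mono) (auto simp: pos_le_divide_eq mult.commute)
        also have "\<dots> = (t m / real m powr q) * (\<Sum>k | lam k < n * real m. cmod (\<phi> k x) * cmod (\<phi> k y))"
          by (simp add: sum_distrib_left)
        also have "\<dots> \<le> (t m / real m powr q) * (exp 1 * c1 * (n * real m) powr q)"
        proof (intro mult_left_mono sum_\<phi>_\<phi>_le)
          show "1 \<le> n * real m" using nm n by linarith
          have "0 \<le> real m powr q * \<bar>c 0 - h (lam 0 / n)\<bar>" by simp
          then have "0 \<le> t m" using ck[of 0] by linarith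
          then show "0 \<le> t m / real m powr q" by simp
        qed
        also have "\<dots> = t m * (exp 1 * c1 * n powr q)" using n m by (simp add: powr_mult)
        finally show ?thesis .
      qed
      then have "eventually (\<lambda>m. norm (p m y - r m y - filter_kernel h n x y) \<le> t m * (exp 1 * c1 * n powr q)) sequentially"
        unfolding eventually_sequentially by blast
      then have "(\<lambda>m. p m y - r m y - filter_kernel h n x y) \<longlonglongrightarrow> 0"
        using t0 by (rule Lim_null_comparison)
      then show ?thesis by (simp add: LIM_zero_iff)
    qed
    have "(\<integral>\<^sup>+y. ennreal (cmod (filter_kernel h n x y)) \<partial>M) = (\<integral>\<^sup>+y. liminf (\<lambda>m. ennreal (cmod (p m y - r m y))) \<partial>M)"
    proof (intro nn_integral_cong)
      fix y
      have "(\<lambda>m. ennreal (cmod (p m y - r m y))) \<longlonglongrightarrow> ennreal (cmod (filter_kernel h n x y))"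
        by (intro tendsto_ennrealI tendsto_norm lim)
      then show "ennreal (cmod (filter_kernel h n x y)) = liminf (\<lambda>m. ennreal (cmod (p m y - r m y)))"
        by (rule lim_imp_Liminf[OF sequentially_bot, symmetric])
    qed
    also have "\<dots> \<le> liminf (\<lambda>m. \<integral>\<^sup>+y. ennreal (cmod (p m y - r m y)) \<partial>M)"
      by (intro nn_integral_liminf) measurable
    also have "\<dots> \<le> ennreal (CP + CN)"
    proof (intro Liminf_le always_eventually allI)
      fix m
      have "(\<integral>\<^sup>+y. ennreal (cmod (p m y - r m y)) \<partial>M) \<le> (\<integral>\<^sup>+y. ennreal (cmod (p m y)) + ennreal (cmod (r m y)) \<partial>M)"
        by (intro nn_integral_mono) (auto simp flip: ennreal_plus intro!: ennreal_leI norm_triangle_ineq4)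
      also have "\<dots> = (\<integral>\<^sup>+y. ennreal (cmod (p m y)) \<partial>M) + (\<integral>\<^sup>+y. ennreal (cmod (r m y)) \<partial>M)"
        by (rule nn_integral_add) measurable
      also have "\<dots> \<le> ennreal CP + ennreal CN"
        unfolding p_def r_def using n K by (intro add_mono P[rule_format] N[rule_format]) auto
      also have "\<dots> = ennreal (CP + CN)" using CP CN by simp
      finally show "(\<integral>\<^sup>+y. ennreal (cmod (p m y - r m y)) \<partial>M) \<le> ennreal (CP + CN)" .
    qed simp
    finally show ?thesis .
  qed
  moreover have "ennreal (CP + CN) \<le> ennreal (CP + CN + 1)" by (intro ennreal_leI) simp
  ultimately have "\<forall>n\<ge>1. \<forall>x. (\<integral>\<^sup>+y. ennreal (cmod (filter_kernel h n x y)) \<partial>M) \<le> ennreal (CP + CN + 1)"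
    using order_trans by blast
  then show ?thesis using CP CN by (intro exI[of _ "CP + CN + 1"]) simp
qed

end

lemma smooth_measure_distr:
  assumes sP: "sets P = sets (restrict_space borel {0..})"
    and fin: "\<And>b. b \<ge> 0 \<Longrightarrow> emeasure P {0..b} < \<infinity>"
    and W: "(\<integral>\<^sup>+v. ennreal ((v + 2) powr q * (v ^ S + v ^ (2 * S))) \<partial>P) < \<infinity>"
    and q: "q > 0"
  shows "smooth_measure (distr P borel (\<lambda>v. v)) q S"
    and "(LINT v|distr P borel (\<lambda>v. v). trunc_power S (v\<^sup>2 - u\<^sup>2)) = (LINT v|P. trunc_power S (v\<^sup>2 - u\<^sup>2))"
proof -
  have [measurable]: "(\<lambda>v. v) \<in> borel_measurable P"
    unfolding measurable_cong_sets[OF sP refl] by (rule measurable_restrict_space1) simp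
  have sp: "space P = {0..}" using sets_eq_imp_space_eq[OF sP] by (simp add: space_restrict_space)
  show "smooth_measure (distr P borel (\<lambda>v. v)) q S"
  proof
    show "emeasure (distr P borel (\<lambda>v. v)) {..b} < \<infinity>" for b
    proof -
      have "emeasure (distr P borel (\<lambda>v. v)) {..b} = emeasure P ({..b} \<inter> {0..})"
        by (subst emeasure_distr) (auto simp: sp)
      also have "{..b} \<inter> {0..} = {0..b}" by auto
      also have "emeasure P {0..b} < \<infinity>" using fin[of b] by (cases "b \<ge> 0") auto
      finally show ?thesis .
    qed
    show "AE v in distr P borel (\<lambda>v. v). v \<ge> 0"
      by (subst AE_distr_iff) (auto simp: sp intro!: AE_I2)
    show "(\<integral>\<^sup>+v. ennreal (smooth_weight q S v) \<partial>distr P borel (\<lambda>v. v)) < \<infinity>"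
      using W by (subst nn_integral_distr) (auto simp: smooth_weight_def)
  qed (use q in simp_all)
  show "(LINT v|distr P borel (\<lambda>v. v). trunc_power S (v\<^sup>2 - u\<^sup>2)) = (LINT v|P. trunc_power S (v\<^sup>2 - u\<^sup>2))"
    by (subst integral_distr) auto
qed

lemma (in heat_system) filter_kernel_L1:
  assumes "low_pass_filter h" "sufficiently_smooth q h"
  shows "\<exists>C>0. \<forall>n\<ge>1. \<forall>x. (\<integral>\<^sup>+y. ennreal (cmod (filter_kernel h n x y)) \<partial>M) \<le> ennreal C"
proof -
  obtain S P N where S: "real S > q + 1" and m: "half_line_signed_measure P N"
    and h: "\<And>u. u \<ge> 0 \<Longrightarrow> h u = (LINT v|P. trunc_power S (v\<^sup>2 - u\<^sup>2)) - (LINT v|N. trunc_power S (v\<^sup>2 - u\<^sup>2))"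
    and W: "(\<integral>\<^sup>+v. ennreal ((v + 2) powr q * (v ^ S + v ^ (2 * S))) \<partial>P)
          + (\<integral>\<^sup>+v. ennreal ((v + 2) powr q * (v ^ S + v ^ (2 * S))) \<partial>N) < \<infinity>"
    using assms(2) unfolding sufficiently_smooth_def by auto
  note mm = m[unfolded half_line_signed_measure_def]
  have P: "sets P = sets (restrict_space borel {0..})" "\<And>b. b \<ge> 0 \<Longrightarrow> emeasure P {0..b} < \<infinity>"
    "(\<integral>\<^sup>+v. ennreal ((v + 2) powr q * (v ^ S + v ^ (2 * S))) \<partial>P) < \<infinity>"
    using mm W by auto
  have N: "sets N = sets (restrict_space borel {0..})" "\<And>b. b \<ge> 0 \<Longrightarrow> emeasure N {0..b} < \<infinity>"
    "(\<integral>\<^sup>+v. ennreal ((v + 2) powr q * (v ^ S + v ^ (2 * S))) \<partial>N) < \<infinity>"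
    using mm W by auto
  show ?thesis
  proof (rule filter_kernel_L1_aux[OF smooth_measure_distr(1)[OF P q] smooth_measure_distr(1)[OF N q] S])
    show "h u = (LINT v|distr P borel (\<lambda>v. v). trunc_power S (v\<^sup>2 - u\<^sup>2)) - (LINT v|distr N borel (\<lambda>v. v). trunc_power S (v\<^sup>2 - u\<^sup>2))"
      if "u \<ge> 0" for u
      using h[OF that] smooth_measure_distr(2)[OF P q] smooth_measure_distr(2)[OF N q] by simp
    show "h u = 0" if "u \<ge> 1" for u using assms(1) that by (auto simp: low_pass_filter_def)
  qed
qed

section \<open>Approximation by filtered sums\<close>

lemma Lp_norm_2_square:
  "(Lp_norm M 2 f)\<^sup>2 = (\<integral>\<^sup>+x. ennreal ((cmod (f x))\<^sup>2) \<partial>M)"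
proof -
  have sq: "(epowr x (1 / 2))\<^sup>2 = x" for x
    by (cases x) (auto simp: epowr_def ennreal_power powr_half_sqrt)
  have "Lp_norm M 2 f = epowr (\<integral>\<^sup>+x. ennreal ((cmod (f x))\<^sup>2) \<partial>M) (1 / 2)"
    by (simp add: Lp_norm_def)
  then show ?thesis by (simp only: sq)
qed

text \<open>With the kernel bound as a parameter, the constants of the later estimates visibly
  depend on neither n nor the function to be approximated.\<close>

locale filtered_system = heat_system +
  fixes h :: "real \<Rightarrow> real" and Ck :: real
  assumes low_pass: "low_pass_filter h" and Ck: "Ck > 0"
    and kernel_L1: "n \<ge> 1 \<Longrightarrow> (\<integral>\<^sup>+y. ennreal (cmod (filter_kernel h n x y)) \<partial>M) \<le> ennreal Ck"
begin

lemma h_bounds: "0 \<le> h u" "h u \<le> 1"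
  using low_pass by (auto simp: low_pass_filter_def)

lemma h_one: "0 \<le> u \<Longrightarrow> u < 1 / 2 \<Longrightarrow> h u = 1"
  using low_pass by (auto simp: low_pass_filter_def)

lemma h_zero: "1 \<le> u \<Longrightarrow> h u = 0"
  using low_pass by (auto simp: low_pass_filter_def)

lemma h_antimono: "0 \<le> u \<Longrightarrow> u \<le> v \<Longrightarrow> h v \<le> h u"
  using low_pass by (auto simp: low_pass_filter_def monotone_on_def)

definition filtered_sum :: "real \<Rightarrow> ('a \<Rightarrow> complex) \<Rightarrow> 'a \<Rightarrow> complex" where
  "filtered_sum n g x = (\<Sum>k | lam k < n. of_real (h (lam k / n)) * coeff M \<phi> g k * \<phi> k x)"

lemma filtered_sum_measurable [measurable]: "filtered_sum n g \<in> borel_measurable M"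
  unfolding filtered_sum_def[abs_def] by measurable

lemma filtered_sum_superset:
  assumes "n > 0" "finite A" "{k. lam k < n} \<subseteq> A"
  shows "filtered_sum n g x = (\<Sum>k\<in>A. of_real (h (lam k / n)) * coeff M \<phi> g k * \<phi> k x)"
  unfolding filtered_sum_def using assms by (intro sum.mono_neutral_left) (auto simp: h_zero not_less)

text \<open>Equality of coefficients is the only link between f and g = U f: the reconstruction from
  f is the filtered expansion of g, and what follows concerns g alone.\<close>

lemma sigma_op_eq:
  assumes "n > 0" and "\<And>k. coeff M \<phi> g k = coeff M \<psi> f k"
  shows "sigma_op M lam \<phi> \<psi> h n f = filtered_sum n g"
proof
  fix x
  show "sigma_op M lam \<phi> \<psi> h n f x = filtered_sum n g x"
    unfolding sigma_op_def filtered_sum_def using assms finite_lam_less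
    by (subst suminf_finite[of "{k. lam k < n}"]) (auto simp: h_zero not_less)
qed

definition dyadic_part :: "nat \<Rightarrow> ('a \<Rightarrow> complex) \<Rightarrow> 'a \<Rightarrow> complex" where
  "dyadic_part j g x = (if j = 0 then filtered_sum 1 g x else filtered_sum (2 ^ j) g x - filtered_sum (2 ^ (j - 1)) g x)"

lemma tau_op_eq:
  assumes "\<And>k. coeff M \<phi> g k = coeff M \<psi> f k"
  shows "tau_op M lam \<phi> \<psi> h j f = dyadic_part j g"
  by (rule ext) (simp add: tau_op_def dyadic_part_def sigma_op_eq[OF _ assms])

lemma dyadic_part_measurable [measurable]: "dyadic_part j g \<in> borel_measurable M"
  unfolding dyadic_part_def[abs_def] by measurable

lemma dyadic_part_telescope: "(\<Sum>j<Suc J. dyadic_part j g x) = filtered_sum (2 ^ J) g x"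
  by (induction J) (simp_all add: dyadic_part_def)

lemma \<phi>_cnj_int: "integrable M (\<lambda>y. cnj (\<phi> k y))"
  using \<phi>_int[of k] by simp

text \<open>The kernel is Hermitian because h is real, so the L1 bound in y also holds in x and the
  Schur test applies. Integrability of g against each \<phi>_k allows the sum of coefficients to be
  written as one integral.\<close>

lemma filtered_sum_bound:
  assumes g [measurable]: "g \<in> borel_measurable M" and gi: "\<And>k. integrable M (\<lambda>x. g x * cnj (\<phi> k x))"
    and n: "n \<ge> 1" and p: "1 \<le> p"
  shows "Lp_norm M p (filtered_sum n g) \<le> ennreal Ck * Lp_norm M p g"
proof (rule Schur_test[OF sigma_finite, where K = "\<lambda>x y. ennreal (cmod (filter_kernel h n x y))"])
  show "(\<lambda>(x, y). ennreal (cmod (filter_kernel h n x y))) \<in> borel_measurable (M \<Otimes>\<^sub>M M)"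
    by measurable
  show "(\<integral>\<^sup>+y. ennreal (cmod (filter_kernel h n x y)) \<partial>M) \<le> ennreal Ck" for x using n by (rule kernel_L1)
  have "cnj (filter_kernel h n y x) = filter_kernel h n x y" for x y
    unfolding filter_kernel_def cnj_sum by (intro sum.cong refl) (simp add: mult_ac)
  then have "cmod (filter_kernel h n x y) = cmod (filter_kernel h n y x)" for x y
    by (metis complex_mod_cnj)
  then show "(\<integral>\<^sup>+x. ennreal (cmod (filter_kernel h n x y)) \<partial>M) \<le> ennreal Ck" for y
    using kernel_L1[OF n, of y] by simp
  show "ennreal (cmod (filtered_sum n g x)) \<le> (\<integral>\<^sup>+y. ennreal (cmod (filter_kernel h n x y)) * ennreal (cmod (g y)) \<partial>M)" for x
  proof -
    define c where "c k = of_real (h (lam k / n)) * \<phi> k x" for k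
    have i: "integrable M (\<lambda>y. c k * (g y * cnj (\<phi> k y)))" for k
      using gi by (rule integrable_mult_right)
    have "filtered_sum n g x = (\<Sum>k | lam k < n. c k * (LINT y|M. g y * cnj (\<phi> k y)))"
      unfolding filtered_sum_def coeff_def c_def by (intro sum.cong refl) (simp add: mult_ac)
    also have "\<dots> = (LINT y|M. (\<Sum>k | lam k < n. c k * (g y * cnj (\<phi> k y))))"
      using i by (subst Bochner_Integration.integral_sum) auto
    also have "(\<lambda>y. (\<Sum>k | lam k < n. c k * (g y * cnj (\<phi> k y)))) = (\<lambda>y. filter_kernel h n x y * g y)"
      unfolding filter_kernel_def c_def sum_distrib_right by (intro ext sum.cong refl) (simp add: mult_ac)
    finally have eq: "filtered_sum n g x = (LINT y|M. filter_kernel h n x y * g y)" .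
    have "ennreal (cmod (LINT y|M. filter_kernel h n x y * g y)) \<le> (\<integral>\<^sup>+y. ennreal (cmod (filter_kernel h n x y * g y)) \<partial>M)"
      by (cases "integrable M (\<lambda>y. filter_kernel h n x y * g y)")
        (auto simp: not_integrable_integral_eq intro: integral_norm_bound_ennreal)
    then show ?thesis unfolding eq by (simp add: norm_mult ennreal_mult)
  qed
qed (use Ck p in auto)

lemma integrable_Lp_\<phi>:
  assumes "g \<in> Lp_space M p" "1 \<le> p"
  shows "integrable M (\<lambda>x. g x * cnj (\<phi> k x))"
proof -
  obtain B where "\<And>x. cmod (\<phi> k x) \<le> B" using \<phi>_bound_ex by blast
  then show ?thesis using assms \<phi>_cnj_int by (intro integrable_mult_of_Lp[of _ _ _ _ B]) auto
qed

lemma integrable_poly_\<phi>: "integrable M (\<lambda>x. (\<Sum>k\<in>A. c k * \<phi> k x) * cnj (\<phi> j x))"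
  unfolding sum_distrib_right mult.assoc
  by (intro Bochner_Integration.integrable_sum integrable_mult_right integrable_\<phi>_\<phi>)

lemma coeff_poly:
  assumes "finite A"
  shows "coeff M \<phi> (\<lambda>x. \<Sum>k\<in>A. c k * \<phi> k x) j = (if j \<in> A then c j else 0)"
proof -
  have "coeff M \<phi> (\<lambda>x. \<Sum>k\<in>A. c k * \<phi> k x) j = (\<Sum>k\<in>A. c k * (if k = j then 1 else 0))"
    unfolding coeff_def sum_distrib_right mult.assoc
    by (subst Bochner_Integration.integral_sum) (auto intro!: integrable_mult_right integrable_\<phi>_\<phi> simp: orth)
  also have "\<dots> = (if j \<in> A then c j else 0)"
    using assms by (simp add: if_distrib sum.delta cong: if_cong)
  finally show ?thesis .
qed

lemma filtered_sum_poly: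
  assumes "finite A" "A \<subseteq> {k. lam k < n / 2}" "n > 0"
  shows "filtered_sum n (\<lambda>x. \<Sum>k\<in>A. c k * \<phi> k x) x = (\<Sum>k\<in>A. c k * \<phi> k x)"
proof -
  have A: "A \<subseteq> {k. lam k < n}" using assms by force
  have "filtered_sum n (\<lambda>x. \<Sum>k\<in>A. c k * \<phi> k x) x = (\<Sum>k | lam k < n. of_real (h (lam k / n)) * (if k \<in> A then c k else 0) * \<phi> k x)"
    by (simp add: filtered_sum_def coeff_poly[OF assms(1)])
  also have "\<dots> = (\<Sum>k\<in>A. of_real (h (lam k / n)) * (if k \<in> A then c k else 0) * \<phi> k x)"
    using A finite_lam_less by (intro sum.mono_neutral_right) auto
  also have "\<dots> = (\<Sum>k\<in>A. c k * \<phi> k x)"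
  proof (intro sum.cong refl)
    fix k assume k: "k \<in> A"
    then have "lam k / n < 1 / 2" using assms by (auto simp: divide_simps)
    then have "h (lam k / n) = 1" using assms lam_nonneg[of k] by (intro h_one) auto
    then show "of_real (h (lam k / n)) * (if k \<in> A then c k else 0) * \<phi> k x = c k * \<phi> k x" using k by simp
  qed
  finally show ?thesis .
qed

section \<open>Near-best approximation by filtered sums\<close>

lemma approx_error_le_filtered_sum:
  "approx_error M lam \<phi> n p g \<le> Lp_norm M p (\<lambda>x. g x - filtered_sum n g x)"
  unfolding approx_error_def
proof (rule INF_lower)
  show "filtered_sum n g \<in> diffusion_polys lam \<phi> n"
    unfolding diffusion_polys_def filtered_sum_def[abs_def] using finite_lam_less[of n]
    by (intro CollectI exI[of _ "{k. lam k < n}"] exI[of _ "\<lambda>k. of_real (h (lam k / n)) * coeff M \<phi> g k"]) auto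
qed

lemma filtered_sum_error_le:
  assumes g: "g \<in> Lp_space M p" and p: "1 \<le> p" and n: "n \<ge> 1"
  shows "Lp_norm M p (\<lambda>x. g x - filtered_sum n g x) \<le> ennreal (1 + Ck) * approx_error M lam \<phi> (n / 2) p g"
proof -
  have g_meas [measurable]: "g \<in> borel_measurable M" using g by (simp add: Lp_space_def)
  have main: "Lp_norm M p (\<lambda>x. g x - filtered_sum n g x) \<le> ennreal (1 + Ck) * Lp_norm M p (\<lambda>x. g x - P x)"
    if P: "P \<in> diffusion_polys lam \<phi> (n / 2)" for P
  proof -
    obtain A c where A: "finite A" "A \<subseteq> {k. lam k < n / 2}" and P_eq: "P = (\<lambda>x. \<Sum>k\<in>A. c k * \<phi> k x)"
      using P by (auto simp: diffusion_polys_def)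
    have [measurable]: "P \<in> borel_measurable M" unfolding P_eq by measurable
    have Pi: "integrable M (\<lambda>x. P x * cnj (\<phi> k x))" for k unfolding P_eq by (rule integrable_poly_\<phi>)
    have gi: "integrable M (\<lambda>x. g x * cnj (\<phi> k x))" for k using g p by (rule integrable_Lp_\<phi>)
    have "coeff M \<phi> (\<lambda>x. g x - P x) k = coeff M \<phi> g k - coeff M \<phi> P k" for k
      unfolding coeff_def left_diff_distrib by (rule Bochner_Integration.integral_diff[OF gi Pi])
    then have "filtered_sum n (\<lambda>x. g x - P x) x = filtered_sum n g x - filtered_sum n P x" for x
      by (simp add: filtered_sum_def right_diff_distrib left_diff_distrib sum_subtractf)
    moreover have "filtered_sum n P x = P x" for x using A n unfolding P_eq by (intro filtered_sum_poly) auto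
    \<comment> \<open>As P is reproduced by the filter, it can be subtracted before filtering;
      reproduction requires frequencies below n / 2, hence the argument n / 2 of the error.\<close>
    ultimately have eq: "g x - filtered_sum n g x = (g x - P x) - filtered_sum n (\<lambda>x. g x - P x) x" for x by simp
    have "Lp_norm M p (\<lambda>x. g x - filtered_sum n g x) \<le> Lp_norm M p (\<lambda>x. g x - P x) + Lp_norm M p (filtered_sum n (\<lambda>x. g x - P x))"
      unfolding eq using p by (intro Lp_norm_triangle_minus) measurable
    also have "Lp_norm M p (filtered_sum n (\<lambda>x. g x - P x)) \<le> ennreal Ck * Lp_norm M p (\<lambda>x. g x - P x)"
    proof (intro filtered_sum_bound n p)
      show "integrable M (\<lambda>x. (g x - P x) * cnj (\<phi> k x))" for k
        unfolding left_diff_distrib by (rule Bochner_Integration.integrable_diff[OF gi Pi])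
    qed measurable
    finally show ?thesis using Ck by (simp add: distrib_right ennreal_plus add_left_mono)
  qed
  define c where "c = 1 + Ck"
  have c: "c > 0" using Ck by (simp add: c_def)
  define X where "X = Lp_norm M p (\<lambda>x. g x - filtered_sum n g x)"
  \<comment> \<open>The constant is moved to the left-hand side before the infimum over P is taken,
    and back afterwards.\<close>
  have cX: "ennreal c * (ennreal (inverse c) * Y) = Y" "ennreal (inverse c) * (ennreal c * Y) = Y" for Y
    using c by (auto simp: mult.assoc[symmetric] simp flip: ennreal_mult)
  have "ennreal (inverse c) * X \<le> approx_error M lam \<phi> (n / 2) p g"
    unfolding approx_error_def
  proof (rule INF_greatest)
    fix P assume "P \<in> diffusion_polys lam \<phi> (n / 2)"
    from main[OF this] have "ennreal (inverse c) * X \<le> ennreal (inverse c) * (ennreal c * Lp_norm M p (\<lambda>x. g x - P x))"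
      unfolding X_def c_def by (intro mult_left_mono) auto
    then show "ennreal (inverse c) * X \<le> Lp_norm M p (\<lambda>x. g x - P x)" by (simp only: cX)
  qed
  then have "ennreal c * (ennreal (inverse c) * X) \<le> ennreal c * approx_error M lam \<phi> (n / 2) p g"
    by (intro mult_left_mono) auto
  then have "X \<le> ennreal c * approx_error M lam \<phi> (n / 2) p g" by (simp only: cX)
  then show ?thesis unfolding X_def c_def .
qed

lemma approx_error_antimono: "m \<le> n \<Longrightarrow> approx_error M lam \<phi> n p g \<le> approx_error M lam \<phi> m p g"
  unfolding approx_error_def by (intro INF_superset_mono) (auto simp: diffusion_polys_def, fastforce)

section \<open>Dyadic decomposition and Besov spaces\<close>

lemma filtered_sum_converges:
  assumes g: "g \<in> X_space M lam \<phi> p" and p: "1 \<le> p"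
  shows "(\<lambda>J. Lp_norm M p (\<lambda>x. g x - filtered_sum (2 ^ J) g x)) \<longlonglongrightarrow> 0"
proof (rule tendsto_sandwich[OF _ _ tendsto_const])
  have "filterlim (\<lambda>J::nat. 2 ^ J / 2 :: real) at_top sequentially" by real_asymp
  then have "(\<lambda>J. approx_error M lam \<phi> (2 ^ J / 2) p g) \<longlonglongrightarrow> 0"
    using g by (auto simp: X_space_def intro: filterlim_compose)
  then have "(\<lambda>J. ennreal (1 + Ck) * approx_error M lam \<phi> (2 ^ J / 2) p g) \<longlonglongrightarrow> ennreal (1 + Ck) * 0"
    by (intro ennreal_tendsto_cmult) auto
  then show "(\<lambda>J. ennreal (1 + Ck) * approx_error M lam \<phi> (2 ^ J / 2) p g) \<longlonglongrightarrow> 0" by simp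
  show "\<forall>\<^sub>F J in sequentially. Lp_norm M p (\<lambda>x. g x - filtered_sum (2 ^ J) g x) \<le> ennreal (1 + Ck) * approx_error M lam \<phi> (2 ^ J / 2) p g"
    using g p by (intro always_eventually allI filtered_sum_error_le) (auto simp: X_space_def)
qed simp

lemma dyadic_part_series_converges:
  assumes g: "g \<in> X_space M lam \<phi> p" and p: "1 \<le> p"
  shows "(\<lambda>J. Lp_norm M p (\<lambda>x. g x - (\<Sum>j<J. dyadic_part j g x))) \<longlonglongrightarrow> 0"
proof -
  have "(\<lambda>J. Lp_norm M p (\<lambda>x. g x - (\<Sum>j<Suc J. dyadic_part j g x))) \<longlonglongrightarrow> 0"
    unfolding dyadic_part_telescope by (rule filtered_sum_converges[OF g p])
  then show ?thesis by (rule LIMSEQ_imp_Suc)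
qed

lemma dyadic_part_finite:
  assumes g: "g \<in> Lp_space M p" and p: "1 \<le> p"
  shows "Lp_norm M p (dyadic_part j g) < \<infinity>"
proof -
  have g_meas: "g \<in> borel_measurable M" and fin: "Lp_norm M p g < \<infinity>" using g by (auto simp: Lp_space_def)
  have s: "Lp_norm M p (filtered_sum n g) < \<infinity>" if "n \<ge> 1" for n
  proof -
    have "ennreal Ck * Lp_norm M p g < \<infinity>" using fin by (simp add: ennreal_mult_less_top)
    then show ?thesis
      using filtered_sum_bound[OF g_meas integrable_Lp_\<phi>[OF g p] that p] by (rule le_less_trans[rotated])
  qed
  show ?thesis
  proof (cases "j = 0")
    case True
    then have "dyadic_part j g = filtered_sum 1 g" by (simp add: dyadic_part_def fun_eq_iff)
    then show ?thesis using s[of 1] by simp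
  next
    case False
    then have "dyadic_part j g = (\<lambda>x. filtered_sum (2 ^ j) g x - filtered_sum (2 ^ (j - 1)) g x)" by (simp add: dyadic_part_def fun_eq_iff)
    moreover have "Lp_norm M p (\<lambda>x. filtered_sum (2 ^ j) g x - filtered_sum (2 ^ (j - 1)) g x) \<le> Lp_norm M p (filtered_sum (2 ^ j) g) + Lp_norm M p (filtered_sum (2 ^ (j - 1)) g)"
      using p by (intro Lp_norm_triangle_minus) measurable
    moreover have "\<dots> < \<infinity>" using s[of "2 ^ j"] s[of "2 ^ (j - 1)"] by simp
    ultimately show ?thesis by (simp add: le_less_trans)
  qed
qed

text \<open>Two indices are lost: one because the error at n is controlled by the approximation
  error at n / 2, one because a dyadic part is the difference of the errors at two consecutive
  scales.\<close>

lemma dyadic_part_le_approx_error: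
  assumes g: "g \<in> Lp_space M p" and p: "1 \<le> p"
  shows "Lp_norm M p (dyadic_part (Suc (Suc j)) g) \<le> ennreal (2 * (1 + Ck)) * approx_error M lam \<phi> (2 ^ j) p g"
proof -
  have [measurable]: "g \<in> borel_measurable M" using g by (simp add: Lp_space_def)
  let ?D = "\<lambda>n. Lp_norm M p (\<lambda>x. g x - filtered_sum n g x)"
  have D: "?D (2 ^ i) \<le> ennreal (1 + Ck) * approx_error M lam \<phi> (2 ^ j) p g" if "i \<ge> Suc j" for i
  proof -
    have "(2::real) ^ Suc j \<le> 2 ^ i" using that by (intro power_increasing) auto
    then have "approx_error M lam \<phi> (2 ^ i / 2) p g \<le> approx_error M lam \<phi> (2 ^ j) p g"
      by (intro approx_error_antimono) simp
    then have "ennreal (1 + Ck) * approx_error M lam \<phi> (2 ^ i / 2) p g \<le> ennreal (1 + Ck) * approx_error M lam \<phi> (2 ^ j) p g"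
      by (intro mult_left_mono) auto
    moreover have "?D (2 ^ i) \<le> ennreal (1 + Ck) * approx_error M lam \<phi> (2 ^ i / 2) p g"
      by (intro filtered_sum_error_le[OF g p]) simp
    ultimately show ?thesis by (rule order_trans[rotated])
  qed
  have "dyadic_part (Suc (Suc j)) g = (\<lambda>x. (g x - filtered_sum (2 ^ Suc j) g x) - (g x - filtered_sum (2 ^ Suc (Suc j)) g x))"
    by (simp add: dyadic_part_def fun_eq_iff)
  then have "Lp_norm M p (dyadic_part (Suc (Suc j)) g) \<le> ?D (2 ^ Suc j) + ?D (2 ^ Suc (Suc j))"
    using p by (simp only:) (intro Lp_norm_triangle_minus, measurable)
  also have "\<dots> \<le> ennreal (1 + Ck) * approx_error M lam \<phi> (2 ^ j) p g + ennreal (1 + Ck) * approx_error M lam \<phi> (2 ^ j) p g"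
    by (intro add_mono D) auto
  also have "\<dots> = ennreal (2 * (1 + Ck)) * approx_error M lam \<phi> (2 ^ j) p g"
  proof -
    have "ennreal (2 * (1 + Ck)) = ennreal (1 + Ck) + ennreal (1 + Ck)"
      using Ck by (subst ennreal_plus[symmetric]) auto
    then show ?thesis by (simp only: distrib_right)
  qed
  finally show ?thesis .
qed

lemma approx_error_le_dyadic_part_sum:
  assumes g: "g \<in> X_space M lam \<phi> p" and p: "1 \<le> p"
  shows "approx_error M lam \<phi> (2 ^ j) p g \<le> (\<Sum>i. Lp_norm M p (dyadic_part (i + j) g))"
proof -
  have [measurable]: "g \<in> borel_measurable M" using g by (simp add: X_space_def Lp_space_def)
  let ?D = "\<lambda>n. Lp_norm M p (\<lambda>x. g x - filtered_sum n g x)"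
  let ?T = "\<Sum>i. Lp_norm M p (dyadic_part (i + j) g)"
  have tele: "filtered_sum (2 ^ (j + m)) g x - filtered_sum (2 ^ j) g x = (\<Sum>i<m. dyadic_part (Suc i + j) g x)" for m x
  proof (induction m)
    case (Suc m)
    have "filtered_sum (2 ^ (j + Suc m)) g x - filtered_sum (2 ^ j) g x = (filtered_sum (2 ^ (j + m)) g x - filtered_sum (2 ^ j) g x) + dyadic_part (Suc m + j) g x"
      by (simp add: dyadic_part_def add.commute)
    then show ?case unfolding Suc by simp
  qed simp
  have "?D (2 ^ j) \<le> ?D (2 ^ (j + m)) + ?T" for m
  proof -
    have "(\<lambda>x. g x - filtered_sum (2 ^ j) g x) = (\<lambda>x. (g x - filtered_sum (2 ^ (j + m)) g x) + (\<Sum>i<m. dyadic_part (Suc i + j) g x))"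
      unfolding tele[symmetric] by (simp add: fun_eq_iff)
    then have "?D (2 ^ j) \<le> ?D (2 ^ (j + m)) + Lp_norm M p (\<lambda>x. \<Sum>i<m. dyadic_part (Suc i + j) g x)"
      using p by (simp only:) (intro Lp_norm_triangle, measurable)
    also have "Lp_norm M p (\<lambda>x. \<Sum>i<m. dyadic_part (Suc i + j) g x) \<le> (\<Sum>i<m. Lp_norm M p (dyadic_part (Suc i + j) g))"
      using p by (intro Lp_norm_sum_le) measurable
    \<comment> \<open>Only parts of index above j occur; the part of index j is added to give the
      sum the form required by \<open>b_space_tail_sums\<close>.\<close>
    also have "\<dots> \<le> (\<Sum>i<Suc m. Lp_norm M p (dyadic_part (i + j) g))"
      by (subst sum.lessThan_Suc_shift) simp
    also have "\<dots> \<le> ?T" by (intro sum_le_suminf) auto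
    finally show ?thesis by (simp add: add_left_mono)
  qed
  moreover have "(\<lambda>m. ?D (2 ^ (j + m)) + ?T) \<longlonglongrightarrow> 0 + ?T"
    using LIMSEQ_ignore_initial_segment[OF filtered_sum_converges[OF g p], of j]
    by (intro tendsto_add tendsto_const) (simp add: add.commute)
  ultimately have "?D (2 ^ j) \<le> 0 + ?T"
    by (intro tendsto_lowerbound[where F = sequentially]) auto
  then show ?thesis using approx_error_le_filtered_sum[of "2 ^ j" p g] by simp
qed

lemma besov_iff_dyadic_part:
  assumes g: "g \<in> X_space M lam \<phi> p" and p: "1 \<le> p" and \<rho>: "0 < \<rho>" and \<gamma>: "0 < \<gamma>"
  shows "g \<in> besov_space M lam \<phi> p \<rho> \<gamma> \<longleftrightarrow> (\<lambda>j. Lp_norm M p (dyadic_part j g)) \<in> b_space \<rho> \<gamma>"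
proof
  have gL: "g \<in> Lp_space M p" using g by (simp add: X_space_def)
  assume "g \<in> besov_space M lam \<phi> p \<rho> \<gamma>"
  then have E: "(\<lambda>j. approx_error M lam \<phi> (2 ^ j) p g) \<in> b_space \<rho> \<gamma>" by (simp add: besov_space_def)
  have "(\<lambda>j. Lp_norm M p (dyadic_part (Suc (Suc j)) g)) \<in> b_space \<rho> \<gamma>"
  proof (rule b_space_tail_sums[OF \<rho> \<gamma> _ E])
    fix j
    \<comment> \<open>A tail sum is at least its first term, so \<open>b_space_tail_sums\<close>
      also serves for a plain comparison up to a constant factor.\<close>
    have "approx_error M lam \<phi> (2 ^ j) p g \<le> (\<Sum>i. approx_error M lam \<phi> (2 ^ (i + j)) p g)"
      using sum_le_suminf[of "\<lambda>i. approx_error M lam \<phi> (2 ^ (i + j)) p g" "{0}"] by simp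
    then have "ennreal (2 * (1 + Ck)) * approx_error M lam \<phi> (2 ^ j) p g \<le> ennreal (2 * (1 + Ck)) * (\<Sum>i. approx_error M lam \<phi> (2 ^ (i + j)) p g)"
      by (intro mult_left_mono) auto
    then show "Lp_norm M p (dyadic_part (Suc (Suc j)) g) \<le> ennreal (2 * (1 + Ck)) * (\<Sum>i. approx_error M lam \<phi> (2 ^ (i + j)) p g)"
      by (rule order_trans[OF dyadic_part_le_approx_error[OF gL p]])
  qed (use Ck in simp)
  then have "(\<lambda>j. Lp_norm M p (dyadic_part (Suc j) g)) \<in> b_space \<rho> \<gamma>"
    by (rule b_space_Suc[OF \<rho>]) (rule dyadic_part_finite[OF gL p])
  then show "(\<lambda>j. Lp_norm M p (dyadic_part j g)) \<in> b_space \<rho> \<gamma>"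
    by (rule b_space_Suc[OF \<rho>]) (rule dyadic_part_finite[OF gL p])
next
  assume T: "(\<lambda>j. Lp_norm M p (dyadic_part j g)) \<in> b_space \<rho> \<gamma>"
  have "(\<lambda>j. approx_error M lam \<phi> (2 ^ j) p g) \<in> b_space \<rho> \<gamma>"
    by (rule b_space_tail_sums[OF \<rho> \<gamma> zero_less_one T]) (simp add: approx_error_le_dyadic_part_sum[OF g p])
  then show "g \<in> besov_space M lam \<phi> p \<rho> \<gamma>" using g by (simp add: besov_space_def)
qed

end

section \<open>Square function estimates in L2\<close>

lemma sum_squares_le_square_sum:
  fixes b :: "nat \<Rightarrow> real"
  assumes "\<And>j. b j \<ge> 0"
  shows "(\<Sum>j<n. (b j)\<^sup>2) \<le> (\<Sum>j<n. b j)\<^sup>2"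
proof (induction n)
  case (Suc n)
  have "0 \<le> (\<Sum>j<n. b j) * b n" using assms by (intro mult_nonneg_nonneg sum_nonneg) auto
  then show ?case using Suc by (simp add: power2_sum)
qed simp

context filtered_system
begin

text \<open>The Fourier multiplier with which \<open>dyadic_part j\<close> acts on \<phi>_k.\<close>

definition band :: "nat \<Rightarrow> nat \<Rightarrow> real" where
  "band j k = (if j = 0 then h (lam k) else h (lam k / 2 ^ j) - h (lam k / 2 ^ (j - 1)))"

lemma band_nonneg: "band j k \<ge> 0"
proof (cases "j = 0")
  case False
  have "(2::real) ^ (j - 1) \<le> 2 ^ j" by (intro power_increasing) auto
  then have "lam k / 2 ^ j \<le> lam k / 2 ^ (j - 1)" using lam_nonneg[of k] by (intro divide_left_mono) auto
  then have "h (lam k / 2 ^ (j - 1)) \<le> h (lam k / 2 ^ j)" using lam_nonneg[of k] by (intro h_antimono) auto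
  then show ?thesis using False by (simp add: band_def)
qed (simp add: band_def h_bounds)

lemma band_sum: "(\<Sum>j<Suc J. band j k) = h (lam k / 2 ^ J)"
  by (induction J) (simp_all add: band_def)

text \<open>For the least m with lam k < 2^m, the value of h at lam k / 2^i is 0 for i < m and 1 for
  i > m, so it can change only in the steps m and m + 1.\<close>

lemma band_support: "\<exists>m. \<forall>j. j \<notin> {m, Suc m} \<longrightarrow> band j k = 0"
proof -
  obtain m0 where "lam k < 2 ^ m0" using real_arch_pow[of 2 "lam k"] by auto
  define m where "m = (LEAST m. lam k < 2 ^ m)"
  have m: "lam k < 2 ^ m" unfolding m_def using \<open>lam k < 2 ^ m0\<close> by (rule LeastI)
  have "band j k = 0" if "j \<notin> {m, Suc m}" for j
  proof (cases "j < m")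
    case True
    have h0: "h (lam k / 2 ^ i) = 0" if "i < m" for i
    proof -
      have "2 ^ i \<le> lam k" using not_less_Least[OF that[unfolded m_def]] by simp
      then show ?thesis by (intro h_zero) (simp add: pos_le_divide_eq)
    qed
    show ?thesis using h0[of j] h0[of "j - 1"] True by (cases j) (auto simp: band_def)
  next
    case False
    then have j: "j \<ge> Suc (Suc m)" using that by auto
    have h1: "h (lam k / 2 ^ i) = 1" if "i \<ge> Suc m" for i
    proof (rule h_one)
      have "(2::real) ^ Suc m \<le> 2 ^ i" using that by (intro power_increasing) auto
      then have "2 * lam k < 2 ^ i" using m by simp
      then show "lam k / 2 ^ i < 1 / 2" by (simp add: pos_divide_less_eq)
    qed (use lam_nonneg in simp)
    show ?thesis using h1[of j] h1[of "j - 1"] j by (simp add: band_def)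
  qed
  then show ?thesis by blast
qed

text \<open>Nonnegativity of the bands gives the first inequality with constant 1; Cauchy-Schwarz
  over at most two nonzero bands gives the second with constant 2.\<close>

lemma band_squares:
  "(\<Sum>j<Suc J. (band j k)\<^sup>2) \<le> (h (lam k / 2 ^ J))\<^sup>2"
  "(h (lam k / 2 ^ J))\<^sup>2 \<le> 2 * (\<Sum>j<Suc J. (band j k)\<^sup>2)"
proof -
  show "(\<Sum>j<Suc J. (band j k)\<^sup>2) \<le> (h (lam k / 2 ^ J))\<^sup>2"
    unfolding band_sum[symmetric] by (intro sum_squares_le_square_sum band_nonneg)
  obtain m where m: "\<And>j. j \<notin> {m, Suc m} \<Longrightarrow> band j k = 0" using band_support by blast
  define I where "I = {m, Suc m} \<inter> {..<Suc J}"
  have "card I \<le> card {m, Suc m}" unfolding I_def by (intro card_mono) auto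
  then have cI: "real (card I) \<le> 2" by simp
  have "(h (lam k / 2 ^ J))\<^sup>2 = (\<Sum>j\<in>I. band j k)\<^sup>2"
    unfolding band_sum[symmetric] I_def
    by (intro arg_cong[where f = "\<lambda>x. x\<^sup>2"] sum.mono_neutral_right) (use m in auto)
  also have "\<dots> \<le> (\<Sum>j\<in>I. (band j k)\<^sup>2) * card I"
    by (intro sum_squared_le_sum_of_squares)
  also have "\<dots> \<le> (\<Sum>j\<in>I. (band j k)\<^sup>2) * 2"
    using cI by (intro mult_left_mono sum_nonneg) auto
  also have "(\<Sum>j\<in>I. (band j k)\<^sup>2) \<le> (\<Sum>j<Suc J. (band j k)\<^sup>2)"
    unfolding I_def by (intro sum_mono2) auto
  finally show "(h (lam k / 2 ^ J))\<^sup>2 \<le> 2 * (\<Sum>j<Suc J. (band j k)\<^sup>2)" by simp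
qed

lemma dyadic_part_eq_sum:
  assumes "j \<le> J"
  shows "dyadic_part j g x = (\<Sum>k | lam k < 2 ^ J. of_real (band j k) * coeff M \<phi> g k * \<phi> k x)"
proof -
  have sub: "{k. lam k < 2 ^ i} \<subseteq> {k. lam k < 2 ^ J}" if "i \<le> J" for i
  proof -
    have "(2::real) ^ i \<le> 2 ^ J" using that by (intro power_increasing) auto
    then show ?thesis by (auto intro: less_le_trans)
  qed
  have s: "filtered_sum (2 ^ i) g x = (\<Sum>k | lam k < 2 ^ J. of_real (h (lam k / 2 ^ i)) * coeff M \<phi> g k * \<phi> k x)" if "i \<le> J" for i
    using sub[OF that] finite_lam_less by (intro filtered_sum_superset) auto
  show ?thesis
  proof (cases "j = 0")
    case True
    then show ?thesis using s[of 0] by (simp add: dyadic_part_def band_def)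
  next
    case False
    then show ?thesis using s[of j] s[of "j - 1"] assms
      by (simp add: dyadic_part_def band_def sum_subtractf left_diff_distrib)
  qed
qed

lemma Lp_norm_2_expansion:
  assumes "finite A"
  shows "(Lp_norm M 2 (\<lambda>x. \<Sum>k\<in>A. of_real (c k) * coeff M \<phi> g k * \<phi> k x))\<^sup>2
    = ennreal (\<Sum>k\<in>A. (c k)\<^sup>2 * (cmod (coeff M \<phi> g k))\<^sup>2)"
  unfolding Lp_norm_2_square nn_integral_orthonormal_sum[OF assms]
  by (simp add: norm_mult power_mult_distrib)

definition energy :: "('a \<Rightarrow> complex) \<Rightarrow> nat \<Rightarrow> real" where
  "energy g J = (\<Sum>k | lam k < 2 ^ J. (h (lam k / 2 ^ J))\<^sup>2 * (cmod (coeff M \<phi> g k))\<^sup>2)"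

lemma dyadic_part_square_sums:
  shows "(Lp_norm M 2 (filtered_sum (2 ^ J) g))\<^sup>2 = ennreal (energy g J)"
    and "(\<Sum>j<Suc J. (Lp_norm M 2 (dyadic_part j g))\<^sup>2) \<le> ennreal (energy g J)"
    and "ennreal (energy g J) \<le> 2 * (\<Sum>j<Suc J. (Lp_norm M 2 (dyadic_part j g))\<^sup>2)"
proof -
  let ?A = "{k. lam k < 2 ^ J}" and ?c = "\<lambda>k. (cmod (coeff M \<phi> g k))\<^sup>2"
  show "(Lp_norm M 2 (filtered_sum (2 ^ J) g))\<^sup>2 = ennreal (energy g J)"
    unfolding energy_def filtered_sum_def[abs_def] by (rule Lp_norm_2_expansion[OF finite_lam_less])
  have "(Lp_norm M 2 (dyadic_part j g))\<^sup>2 = ennreal (\<Sum>k\<in>?A. (band j k)\<^sup>2 * ?c k)" if "j \<le> J" for j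
  proof -
    have "dyadic_part j g = (\<lambda>x. \<Sum>k\<in>?A. of_real (band j k) * coeff M \<phi> g k * \<phi> k x)"
      using that by (intro ext dyadic_part_eq_sum)
    then show ?thesis by (simp only: Lp_norm_2_expansion[OF finite_lam_less])
  qed
  then have "(\<Sum>j<Suc J. (Lp_norm M 2 (dyadic_part j g))\<^sup>2) = (\<Sum>j<Suc J. ennreal (\<Sum>k\<in>?A. (band j k)\<^sup>2 * ?c k))"
    by (intro sum.cong) auto
  also have "\<dots> = ennreal (\<Sum>j<Suc J. \<Sum>k\<in>?A. (band j k)\<^sup>2 * ?c k)"
    by (intro sum_ennreal sum_nonneg) auto
  also have "(\<Sum>j<Suc J. \<Sum>k\<in>?A. (band j k)\<^sup>2 * ?c k) = (\<Sum>k\<in>?A. (\<Sum>j<Suc J. (band j k)\<^sup>2) * ?c k)"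
    unfolding sum_distrib_right by (rule sum.swap)
  finally have eq: "(\<Sum>j<Suc J. (Lp_norm M 2 (dyadic_part j g))\<^sup>2) = ennreal (\<Sum>k\<in>?A. (\<Sum>j<Suc J. (band j k)\<^sup>2) * ?c k)" .
  show "(\<Sum>j<Suc J. (Lp_norm M 2 (dyadic_part j g))\<^sup>2) \<le> ennreal (energy g J)"
    unfolding eq energy_def by (intro ennreal_leI sum_mono mult_right_mono band_squares) auto
  have "energy g J \<le> (\<Sum>k\<in>?A. (2 * (\<Sum>j<Suc J. (band j k)\<^sup>2)) * ?c k)"
    unfolding energy_def by (intro sum_mono mult_right_mono band_squares) auto
  also have "\<dots> = 2 * (\<Sum>k\<in>?A. (\<Sum>j<Suc J. (band j k)\<^sup>2) * ?c k)"
    by (subst sum_distrib_left) (simp only: mult.assoc)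
  finally have "energy g J \<le> 2 * (\<Sum>k\<in>?A. (\<Sum>j<Suc J. (band j k)\<^sup>2) * ?c k)" .
  then have "ennreal (energy g J) \<le> ennreal (2 * (\<Sum>k\<in>?A. (\<Sum>j<Suc J. (band j k)\<^sup>2) * ?c k))"
    by (rule ennreal_leI)
  also have "\<dots> = 2 * ennreal (\<Sum>k\<in>?A. (\<Sum>j<Suc J. (band j k)\<^sup>2) * ?c k)"
    by (subst ennreal_mult) (auto intro!: sum_nonneg mult_nonneg_nonneg add_nonneg_nonneg)
  finally show "ennreal (energy g J) \<le> 2 * (\<Sum>j<Suc J. (Lp_norm M 2 (dyadic_part j g))\<^sup>2)" unfolding eq .
qed

text \<open>The orthonormal system need not be complete, so Parseval's identity is not applied to g
  itself. The norm of g is recovered as the limit of the norms of its filtered sums, which converge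
  to g because g lies in \<open>X_space\<close>; for each filtered sum orthonormality reduces the
  claim to the multipliers.\<close>

lemma dyadic_part_square_function:
  assumes g: "g \<in> X_space M lam \<phi> 2"
  shows "(\<Sum>j. (Lp_norm M 2 (dyadic_part j g))\<^sup>2) \<le> (Lp_norm M 2 g)\<^sup>2"
    and "(Lp_norm M 2 g)\<^sup>2 \<le> 5 * (\<Sum>j. (Lp_norm M 2 (dyadic_part j g))\<^sup>2)"
proof -
  note sq = dyadic_part_square_sums[where g = g]
  let ?T = "\<Sum>j. (Lp_norm M 2 (dyadic_part j g))\<^sup>2"
  have g_meas [measurable]: "g \<in> borel_measurable M" and "Lp_norm M 2 g < \<infinity>"
    using g by (auto simp: X_space_def Lp_space_def)
  then obtain G where G: "G \<ge> 0" "Lp_norm M 2 g = ennreal G" by (cases "Lp_norm M 2 g") auto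
  have s0: "energy g J \<ge> 0" for J unfolding energy_def by (intro sum_nonneg) auto
  have p2: "(1::ennreal) \<le> 2" by simp
  have filtered_sum_norm: "Lp_norm M 2 (filtered_sum (2 ^ J) g) = ennreal (sqrt (energy g J))" for J
  proof (cases "Lp_norm M 2 (filtered_sum (2 ^ J) g)")
    case (real r)
    then have "ennreal (r\<^sup>2) = ennreal (energy g J)" using sq(1)[of J] by (simp add: ennreal_power)
    then have "r\<^sup>2 = energy g J" using s0 by (simp add: ennreal_inj)
    then have "sqrt (energy g J) = r" using real by (intro real_sqrt_unique) auto
    then show ?thesis using real by simp
  next
    case top
    then show ?thesis using sq(1)[of J] by (simp add: power2_eq_square)
  qed
  have "(\<lambda>J. sqrt (energy g J)) \<longlonglongrightarrow> G"
  proof (rule LIMSEQ_I)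
    fix \<epsilon> :: real assume \<epsilon>: "0 < \<epsilon>"
    have "\<forall>\<^sub>F J in sequentially. Lp_norm M 2 (\<lambda>x. g x - filtered_sum (2 ^ J) g x) < ennreal \<epsilon>"
      using filtered_sum_converges[OF g p2] by (rule order_tendstoD(2)) (use \<epsilon> in simp)
    then obtain J0 where J0: "\<And>J. J \<ge> J0 \<Longrightarrow> Lp_norm M 2 (\<lambda>x. g x - filtered_sum (2 ^ J) g x) < ennreal \<epsilon>"
      by (auto simp: eventually_sequentially)
    have "norm (sqrt (energy g J) - G) < \<epsilon>" if J: "J \<ge> J0" for J
    proof -
      obtain e where e: "e \<ge> 0" "Lp_norm M 2 (\<lambda>x. g x - filtered_sum (2 ^ J) g x) = ennreal e" "e < \<epsilon>"
        using J0[OF J] by (cases "Lp_norm M 2 (\<lambda>x. g x - filtered_sum (2 ^ J) g x)") (auto simp: ennreal_less_iff)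
      have "Lp_norm M 2 (\<lambda>x. g x - (g x - filtered_sum (2 ^ J) g x)) \<le> Lp_norm M 2 g + Lp_norm M 2 (\<lambda>x. g x - filtered_sum (2 ^ J) g x)"
        using p2 by (intro Lp_norm_triangle_minus) measurable
      then have "ennreal (sqrt (energy g J)) \<le> ennreal (G + e)"
        using G e by (simp add: filtered_sum_norm)
      then have 1: "sqrt (energy g J) \<le> G + e" using G e by (simp add: ennreal_le_iff del: ennreal_plus)
      have "Lp_norm M 2 (\<lambda>x. filtered_sum (2 ^ J) g x + (g x - filtered_sum (2 ^ J) g x)) \<le> Lp_norm M 2 (filtered_sum (2 ^ J) g) + Lp_norm M 2 (\<lambda>x. g x - filtered_sum (2 ^ J) g x)"
        using p2 by (intro Lp_norm_triangle) measurable
      then have "ennreal G \<le> ennreal (sqrt (energy g J) + e)"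
        using G e s0 by (simp add: filtered_sum_norm)
      then have 2: "G \<le> sqrt (energy g J) + e" using e s0 by (simp add: ennreal_le_iff del: ennreal_plus)
      show ?thesis using 1 2 e by (auto simp: abs_less_iff)
    qed
    then show "\<exists>no. \<forall>n\<ge>no. norm (sqrt (energy g n) - G) < \<epsilon>" by blast
  qed
  then have "(\<lambda>J. (sqrt (energy g J))\<^sup>2) \<longlonglongrightarrow> G\<^sup>2" by (rule tendsto_power)
  then have "(\<lambda>J. energy g J) \<longlonglongrightarrow> G\<^sup>2" using s0 by simp
  then have lim: "(\<lambda>J. ennreal (energy g J)) \<longlonglongrightarrow> (Lp_norm M 2 g)\<^sup>2"
    unfolding G(2) ennreal_power[OF G(1)] by (rule tendsto_ennrealI)
  have "(\<lambda>J. \<Sum>j<J. (Lp_norm M 2 (dyadic_part j g))\<^sup>2) \<longlonglongrightarrow> ?T"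
    by (intro summable_LIMSEQ summableI)
  then have limT: "(\<lambda>J. \<Sum>j<Suc J. (Lp_norm M 2 (dyadic_part j g))\<^sup>2) \<longlonglongrightarrow> ?T"
    by (rule LIMSEQ_Suc)
  show "?T \<le> (Lp_norm M 2 g)\<^sup>2"
    by (rule LIMSEQ_le[OF limT lim]) (use sq(2) in blast)
  have "ennreal (energy g J) \<le> 5 * ?T" for J
  proof -
    have "ennreal (energy g J) \<le> 2 * (\<Sum>j<Suc J. (Lp_norm M 2 (dyadic_part j g))\<^sup>2)" by (rule sq(3))
    \<comment> \<open>The argument yields the factor 2, which is weakened here to the 5 of the
      theorem.\<close>
    also have "\<dots> \<le> 5 * ?T" by (intro mult_mono sum_le_suminf) auto
    finally show ?thesis .
  qed
  then show "(Lp_norm M 2 g)\<^sup>2 \<le> 5 * ?T"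
    by (intro LIMSEQ_le_const2[OF lim]) blast
qed

end

section \<open>From the operator U to coefficients, and the theorem itself\<close>

lemma coeff_image:
  assumes ortho: "orthonormal_system M \<phi>" "orthonormal_system M \<psi>"
    and U: "partial_isometry M U" "L2_adjoint M U Uadj" and \<psi>: "\<And>k. AE x in M. \<psi> k x = Uadj (\<phi> k) x"
    and im: "is_image M \<phi> \<psi> U f g" and g: "g \<in> borel_measurable M"
  shows "coeff M \<phi> g k = coeff M \<psi> f k"
\<comment> \<open>Outside L2 the equality of coefficients is the meaning of U f; inside L2 it is the
  adjoint relation tested on \<phi>_k.\<close>
proof (cases "f \<in> Lp_space M 2")
  case False
  then show ?thesis using im by (simp add: is_image_def)
next
  case True
  have \<phi>2: "\<phi> k \<in> Lp_space M 2" "\<psi> k \<in> Lp_space M 2" using ortho by (auto simp: orthonormal_system_def)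
  have U2: "U f \<in> Lp_space M 2" using U True by (auto simp: partial_isometry_def L2_bounded_operator_def)
  have V2: "Uadj (\<phi> k) \<in> Lp_space M 2" using U \<phi>2 by (auto simp: L2_adjoint_def L2_bounded_operator_def)
  have [measurable]: "g \<in> borel_measurable M" "f \<in> borel_measurable M" "U f \<in> borel_measurable M"
    "Uadj (\<phi> k) \<in> borel_measurable M" "\<phi> k \<in> borel_measurable M" "\<psi> k \<in> borel_measurable M"
    using g True U2 V2 \<phi>2 by (auto simp: Lp_space_def)
  have "AE x in M. g x = U f x" using im True by (simp add: is_image_def)
  then have "coeff M \<phi> g k = L2_inner M (U f) (\<phi> k)"
    unfolding coeff_def L2_inner_def by (intro integral_cong_AE) (measurable, auto)
  also have "\<dots> = L2_inner M f (Uadj (\<phi> k))"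
    using U \<phi>2 True by (auto simp: L2_adjoint_def)
  also have "\<dots> = coeff M \<psi> f k"
    unfolding coeff_def L2_inner_def using \<psi>[of k] by (intro integral_cong_AE) (measurable, auto)
  finally show ?thesis .
qed

lemma heat_system_of_admissible:
  fixes d :: "'a::topological_space \<Rightarrow> 'a \<Rightarrow> real"
  assumes adm: "admissible_system d M lam \<phi>" and ortho: "orthonormal_system M \<phi>" and q: "q > 0"
    and gauss: "gaussian_upper_bound d lam \<phi> q" and balls: "ball_measure_bound d M q"
  obtains c1 c2 cb where "heat_system d M lam \<phi> q c1 c2 cb"
proof -
  obtain c1 c2 where c: "c1 > 0" "c2 > 0" and gb: "\<forall>t x y. 0 < t \<and> t \<le> 1 \<longrightarrow>
        cmod (heat_kernel lam \<phi> t x y) \<le> c1 * t powr (- q / 2) * exp (- c2 * (d x y)\<^sup>2 / t)"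
    using gauss unfolding gaussian_upper_bound_def by blast
  obtain cb where cb: "cb > 0" "\<And>x r. r > 0 \<Longrightarrow> outer_measure_of M (qball d x r) \<le> ennreal (cb * r powr q)"
    using balls unfolding ball_measure_bound_def by blast
  have sp: "space M = UNIV"
    using adm sets_eq_imp_space_eq[of M borel] by (simp add: admissible_system_def)
  have "quasi_metric d" using adm by (simp add: admissible_system_def locally_compact_quasi_metric_space_def)
  then have d: "d x x = 0" "d x y = d y x" for x y by (auto simp: quasi_metric_def)
  have "heat_system d M lam \<phi> q c1 c2 cb"
  proof (rule heat_system.intro)
    \<comment> \<open>The outer measure of a ball is attained by a measurable superset, which is
      taken as the hull.\<close>
    show "\<exists>E\<in>sets M. qball d x r \<subseteq> E \<and> emeasure M E \<le> ennreal (cb * r powr q)" if "r > 0" for x r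
      using outer_measure_of_attain[of "qball d x r" M] cb(2)[OF that, of x] sp by auto
    show "cmod (heat_kernel lam \<phi> t x y) \<le> c1 * t powr (- q / 2) * exp (- c2 * (d x y)\<^sup>2 / t)"
      if "0 < t" "t \<le> 1" for t x y using gb that by blast
    show "(LINT x|M. \<phi> j x * cnj (\<phi> k x)) = (if j = k then 1 else 0)" for j k
      using ortho by (simp add: orthonormal_system_def L2_inner_def)
    show "summable (\<lambda>k. complex_of_real (exp (- (lam k)\<^sup>2 * t)) * \<phi> k x * cnj (\<phi> k y))" if "t > 0" for t x y
      using gauss that by (simp add: gaussian_upper_bound_def)
    show "d x y = d y x" for x y by (rule d(2))
  qed (use adm sp d(1) c cb(1) q in \<open>simp_all add: admissible_system_def\<close>)
  then show ?thesis by (rule that)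
qed

theorem theorem2p1:
  fixes d :: "'a::topological_space \<Rightarrow> 'a \<Rightarrow> real"
    and M :: "'a measure"
    and lam :: "nat \<Rightarrow> real"
    and \<phi> \<psi> :: "nat \<Rightarrow> 'a \<Rightarrow> complex"
    and U Uadj :: "('a \<Rightarrow> complex) \<Rightarrow> ('a \<Rightarrow> complex)"
    and h :: "real \<Rightarrow> real"
    and q :: real
    and p :: ennreal
  assumes "admissible_system d M lam \<phi>"
    and "orthonormal_system M \<phi>"
    and "q > 0"
    and "gaussian_upper_bound d lam \<phi> q"
    and "partial_isometry M U"
    and "L2_adjoint M U Uadj"
    and "\<And>k. AE x in M. \<psi> k x = Uadj (\<phi> k) x"
    and "admissible_system d M lam \<psi>"
    and "orthonormal_system M \<psi>"
    and "ball_measure_bound d M q"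
    and "1 \<le> p"
    and "low_pass_filter h"
    and "sufficiently_smooth q h"
  shows
    "(\<exists>c::real. c > 0 \<and>
        (\<forall>f Uf. f \<in> L1_plus_Linf M \<and> is_image M \<phi> \<psi> U f Uf \<and> Uf \<in> X_space M lam \<phi> p \<longrightarrow>
          (\<forall>n::real. n \<ge> 1 \<longrightarrow>
             approx_error M lam \<phi> n p Uf \<le> Lp_norm M p (\<lambda>x. Uf x - sigma_op M lam \<phi> \<psi> h n f x) \<and>
             Lp_norm M p (\<lambda>x. Uf x - sigma_op M lam \<phi> \<psi> h n f x)
               \<le> ennreal c * approx_error M lam \<phi> (n / 2) p Uf))) \<and>
     (\<forall>f Uf. f \<in> L1_plus_Linf M \<and> is_image M \<phi> \<psi> U f Uf \<and> Uf \<in> X_space M lam \<phi> p \<longrightarrow>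
        (\<lambda>J. Lp_norm M p (\<lambda>x. Uf x - (\<Sum>j<J. tau_op M lam \<phi> \<psi> h j f x))) \<longlonglongrightarrow> 0 \<and>
        (p = 2 \<longrightarrow>
           (\<Sum>j. (Lp_norm M 2 (tau_op M lam \<phi> \<psi> h j f))\<^sup>2) \<le> (Lp_norm M 2 Uf)\<^sup>2 \<and>
           (Lp_norm M 2 Uf)\<^sup>2 \<le> 5 * (\<Sum>j. (Lp_norm M 2 (tau_op M lam \<phi> \<psi> h j f))\<^sup>2)) \<and>
        (\<forall>(\<rho>::ennreal) (\<gamma>::real). 0 < \<rho> \<and> 0 < \<gamma> \<longrightarrow>
           (Uf \<in> besov_space M lam \<phi> p \<rho> \<gamma> \<longleftrightarrow>
            (\<lambda>j. Lp_norm M p (tau_op M lam \<phi> \<psi> h j f)) \<in> b_space \<rho> \<gamma>)))"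
proof -
  obtain c1 c2 cb where "heat_system d M lam \<phi> q c1 c2 cb"
    using heat_system_of_admissible assms(1-4,10) by metis
  then interpret H: heat_system d M lam \<phi> q c1 c2 cb .
  from H.filter_kernel_L1[OF assms(12,13)] obtain Ck where "Ck > 0"
    and "\<forall>n\<ge>1. \<forall>x. (\<integral>\<^sup>+y. ennreal (cmod (H.filter_kernel h n x y)) \<partial>M) \<le> ennreal Ck"
    by (elim exE conjE)
  then interpret filtered_system d M lam \<phi> q c1 c2 cb h Ck
    using assms(12) by unfold_locales auto
  \<comment> \<open>This removes f, \<psi> and U from the problem: the operators of the theorem
    become filtered sums and dyadic parts of \<open>Uf\<close>.\<close>
  have co: "coeff M \<phi> Uf k = coeff M \<psi> f k"
    if "is_image M \<phi> \<psi> U f Uf" "Uf \<in> X_space M lam \<phi> p" for f Uf k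
    using that by (intro coeff_image[OF assms(2,9,5,6,7)]) (auto simp: X_space_def Lp_space_def)
  show ?thesis
  proof (intro conjI exI[of _ "1 + Ck"] allI impI; (elim conjE)?)
    show "1 + Ck > 0" using Ck by simp
  next
    fix f Uf and n :: real
    assume *: "is_image M \<phi> \<psi> U f Uf" "Uf \<in> X_space M lam \<phi> p" and n: "1 \<le> n"
    have s: "sigma_op M lam \<phi> \<psi> h n f = filtered_sum n Uf"
      using n by (intro sigma_op_eq co[OF *]) simp
    show "approx_error M lam \<phi> n p Uf \<le> Lp_norm M p (\<lambda>x. Uf x - sigma_op M lam \<phi> \<psi> h n f x)"
      unfolding s by (rule approx_error_le_filtered_sum)
    show "Lp_norm M p (\<lambda>x. Uf x - sigma_op M lam \<phi> \<psi> h n f x) \<le> ennreal (1 + Ck) * approx_error M lam \<phi> (n / 2) p Uf"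
      unfolding s using n *(2) assms(11) by (intro filtered_sum_error_le) (simp_all add: X_space_def)
  next
    fix f Uf assume *: "is_image M \<phi> \<psi> U f Uf" "Uf \<in> X_space M lam \<phi> p"
    note t = tau_op_eq[OF co[OF *]]
    show "(\<lambda>J. Lp_norm M p (\<lambda>x. Uf x - (\<Sum>j<J. tau_op M lam \<phi> \<psi> h j f x))) \<longlonglongrightarrow> 0"
      unfolding t using *(2) assms(11) by (rule dyadic_part_series_converges)
    show "(\<Sum>j. (Lp_norm M 2 (tau_op M lam \<phi> \<psi> h j f))\<^sup>2) \<le> (Lp_norm M 2 Uf)\<^sup>2" if "p = 2"
      unfolding t using *(2) that by (intro dyadic_part_square_function(1)) simp
    show "(Lp_norm M 2 Uf)\<^sup>2 \<le> 5 * (\<Sum>j. (Lp_norm M 2 (tau_op M lam \<phi> \<psi> h j f))\<^sup>2)" if "p = 2"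
      unfolding t using *(2) that by (intro dyadic_part_square_function(2)) simp
    show "(Uf \<in> besov_space M lam \<phi> p \<rho> \<gamma>) = ((\<lambda>j. Lp_norm M p (tau_op M lam \<phi> \<psi> h j f)) \<in> b_space \<rho> \<gamma>)"
      if "0 < \<rho>" "0 < \<gamma>" for \<rho> :: ennreal and \<gamma> :: real
      unfolding t using *(2) assms(11) that by (rule besov_iff_dyadic_part)
  qed
qed

end
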